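(* Let $F_n$ be the free group of rank $n$. For any $m\ge 2$, we have $\mathcal{D}^m_{F_n}(k)=\mathcal{A}_{F_n}(k)$ for any $1\le k\le 4$.
   Context: For a group $G$ generated by $x_1,\dots,x_n$ and $m\ge 2$, let $R^m(G)=\mathrm{Hom}(G,\mathrm{SL}(m,\mathbf{C}))$. For $x\in G$ and $1\le i,j\le m$, let $a_{ij}(x):R^m(G)\to\mathbf{C}$ be the function $\rho\mapsto$ the $(i,j)$-component of $\rho(x)$. Let $\mathfrak{R}^m_{\mathbf{Q}}(G)$ be the $\mathbf{Q}$-subalgebra of the algebra of all functions $R^m(G)\to\mathbf{C}$ (pointwise operations) generated by all $a_{ij}(x)$. Put $s_{ij}(x)=a_{ij}(x)-\delta_{ij}$ and let $\mathfrak{J}_G$ be the ideal of $\mathfrak{R}^m_{\mathbf{Q}}(G)$ generated by $s_{ij}(x_l)$ for $1\le i,j\le m$, $1\le l\le n$. $\mathrm{Aut}\,G$ acts on $G$ from the right, written $x^\sigma$, and acts from the right on $\mathfrak{R}^m_{\mathbf{Q}}(G)$ by algebra automorphisms with $a_{ij}(x)^\sigma=a_{ij}(x^\sigma)$; the ideal $\mathfrak{J}_G$ and its powers are invariant. Define $\mathcal{D}^m_G(k)=\mathrm{Ker}(\mathrm{Aut}\,G\to\mathrm{Aut}(\mathfrak{J}_G/\mathfrak{J}_G^{k+1}))$. Let $\Gamma_G(1)=G$, $\Gamma_G(k)=[\Gamma_G(k-1),G]$ be the lower central series, and define $\mathcal{A}_G(k)=\mathrm{Ker}(\mathrm{Aut}\,G\to\mathrm{Aut}(G/\Gamma_G(k+1)))$.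 For $G=F_n$, take $x_1,\dots,x_n$ to be a basis of $F_n$. *)

theory Defs
  imports "HOL-Analysis.Analysis" "HOL-Algebra.Algebra"
begin

text \<open>
  A letter \<open>(l, True)\<close> stands for the generator \<open>x\<^sub>l\<close> and \<open>(l, False)\<close> for its inverse;
  a word is reduced if no two adjacent letters cancel.
\<close>

definition reduced_words :: "nat \<Rightarrow> (nat \<times> bool) list set" where
  "reduced_words n =
     {w. fst ` set w \<subseteq> {1..n} \<and> successively (\<lambda>(l, b) (l', b'). l = l' \<longrightarrow> b = b') w}"

definition eval_word :: "('a, 'b) monoid_scheme \<Rightarrow> (nat \<Rightarrow> 'a) \<Rightarrow> (nat \<times> bool) list \<Rightarrow> 'a" where
  "eval_word G x w = foldr (\<lambda>(l, b) g. (if b then x l else inv\<^bsub>G\<^esub> x l) \<otimes>\<^bsub>G\<^esub> g) w \<one>\<^bsub>G\<^esub>"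

text \<open>
  \<open>G\<close> is a free group of rank \<open>n\<close> with basis \<open>x 1, \<dots>, x n\<close>: every element of \<open>G\<close> is the value
  of exactly one reduced word in the basis.  (The universal property would have to quantify over
  groups on all types.)
\<close>

definition free_group_with_basis ::
    "('a, 'b) monoid_scheme \<Rightarrow> nat \<Rightarrow> (nat \<Rightarrow> 'a) \<Rightarrow> bool" where
  "free_group_with_basis G n x \<longleftrightarrow>
     group G \<and> x ` {1..n} \<subseteq> carrier G \<and>
     bij_betw (eval_word G x) (reduced_words n) (carrier G)"

text \<open>The lower central series, indexed from 1; index 0 only makes the function total.\<close>

fun lower_central :: "('a, 'b) monoid_scheme \<Rightarrow> nat \<Rightarrow> 'a set" where
  "lower_central G 0 = carrier G"
| "lower_central G (Suc 0) = carrier G"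
| "lower_central G (Suc (Suc k)) =
     generate G {a \<otimes>\<^bsub>G\<^esub> b \<otimes>\<^bsub>G\<^esub> inv\<^bsub>G\<^esub> a \<otimes>\<^bsub>G\<^esub> inv\<^bsub>G\<^esub> b | a b.
                   a \<in> lower_central G (Suc k) \<and> b \<in> carrier G}"

text \<open>
  Automorphisms act on a quotient by an invariant normal subgroup by sending a coset to its image.
  Elements of \<open>AutoGroup G\<close> are extensional functions.  The multiplication of \<open>AutoGroup\<close> is that
  of left actions; for right actions one has to take the opposite group, which does not affect
  kernels.
\<close>

definition andreadakis :: "('a, 'b) monoid_scheme \<Rightarrow> nat \<Rightarrow> ('a \<Rightarrow> 'a) set" where
  "andreadakis G k =
     (let Q = G Mod lower_central G (k + 1)
      in kernel (AutoGroup G) (AutoGroup Q) (\<lambda>\<sigma>. \<lambda>C\<in>carrier Q. \<sigma> ` C))"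

definition SL :: "(complex^'m^'m) monoid" where
  "SL = \<lparr>carrier = {A. det A = 1}, mult = (**), one = mat 1\<rparr>"

text \<open>Homomorphisms are taken extensional, so that each is represented by exactly one function.\<close>

definition rep_variety :: "('a, 'b) monoid_scheme \<Rightarrow> ('a \<Rightarrow> complex^'m^'m) set" where
  "rep_variety G = hom G SL \<inter> extensional (carrier G)"

definition fun_ring :: "'r set \<Rightarrow> ('r \<Rightarrow> complex) ring" where
  "fun_ring S = \<lparr>carrier = extensional S,
     mult = (\<lambda>f g. \<lambda>r\<in>S. f r * g r), one = (\<lambda>r\<in>S. 1),
     ring.zero = (\<lambda>r\<in>S. 0), ring.add = (\<lambda>f g. \<lambda>r\<in>S. f r + g r)\<rparr>"

definition rat_subalgebra :: "'r set \<Rightarrow> ('r \<Rightarrow> complex) set \<Rightarrow> bool" where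
  "rat_subalgebra S V \<longleftrightarrow>
     subring V (fun_ring S) \<and> (\<forall>q::rat. \<forall>f\<in>V. (\<lambda>r\<in>S. of_rat q * f r) \<in> V)"

definition coord ::
    "('a, 'b) monoid_scheme \<Rightarrow> 'm \<Rightarrow> 'm \<Rightarrow> 'a \<Rightarrow> ('a \<Rightarrow> complex^'m^'m) \<Rightarrow> complex" where
  "coord G i j g = (\<lambda>\<rho>\<in>rep_variety G. \<rho> g $ i $ j)"

definition rep_algebra ::
    "('a, 'b) monoid_scheme \<Rightarrow> (('a \<Rightarrow> complex^'m^'m) \<Rightarrow> complex) ring" where
  "rep_algebra G = (fun_ring (rep_variety G))
     \<lparr>carrier := rat_subalgebra (rep_variety G) hull {coord G i j g | i j g. g \<in> carrier G}\<rparr>"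

definition shifted_coord ::
    "('a, 'b) monoid_scheme \<Rightarrow> 'm \<Rightarrow> 'm \<Rightarrow> 'a \<Rightarrow> ('a \<Rightarrow> complex^'m^'m) \<Rightarrow> complex" where
  "shifted_coord G i j g =
     (\<lambda>\<rho>\<in>rep_variety G. coord G i j g \<rho> - (if i = j then 1 else 0))"

definition rep_ideal ::
    "('a, 'b) monoid_scheme \<Rightarrow> nat \<Rightarrow> (nat \<Rightarrow> 'a) \<Rightarrow> (('a \<Rightarrow> complex^'m^'m) \<Rightarrow> complex) set" where
  "rep_ideal G n x = Idl\<^bsub>rep_algebra G\<^esub> {shifted_coord G i j (x l) | i j l. l \<in> {1..n}}"

text \<open>
  The right action of \<open>Aut G\<close> on functions on the representation variety: precomposition with
  \<open>\<rho> \<mapsto> \<rho> \<circ> \<sigma>\<close>.  By the lemmas below this is the action by ring homomorphisms with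
  \<open>a\<^sub>i\<^sub>j(g)\<^sup>\<sigma> = a\<^sub>i\<^sub>j(g\<^sup>\<sigma>)\<close>.
\<close>

definition aut_act ::
    "('a, 'b) monoid_scheme \<Rightarrow> ('a \<Rightarrow> 'a)
       \<Rightarrow> (('a \<Rightarrow> complex^'m^'m) \<Rightarrow> complex) \<Rightarrow> ('a \<Rightarrow> complex^'m^'m) \<Rightarrow> complex" where
  "aut_act G \<sigma> f = (\<lambda>\<rho>\<in>rep_variety G. f (compose (carrier G) \<rho> \<sigma>))"

lemma compose_rep_variety:
  assumes "group G" "\<sigma> \<in> carrier (AutoGroup G)" "\<rho> \<in> rep_variety G"
  shows "compose (carrier G) \<rho> \<sigma> \<in> rep_variety G"
  using assms
  by (auto simp: AutoGroup_def auto_def rep_variety_def hom_def compose_def Pi_iff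
      group.is_monoid monoid.m_closed)

lemma aut_act_coord:
  assumes "group G" "\<sigma> \<in> carrier (AutoGroup G)" "g \<in> carrier G"
  shows "aut_act G \<sigma> (coord G i j g) = coord G i j (\<sigma> g)"
  using assms(3) compose_rep_variety[OF assms(1,2)]
  by (auto simp: aut_act_def coord_def compose_def fun_eq_iff restrict_def)

lemma aut_act_hom:
  assumes "group G" "\<sigma> \<in> carrier (AutoGroup G)"
  shows "aut_act G \<sigma> \<in> ring_hom (fun_ring (rep_variety G)) (fun_ring (rep_variety G))"
  by (rule ring_hom_memI)
    (auto simp: aut_act_def fun_ring_def fun_eq_iff extensional_def compose_rep_variety[OF assms])

text \<open>
  The kernel of \<open>Aut G \<rightarrow> Aut(J / J\<^sup>k\<^sup>+\<^sup>1)\<close>, where \<open>J\<close> is the ideal above and the quotient is taken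
  of additive groups; the matrix size is the cardinality of the index type \<open>'m\<close>.
\<close>

definition rep_filtration ::
    "'m::finite itself \<Rightarrow> ('a, 'b) monoid_scheme \<Rightarrow> nat \<Rightarrow> (nat \<Rightarrow> 'a) \<Rightarrow> nat \<Rightarrow> ('a \<Rightarrow> 'a) set" where
  "rep_filtration M G n x k =
     (let A = rep_algebra G :: (('a \<Rightarrow> complex^'m^'m) \<Rightarrow> complex) ring;
          J = rep_ideal G n x;
          Q = ((add_monoid A)\<lparr>carrier := J\<rparr>) Mod (J [^]\<^bsub>ideals_set A\<^esub> (k + 1))
      in kernel (AutoGroup G) (AutoGroup Q) (\<lambda>\<sigma>. \<lambda>C\<in>carrier Q. aut_act G \<sigma> ` C))"

end

theory Submission
  imports Defs
begin

text \<open>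
  Both filtrations measure how close an automorphism \<open>\<sigma>\<close> is to the identity. One looks at
  \<open>x\<inverse> \<sigma>(x)\<close> in the lower central series, the other at the order to which the entries of
  \<open>\<rho>(\<sigma>(x)) - \<rho>(x)\<close> vanish at the trivial representation, as functions of \<open>\<rho>\<close>.

  One inclusion holds in every weight and for every finitely generated group. Since
  \<open>\<rho>([u, v]) - 1 = (UV - VU) \<rho>(u\<inverse> v\<inverse>)\<close> with \<open>U = \<rho>(u) - 1\<close> and \<open>V = \<rho>(v) - 1\<close>, the entries of
  \<open>\<rho>(g) - 1\<close> lie in \<open>J\<^sup>k\<close> for \<open>g\<close> in the \<open>k\<close>-th term of the lower central series
  (\<open>shifted_coord_lower_central\<close>). Hence an automorphism that is trivial modulo the \<open>(k+1)\<close>-st term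
  moves every function in the algebra by an element of \<open>J\<^sup>k\<^sup>+\<^sup>1\<close> (\<open>aut_act_diff_in_J_power\<close>).

  For the other inclusion, let \<open>g = x\<^sub>l\<inverse> \<sigma>(x\<^sub>l)\<close>, so that the entries of \<open>\<rho>(g) - 1\<close> lie in
  \<open>J\<^sup>k\<^sup>+\<^sup>1\<close>, and climb the lower central series: if \<open>g\<close> is in the \<open>j\<close>-th term with \<open>j \<le> k\<close>, it is in the
  next one. Modulo the next term, \<open>g\<close> is an integral combination of basic commutators of weight \<open>j\<close>
  (\<open>lower_central_eq_hall_span\<close>). Choose curves of matrices through the identity with derivatives
  \<open>Y\<^sub>1, \<dots>, Y\<^sub>n\<close> in a copy of \<open>sl\<^sub>2\<close>, and send the basis of the free group to them. Along this
  curve of representations \<open>\<rho>(g) - 1\<close> starts, in order \<open>j\<close>, with the value at \<open>Y\<close> of the same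
  combination of Lie brackets, and it vanishes to order \<open>k + 1\<close>. So the combination of brackets
  is zero on \<open>sl\<^sub>2\<close>. In weights up to four the basic brackets are linearly independent as functions
  on \<open>sl\<^sub>2\<close> (\<open>hall_basis_independent\<close>), so all coefficients are zero. This is where the bound
  enters, as \<open>sl\<^sub>2\<close> satisfies Lie identities from degree five on.

  The independence has two parts. The left-normed basic brackets form a basis of the free metabelian
  Lie ring and are already independent on the Borel subalgebra of \<open>sl\<^sub>2\<close>, where they are monomials up
  to antisymmetry. The Borel subalgebra is metabelian and kills the remaining basic brackets,
  \<open>[[x\<^sub>i, x\<^sub>j], [x\<^sub>k, x\<^sub>l]]\<close> in weight four. These are separated by a few explicit values.
\<close>

section \<open>Commutators and the lower central series\<close>

definition gcomm :: "('a, 'b) monoid_scheme \<Rightarrow> 'a \<Rightarrow> 'a \<Rightarrow> 'a" where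
  "gcomm G a b = a \<otimes>\<^bsub>G\<^esub> b \<otimes>\<^bsub>G\<^esub> inv\<^bsub>G\<^esub> a \<otimes>\<^bsub>G\<^esub> inv\<^bsub>G\<^esub> b"

declare lower_central.simps(3) [simp del]

context group
begin

lemma inv_mult_cancel_left: "x \<in> carrier G \<Longrightarrow> y \<in> carrier G \<Longrightarrow> inv x \<otimes> (x \<otimes> y) = y"
  by (simp add: m_assoc[symmetric])

lemma mult_inv_cancel_left: "x \<in> carrier G \<Longrightarrow> y \<in> carrier G \<Longrightarrow> x \<otimes> (inv x \<otimes> y) = y"
  by (simp add: m_assoc[symmetric])

text \<open>
  Simplification with these rules brings a word into reduced form, and so decides identities that hold
  in all groups, such as the one of Hall and Witt.
\<close>

lemmas group_word_simps = m_assoc inv_mult_group inv_mult_cancel_left mult_inv_cancel_left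

lemma gcomm_closed [simp]:
  "a \<in> carrier G \<Longrightarrow> b \<in> carrier G \<Longrightarrow> gcomm G a b \<in> carrier G"
  by (simp add: gcomm_def)

lemma gcomm_self: "a \<in> carrier G \<Longrightarrow> gcomm G a a = \<one>"
  by (simp add: gcomm_def group_word_simps)

lemma inv_gcomm: "a \<in> carrier G \<Longrightarrow> b \<in> carrier G \<Longrightarrow> inv (gcomm G a b) = gcomm G b a"
  by (simp add: gcomm_def group_word_simps)

lemma conj_eq_gcomm_mult:
  "a \<in> carrier G \<Longrightarrow> b \<in> carrier G \<Longrightarrow> a \<otimes> b \<otimes> inv a = gcomm G a b \<otimes> b"
  by (simp add: gcomm_def group_word_simps)

lemma hall_witt:
  assumes "x \<in> carrier G" "y \<in> carrier G" "z \<in> carrier G"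
  shows "gcomm G (gcomm G x y) (y \<otimes> z \<otimes> inv y) \<otimes> gcomm G (gcomm G y z) (z \<otimes> x \<otimes> inv z)
           \<otimes> gcomm G (gcomm G z x) (x \<otimes> y \<otimes> inv x) = \<one>"
  using assms by (simp add: gcomm_def group_word_simps)

lemma normal_gcomm_commute:
  assumes "S \<lhd> G" "a \<in> carrier G" "b \<in> carrier G"
  shows "gcomm G a b \<in> S \<longleftrightarrow> gcomm G b a \<in> S"
  using assms subgroup.m_inv_closed[OF normal_imp_subgroup[OF assms(1)]] inv_gcomm
  by metis

lemma normal_conj_mem:
  assumes "S \<lhd> G" "g \<in> carrier G" "s \<in> S"
  shows "g \<otimes> s \<otimes> inv g \<in> S"
  using assms by (simp add: normal.inv_op_closed2)

lemma normal_gcomm_mem: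
  assumes "S \<lhd> G" "s \<in> S" "g \<in> carrier G"
  shows "gcomm G s g \<in> S"
proof -
  interpret S: normal S G by fact
  have s: "s \<in> carrier G" using assms by auto
  have "gcomm G s g = s \<otimes> (g \<otimes> inv s \<otimes> inv g)"
    using s assms by (simp add: gcomm_def m_assoc)
  thus ?thesis
    using normal_conj_mem[OF assms(1,3)] assms by simp
qed

lemma subgroup_centralizer_mod:
  assumes "S \<lhd> G" "v \<in> carrier G"
  shows "subgroup {u \<in> carrier G. gcomm G u v \<in> S} G"
proof -
  interpret S: normal S G by fact
  show ?thesis
  proof (rule subgroupI)
    show "{u \<in> carrier G. gcomm G u v \<in> S} \<noteq> {}"
      using assms S.one_closed by (auto simp: gcomm_def intro!: exI[of _ \<one>])
  next
    fix a assume a: "a \<in> {u \<in> carrier G. gcomm G u v \<in> S}"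
    have "gcomm G (inv a) v = inv a \<otimes> inv (gcomm G a v) \<otimes> inv (inv a)"
      using a assms by (simp add: gcomm_def group_word_simps)
    thus "inv a \<in> {u \<in> carrier G. gcomm G u v \<in> S}"
      using a assms normal_conj_mem[OF assms(1), of "inv a" "inv (gcomm G a v)"] by simp
  next
    fix a b assume a: "a \<in> {u \<in> carrier G. gcomm G u v \<in> S}"
      and b: "b \<in> {u \<in> carrier G. gcomm G u v \<in> S}"
    have "gcomm G (a \<otimes> b) v = a \<otimes> gcomm G b v \<otimes> inv a \<otimes> gcomm G a v"
      using a b assms by (simp add: gcomm_def group_word_simps)
    thus "a \<otimes> b \<in> {u \<in> carrier G. gcomm G u v \<in> S}"
      using a b assms normal_conj_mem[OF assms(1), of a "gcomm G b v"] by simp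
  qed auto
qed

lemma subgroup_centralizer_mod':
  assumes "S \<lhd> G" "v \<in> carrier G"
  shows "subgroup {u \<in> carrier G. gcomm G v u \<in> S} G"
proof -
  have "{u \<in> carrier G. gcomm G v u \<in> S} = {u \<in> carrier G. gcomm G u v \<in> S}"
    using normal_gcomm_commute[OF assms(1)] assms(2) by blast
  thus ?thesis using subgroup_centralizer_mod[OF assms] by simp
qed

lemma lower_central_Suc:
  "k \<ge> 1 \<Longrightarrow> lower_central G (Suc k) =
     generate G {gcomm G a b | a b. a \<in> lower_central G k \<and> b \<in> carrier G}"
  by (cases k) (simp_all add: gcomm_def lower_central.simps(3))

lemma lower_central_normal: "lower_central G k \<lhd> G"
proof (induction k)
  case (Suc k)
  show ?case
  proof (cases "k \<ge> 1")
    case True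
    interpret N: normal "lower_central G k" G by fact
    show ?thesis unfolding lower_central_Suc[OF True]
    proof (rule normal_generateI)
      fix h g
      assume "h \<in> {gcomm G a b | a b. a \<in> lower_central G k \<and> b \<in> carrier G}"
        and g: "g \<in> carrier G"
      then obtain a b where h: "h = gcomm G a b" and a: "a \<in> lower_central G k"
        and b: "b \<in> carrier G"
        by blast
      have "g \<otimes> h \<otimes> inv g = gcomm G (g \<otimes> a \<otimes> inv g) (g \<otimes> b \<otimes> inv g)"
        using g N.mem_carrier[OF a] b by (simp add: h gcomm_def group_word_simps)
      moreover have "g \<otimes> a \<otimes> inv g \<in> lower_central G k"
        using normal_conj_mem[OF Suc.IH g a] .
      ultimately show
        "g \<otimes> h \<otimes> inv g \<in> {gcomm G a b | a b. a \<in> lower_central G k \<and> b \<in> carrier G}"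
        using g b by blast
    qed auto
  qed (use subgroup_self in \<open>auto simp: normal_inv_iff not_le\<close>)
qed (use subgroup_self in \<open>auto simp: normal_inv_iff\<close>)

lemma lower_central_subgroup: "subgroup (lower_central G k) G"
  using lower_central_normal by (rule normal_imp_subgroup)

lemma lower_central_carrier: "u \<in> lower_central G k \<Longrightarrow> u \<in> carrier G"
  by (rule subgroup.mem_carrier[OF lower_central_subgroup])

lemma gcomm_lower_central_carrier:
  "k \<ge> 1 \<Longrightarrow> a \<in> lower_central G k \<Longrightarrow> b \<in> carrier G \<Longrightarrow> gcomm G a b \<in> lower_central G (Suc k)"
  unfolding lower_central_Suc by (rule generate.incl) blast

lemma lower_central_Suc_subset: "lower_central G (Suc k) \<subseteq> lower_central G k"
proof (cases "k \<ge> 1")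
  case True
  show ?thesis unfolding lower_central_Suc[OF True]
    by (rule generate_subgroup_incl)
      (auto intro: lower_central_subgroup normal_gcomm_mem lower_central_normal)
qed (auto simp: not_le)

lemma lower_central_antimono: "j \<le> k \<Longrightarrow> lower_central G k \<subseteq> lower_central G j"
  using lower_central_Suc_subset by (rule lift_Suc_antimono_le)

text \<open>
  The induction step is the Hall-Witt identity: a commutator \<open>[[u, v], x]\<close> is a product of
  \<open>[[v, x'], u']\<close> and \<open>[[x', u], v']\<close>, up to order and inverses, where \<open>x'\<close>, \<open>u'\<close> and \<open>v'\<close> are
  conjugates of \<open>x\<close>, \<open>u\<close> and \<open>v\<close>.
\<close>

lemma gcomm_lower_central:
  assumes "a \<ge> 1" "b \<ge> 1" "x \<in> lower_central G a" "y \<in> lower_central G b"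
  shows "gcomm G x y \<in> lower_central G (a + b)"
  using assms(2,1,3,4)
proof (induction b arbitrary: a x y rule: nat_induct_at_least)
  case base
  thus ?case using gcomm_lower_central_carrier[of a x y] by simp
next
  case (Suc b)
  let ?S = "lower_central G (a + Suc b)"
  interpret S: normal ?S G by (rule lower_central_normal)
  have x: "x \<in> carrier G" using Suc.prems lower_central_carrier by blast
  have "lower_central G (Suc b) \<subseteq> {u \<in> carrier G. gcomm G x u \<in> ?S}"
    unfolding lower_central_Suc[OF Suc.hyps]
  proof (rule generate_subgroup_incl)
    show "subgroup {u \<in> carrier G. gcomm G x u \<in> ?S} G"
      using subgroup_centralizer_mod' S.normal_axioms x by blast
    show "{gcomm G u v | u v. u \<in> lower_central G b \<and> v \<in> carrier G}
        \<subseteq> {u \<in> carrier G. gcomm G x u \<in> ?S}"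
    proof clarify
      fix u v assume u: "u \<in> lower_central G b" and v: "v \<in> carrier G"
      have uc: "u \<in> carrier G" using u lower_central_carrier by blast
      define x' where "x' = inv v \<otimes> x \<otimes> inv (inv v)"
      have x': "x' \<in> lower_central G a" "x' \<in> carrier G"
        using normal_conj_mem[OF lower_central_normal, of "inv v" x a] v x Suc.prems
        by (auto simp: x'_def)
      have xx': "v \<otimes> x' \<otimes> inv v = x"
        using v x by (simp add: x'_def group_word_simps)
      have "gcomm G v x' \<in> lower_central G (Suc a)"
        using gcomm_lower_central_carrier[of a x' v] Suc.prems(1) x' v
          normal_gcomm_commute[OF lower_central_normal] by blast
      moreover have "x' \<otimes> u \<otimes> inv x' \<in> lower_central G b"
        using normal_conj_mem[OF lower_central_normal] u x' by blast
      ultimately have 1: "gcomm G (gcomm G v x') (x' \<otimes> u \<otimes> inv x') \<in> ?S"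
        using Suc.IH[of "Suc a" "gcomm G v x'" "x' \<otimes> u \<otimes> inv x'"] by simp
      have 2: "gcomm G (gcomm G x' u) (u \<otimes> v \<otimes> inv u) \<in> ?S"
        using gcomm_lower_central_carrier[of "a + b" "gcomm G x' u" "u \<otimes> v \<otimes> inv u"]
          Suc.IH[of a x' u] x' u uc v Suc.prems by simp
      have "gcomm G (gcomm G u v) x \<otimes> gcomm G (gcomm G v x') (x' \<otimes> u \<otimes> inv x')
             \<otimes> gcomm G (gcomm G x' u) (u \<otimes> v \<otimes> inv u) = \<one>"
        using hall_witt[OF uc v x'(2)] xx' by simp
      hence "gcomm G (gcomm G u v) x = inv (gcomm G (gcomm G v x') (x' \<otimes> u \<otimes> inv x')
             \<otimes> gcomm G (gcomm G x' u) (u \<otimes> v \<otimes> inv u))"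
        using uc v x x' by (intro inv_equality[symmetric]) (auto simp: m_assoc)
      hence "gcomm G (gcomm G u v) x \<in> ?S"
        using S.m_inv_closed[OF S.m_closed[OF 1 2]] by (simp only:)
      thus "gcomm G u v \<in> carrier G \<and> gcomm G x (gcomm G u v) \<in> ?S"
        using normal_gcomm_commute[OF S.normal_axioms, of x "gcomm G u v"] x uc v by simp
    qed
  qed
  from subsetD[OF this Suc.prems(3)] show ?case by (simp only: mem_Collect_eq)
qed

text \<open>
  The Jacobi identity in the graded Lie ring of the lower central series, in a form that only speaks
  of membership and therefore needs no signs.
\<close>

lemma jacobi_mem:
  assumes S: "S \<lhd> G" "lower_central G (Suc (a + b + c)) \<subseteq> S"
    and abc: "a \<ge> 1" "b \<ge> 1" "c \<ge> 1"
    and xyz: "x \<in> lower_central G a" "y \<in> lower_central G b" "z \<in> lower_central G c"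
    and mem: "gcomm G (gcomm G y z) x \<in> S" "gcomm G (gcomm G z x) y \<in> S"
  shows "gcomm G (gcomm G x y) z \<in> S"
proof -
  interpret S: normal S G by fact
  \<comment> \<open>Here \<open>y z y\<inverse> = [y, z] z\<close>, and \<open>[[x, y], [y, z]]\<close> has weight \<open>a + 2b + c\<close>.\<close>
  have conj: "gcomm G (gcomm G x y) (y \<otimes> z \<otimes> inv y) \<in> S \<longleftrightarrow> gcomm G (gcomm G x y) z \<in> S"
    if "a \<ge> 1" "b \<ge> 1" "c \<ge> 1" "lower_central G (Suc (a + b + c)) \<subseteq> S"
      "x \<in> lower_central G a" "y \<in> lower_central G b" "z \<in> lower_central G c"
    for a b c x y z
  proof -
    have car: "x \<in> carrier G" "y \<in> carrier G" "z \<in> carrier G"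
      using that lower_central_carrier by blast+
    define C where "C = {u \<in> carrier G. gcomm G (gcomm G x y) u \<in> S}"
    have C_iff: "u \<in> C \<longleftrightarrow> gcomm G (gcomm G x y) u \<in> S" if "u \<in> carrier G" for u
      using that by (simp add: C_def)
    interpret C: subgroup C G
      using subgroup_centralizer_mod'[OF S(1)] car by (simp add: C_def)
    have "gcomm G (gcomm G x y) (gcomm G y z) \<in> lower_central G ((a + b) + (b + c))"
      using that by (intro gcomm_lower_central) auto
    moreover have "lower_central G (a + b + (b + c)) \<subseteq> lower_central G (Suc (a + b + c))"
      using that(2) by (intro lower_central_antimono) simp
    ultimately have "gcomm G (gcomm G x y) (gcomm G y z) \<in> S"
      using that(4) by (meson subsetD)
    hence *: "gcomm G y z \<in> C"
      using car by (simp add: C_iff)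
    have "y \<otimes> z \<otimes> inv y \<in> C \<longleftrightarrow> z \<in> C"
    proof
      assume "z \<in> C"
      thus "y \<otimes> z \<otimes> inv y \<in> C"
        using C.m_closed[OF *] car by (simp add: conj_eq_gcomm_mult)
    next
      assume "y \<otimes> z \<otimes> inv y \<in> C"
      hence "inv (gcomm G y z) \<otimes> (gcomm G y z \<otimes> z) \<in> C"
        using C.m_closed[OF C.m_inv_closed[OF *]] car by (simp only: conj_eq_gcomm_mult)
      thus "z \<in> C" using car by (simp add: inv_mult_cancel_left)
    qed
    thus ?thesis using car by (simp add: C_iff)
  qed
  have car: "x \<in> carrier G" "y \<in> carrier G" "z \<in> carrier G"
    using xyz lower_central_carrier by blast+
  have 1: "gcomm G (gcomm G y z) (z \<otimes> x \<otimes> inv z) \<in> S"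
    using conj[of b c a y z x] mem S abc xyz by (simp add: ac_simps)
  have 2: "gcomm G (gcomm G z x) (x \<otimes> y \<otimes> inv x) \<in> S"
    using conj[of c a b z x y] mem S abc xyz by (simp add: ac_simps)
  have "gcomm G (gcomm G x y) (y \<otimes> z \<otimes> inv y)
      = inv (gcomm G (gcomm G y z) (z \<otimes> x \<otimes> inv z) \<otimes> gcomm G (gcomm G z x) (x \<otimes> y \<otimes> inv x))"
    using hall_witt[OF car] car by (intro inv_equality[symmetric]) (auto simp: m_assoc)
  also have "\<dots> \<in> S" using 1 2 by simp
  finally show ?thesis using conj S abc xyz by blast
qed

text \<open>
  Commuting with everything modulo \<open>S\<close> is a property that passes from generators to products on both
  sides, so the next term of the lower central series only needs the commutators of generators.
\<close>

lemma lower_central_Suc_subset_if_generators: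
  assumes k: "k \<ge> 1" and S: "S \<lhd> G" "lower_central G (Suc (Suc k)) \<subseteq> S"
    and C: "C \<subseteq> carrier G" "lower_central G k = generate G (C \<union> lower_central G (Suc k))"
    and Y: "Y \<subseteq> carrier G" "carrier G = generate G Y"
    and CX: "\<And>c y. c \<in> C \<Longrightarrow> y \<in> Y \<Longrightarrow> gcomm G c y \<in> S"
  shows "lower_central G (Suc k) \<subseteq> S"
proof -
  have C_all: "gcomm G c v \<in> S" if "c \<in> C" "v \<in> carrier G" for c v
  proof -
    have "generate G Y \<subseteq> {u \<in> carrier G. gcomm G c u \<in> S}"
      using that C Y CX by (intro generate_subgroup_incl subgroup_centralizer_mod' S) auto
    thus ?thesis using that Y by auto
  qed
  have all: "gcomm G u v \<in> S" if "u \<in> lower_central G k" "v \<in> carrier G" for u v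
  proof -
    have "generate G (C \<union> lower_central G (Suc k)) \<subseteq> {u \<in> carrier G. gcomm G u v \<in> S}"
    proof (intro generate_subgroup_incl subgroup_centralizer_mod S that)
      show "C \<union> lower_central G (Suc k) \<subseteq> {u \<in> carrier G. gcomm G u v \<in> S}"
        using C_all C that S gcomm_lower_central_carrier[of "Suc k" _ v] lower_central_carrier
        by auto
    qed
    thus ?thesis using that C by auto
  qed
  show ?thesis unfolding lower_central_Suc[OF k]
    using all normal_imp_subgroup[OF S(1)] by (intro generate_subgroup_incl) auto
qed

text \<open>A conjugate of \<open>s\<close> differs from \<open>s\<close> by a commutator, which lies in the next term.\<close>

lemma normal_between_lower_central:
  assumes "k \<ge> 1" "subgroup S G" "S \<subseteq> lower_central G k" "lower_central G (Suc k) \<subseteq> S"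
  shows "S \<lhd> G"
proof (rule normal_invI)
  fix g s assume g: "g \<in> carrier G" and s: "s \<in> S"
  interpret S: subgroup S G by fact
  have "gcomm G s g \<in> lower_central G (Suc k)"
    using gcomm_lower_central_carrier[OF assms(1) subsetD[OF assms(3) s] g] .
  hence "inv (gcomm G s g) \<in> S"
    using subsetD[OF assms(4)] by simp
  hence "gcomm G g s \<in> S"
    using g s by (simp add: inv_gcomm)
  thus "g \<otimes> s \<otimes> inv g \<in> S"
    using g s by (simp add: conj_eq_gcomm_mult)
qed (fact assms(2))

text \<open>
  Integer coordinates in a finitely generated abelian quotient \<open>K / N\<close>. They need not be unique, so
  the point is that one choice serves all additive maps \<open>\<phi>\<close> on the quotient at once. Adjoining one
  generator \<open>c i\<close> at a time, every element is a power of \<open>c i\<close> times an element of the subgroup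
  generated before.
\<close>

lemma generate_coordinates:
  fixes c :: "'i \<Rightarrow> 'a"
  assumes "finite I" and K: "subgroup K G" and N: "subgroup N G" "N \<subseteq> K"
    and c: "c ` I \<subseteq> K" and KK: "\<And>u v. u \<in> K \<Longrightarrow> v \<in> K \<Longrightarrow> gcomm G u v \<in> N"
    and g: "g \<in> generate G (c ` I \<union> N)"
  shows "\<exists>e :: 'i \<Rightarrow> int.
    (\<forall>\<phi> :: 'a \<Rightarrow> 'v :: comm_ring_1. (\<forall>u\<in>K. \<forall>v\<in>K. \<phi> (u \<otimes> v) = \<phi> u + \<phi> v) \<longrightarrow> (\<forall>u\<in>N. \<phi> u = 0)
        \<longrightarrow> \<phi> g = (\<Sum>i\<in>I. of_int (e i) * \<phi> (c i))) \<and>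
    ((\<forall>i\<in>I. e i = 0) \<longrightarrow> g \<in> N)"
  using assms(1) c g
proof (induction I arbitrary: g rule: finite_induct)
  case empty
  hence "g \<in> N" using generate_subgroup_incl[of N N] N by auto
  thus ?case by simp
next
  case (insert i I)
  interpret K: subgroup K G by fact
  let ?S = "generate G (c ` I \<union> N)"
  have S: "subgroup ?S G" "?S \<subseteq> K" "N \<subseteq> ?S"
    using insert.prems N K.subset generate_subgroup_incl[OF _ K, of "c ` I \<union> N"]
    by (auto intro!: generate_is_subgroup generate.incl)
  interpret S: subgroup ?S G by fact
  have ci: "c i \<in> K" "c i \<in> carrier G" using insert.prems K.mem_carrier by auto
  have pow: "c i [^] z \<in> K" "c i [^] z \<in> carrier G" for z :: int
    using subgroup_int_pow_closed[OF K ci(1)] ci by auto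
  have conj: "u \<otimes> s \<otimes> inv u \<in> ?S" if "u \<in> K" "s \<in> ?S" for u s
  proof -
    have "gcomm G u s \<in> ?S" using KK[of u s] S that by blast
    thus ?thesis
      using S.m_closed[of "gcomm G u s" s] that K.mem_carrier S.mem_carrier
      by (simp add: conj_eq_gcomm_mult)
  qed
  define H where "H = {c i [^] z \<otimes> s | z s. z \<in> (UNIV :: int set) \<and> s \<in> ?S}"
  have "subgroup H G"
  proof (rule subgroupI)
    show "H \<subseteq> carrier G" using pow S.mem_carrier by (auto simp: H_def)
    show "H \<noteq> {}" using S.one_closed unfolding H_def by blast
  next
    fix a assume "a \<in> H"
    then obtain z s where a: "a = c i [^] (z :: int) \<otimes> s" and s: "s \<in> ?S"
      by (auto simp: H_def)
    have "inv a = c i [^] (- z) \<otimes> (c i [^] z \<otimes> inv s \<otimes> inv (c i [^] z))"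
      using pow[of z] S.mem_carrier[OF s] ci
      by (simp add: a int_pow_neg group_word_simps)
    thus "inv a \<in> H" using conj[OF pow(1), of "inv s" z] s by (auto simp: H_def)
  next
    fix a b assume "a \<in> H" "b \<in> H"
    then obtain z s w t where ab: "a = c i [^] (z :: int) \<otimes> s" "b = c i [^] (w :: int) \<otimes> t"
      and st: "s \<in> ?S" "t \<in> ?S"
      by (auto simp: H_def)
    have "a \<otimes> b = c i [^] (z + w) \<otimes> ((c i [^] (- w) \<otimes> s \<otimes> inv (c i [^] (- w))) \<otimes> t)"
      using pow[of z] pow[of w] S.mem_carrier[OF st(1)] S.mem_carrier[OF st(2)] ci
      by (simp add: ab int_pow_neg int_pow_mult group_word_simps)
    thus "a \<otimes> b \<in> H"
      using S.m_closed[OF conj[OF pow(1) st(1), of "- w"] st(2)] by (auto simp: H_def)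
  qed
  moreover have "c ` insert i I \<union> N \<subseteq> H"
  proof
    fix y assume "y \<in> c ` insert i I \<union> N"
    then consider "y = c i" | "y \<in> ?S" using S(3) by (auto intro: generate.incl)
    thus "y \<in> H"
    proof cases
      case 1
      hence "y = c i [^] (1 :: int) \<otimes> \<one>" using ci by (simp add: int_pow_1)
      thus ?thesis using S.one_closed unfolding H_def by blast
    next
      case 2
      hence "y = c i [^] (0 :: int) \<otimes> y" using S.mem_carrier by simp
      thus ?thesis using 2 unfolding H_def by blast
    qed
  qed
  ultimately have "g \<in> H" using generate_subgroup_incl insert.prems by blast
  then obtain z s where g: "g = c i [^] (z :: int) \<otimes> s" and s: "s \<in> ?S"
    by (auto simp: H_def)
  obtain e :: "'i \<Rightarrow> int" where
    e: "\<And>\<phi> :: 'a \<Rightarrow> 'v. (\<forall>u\<in>K. \<forall>v\<in>K. \<phi> (u \<otimes> v) = \<phi> u + \<phi> v) \<Longrightarrow> (\<forall>u\<in>N. \<phi> u = 0)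
        \<Longrightarrow> \<phi> s = (\<Sum>i\<in>I. of_int (e i) * \<phi> (c i))"
    and e0: "(\<forall>i\<in>I. e i = 0) \<longrightarrow> s \<in> N"
    using insert.IH[of s] insert.prems s by auto
  show ?case
  proof (intro exI[of _ "e(i := z)"] conjI allI impI)
    fix \<phi> :: "'a \<Rightarrow> 'v"
    assume add: "\<forall>u\<in>K. \<forall>v\<in>K. \<phi> (u \<otimes> v) = \<phi> u + \<phi> v" and zero: "\<forall>u\<in>N. \<phi> u = 0"
    have nat: "\<phi> (c i [^] m) = of_nat m * \<phi> (c i)" for m :: nat
    proof (induction m)
      case 0
      show ?case using zero subgroup.one_closed[OF N(1)] by simp
    next
      case (Suc m)
      have "c i [^] m \<in> K" using pow(1)[of "int m"] by (simp add: int_pow_int)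
      thus ?case using Suc add ci by (simp add: algebra_simps)
    qed
    have "\<phi> (c i [^] z) = of_int z * \<phi> (c i)"
    proof (cases z rule: int_cases2)
      case (nonneg m)
      thus ?thesis using nat by (simp add: int_pow_int)
    next
      case (nonpos m)
      have "\<phi> (c i [^] z \<otimes> c i [^] (- z)) = \<phi> (c i [^] z) + \<phi> (c i [^] (- z))"
        using add pow by blast
      moreover have "c i [^] z \<otimes> c i [^] (- z) = \<one>"
        using ci pow by (simp add: int_pow_neg)
      moreover have "\<phi> \<one> = 0" using zero subgroup.one_closed[OF N(1)] by simp
      moreover have "\<phi> (c i [^] (- z)) = of_nat m * \<phi> (c i)"
        using nonpos nat[of m] by (simp add: int_pow_int)
      ultimately have "\<phi> (c i [^] z) + of_nat m * \<phi> (c i) = 0" by simp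
      moreover have "of_int z * \<phi> (c i) + of_nat m * \<phi> (c i) = 0"
        using nonpos by simp
      ultimately show ?thesis by (metis add_right_imp_eq)
    qed
    moreover have "\<phi> g = \<phi> (c i [^] z) + \<phi> s" using add pow s S g by blast
    moreover have "(\<Sum>j\<in>I. of_int ((e(i := z)) j) * \<phi> (c j)) = (\<Sum>j\<in>I. of_int (e j) * \<phi> (c j))"
      using insert.hyps by (intro sum.cong) auto
    ultimately show "\<phi> g = (\<Sum>j\<in>insert i I. of_int ((e(i := z)) j) * \<phi> (c j))"
      using e[OF add zero] insert.hyps by simp
  next
    assume 0: "\<forall>j\<in>insert i I. (e(i := z)) j = 0"
    hence "z = 0" "\<forall>j\<in>I. e j = 0" using insert.hyps by (auto split: if_splits)
    thus "g \<in> N" using e0 g S.mem_carrier[OF s] by simp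
  qed
qed

end

section \<open>Homomorphisms on a free group\<close>

definition letter_value :: "('a, 'b) monoid_scheme \<Rightarrow> (nat \<Rightarrow> 'a) \<Rightarrow> nat \<times> bool \<Rightarrow> 'a" where
  "letter_value G x a = (if snd a then x (fst a) else inv\<^bsub>G\<^esub> x (fst a))"

fun reduced_cons :: "nat \<times> bool \<Rightarrow> (nat \<times> bool) list \<Rightarrow> (nat \<times> bool) list" where
  "reduced_cons a [] = [a]"
| "reduced_cons a (c # w) = (if fst c = fst a \<and> snd c \<noteq> snd a then w else a # c # w)"

lemma eval_word_Nil [simp]: "eval_word G x [] = \<one>\<^bsub>G\<^esub>"
  by (simp add: eval_word_def)

lemma eval_word_Cons [simp]: "eval_word G x (a # w) = letter_value G x a \<otimes>\<^bsub>G\<^esub> eval_word G x w"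
  by (cases a) (simp add: eval_word_def letter_value_def)

text \<open>
  Multiplication by a letter acts on reduced words by \<open>reduced_cons\<close>, in the free group and, through
  evaluation, in any other group. This is what makes evaluation of the reduced word multiplicative.
\<close>

lemma reduced_cons_in_reduced_words:
  assumes "fst a \<in> {1..n}" "w \<in> reduced_words n"
  shows "reduced_cons a w \<in> reduced_words n"
  using assms by (cases w) (auto simp: reduced_words_def successively_Cons)

context group
begin

lemma letter_value_closed [simp]: "x (fst a) \<in> carrier G \<Longrightarrow> letter_value G x a \<in> carrier G"
  by (simp add: letter_value_def)

lemma eval_word_closed:
  assumes "x ` {1..n} \<subseteq> carrier G" "fst ` set w \<subseteq> {1..n}"
  shows "eval_word G x w \<in> carrier G"
  using assms(2)
proof (induction w)
  case (Cons a w)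
  hence "x (fst a) \<in> carrier G" using assms(1) by auto
  thus ?case using Cons by simp
qed simp

lemma eval_word_reduced_cons:
  assumes "x ` {1..n} \<subseteq> carrier G" "fst a \<in> {1..n}" "fst ` set w \<subseteq> {1..n}"
  shows "eval_word G x (reduced_cons a w) = letter_value G x a \<otimes> eval_word G x w"
proof (cases w)
  case (Cons c v)
  have "x (fst a) \<in> carrier G" "eval_word G x v \<in> carrier G"
    using assms Cons eval_word_closed[OF assms(1), of v] by auto
  thus ?thesis using Cons
    by (auto simp: letter_value_def inv_mult_cancel_left mult_inv_cancel_left)
qed (use assms in auto)

end

lemma free_group_generate:
  assumes "free_group_with_basis G n x"
  shows "carrier G = generate G (x ` {1..n})"
proof
  interpret group G using assms by (simp add: free_group_with_basis_def)
  have x: "x ` {1..n} \<subseteq> carrier G" using assms by (simp add: free_group_with_basis_def)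
  show "generate G (x ` {1..n}) \<subseteq> carrier G" using x by (rule generate_incl)
  have gen: "eval_word G x w \<in> generate G (x ` {1..n})" if "fst ` set w \<subseteq> {1..n}" for w
    using that
  proof (induction w)
    case (Cons a w)
    hence "x (fst a) \<in> x ` {1..n}" by auto
    hence "letter_value G x a \<in> generate G (x ` {1..n})"
      by (auto simp: letter_value_def intro: generate.incl generate.inv)
    thus ?case using Cons by (auto intro: generate.eng)
  qed (simp add: generate.one)
  show "carrier G \<subseteq> generate G (x ` {1..n})"
  proof
    fix g assume "g \<in> carrier G"
    then obtain w where "w \<in> reduced_words n" "g = eval_word G x w"
      using assms by (metis free_group_with_basis_def bij_betw_def imageE)
    thus "g \<in> generate G (x ` {1..n})" using gen by (auto simp: reduced_words_def)
  qed
qed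

lemma free_group_extend_hom:
  assumes F: "free_group_with_basis G n x" and H: "group H" "y ` {1..n} \<subseteq> carrier H"
  obtains \<phi> where "\<phi> \<in> hom G H" "\<And>i. i \<in> {1..n} \<Longrightarrow> \<phi> (x i) = y i"
proof -
  interpret G: group G using F by (simp add: free_group_with_basis_def)
  interpret H: group H by fact
  have x: "x ` {1..n} \<subseteq> carrier G" and bij: "bij_betw (eval_word G x) (reduced_words n) (carrier G)"
    using F by (auto simp: free_group_with_basis_def)
  define word where "word = inv_into (reduced_words n) (eval_word G x)"
  define \<phi> where "\<phi> g = eval_word H y (word g)" for g
  have word: "word g \<in> reduced_words n" "eval_word G x (word g) = g" if "g \<in> carrier G" for g
    using bij that by (auto simp: word_def bij_betw_def inv_into_into f_inv_into_f)
  have word_eval: "word (eval_word G x w) = w" if "w \<in> reduced_words n" for w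
    using bij that by (auto simp: word_def bij_betw_def)
  have letters: "fst ` set w \<subseteq> {1..n}" if "w \<in> reduced_words n" for w
    using that by (auto simp: reduced_words_def)
  have closed: "\<phi> g \<in> carrier H" if "g \<in> carrier G" for g
    using H.eval_word_closed[OF H(2) letters[OF word(1)[OF that]]] by (simp add: \<phi>_def)
  have letter: "\<phi> (letter_value G x a \<otimes>\<^bsub>G\<^esub> g) = letter_value H y a \<otimes>\<^bsub>H\<^esub> \<phi> g"
    if a: "fst a \<in> {1..n}" and g: "g \<in> carrier G" for a g
  proof -
    note w = word[OF g]
    have "letter_value G x a \<otimes>\<^bsub>G\<^esub> g = eval_word G x (reduced_cons a (word g))"
      using G.eval_word_reduced_cons[OF x a letters[OF w(1)]] w(2) by simp
    hence "\<phi> (letter_value G x a \<otimes>\<^bsub>G\<^esub> g) = eval_word H y (reduced_cons a (word g))"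
      using word_eval[OF reduced_cons_in_reduced_words[OF a w(1)]] by (simp add: \<phi>_def)
    thus ?thesis
      using H.eval_word_reduced_cons[OF H(2) a letters[OF w(1)]] by (simp add: \<phi>_def)
  qed
  have eval: "\<phi> (eval_word G x w \<otimes>\<^bsub>G\<^esub> g) = eval_word H y w \<otimes>\<^bsub>H\<^esub> \<phi> g"
    if "fst ` set w \<subseteq> {1..n}" "g \<in> carrier G" for w g
    using that(1)
  proof (induction w)
    case Nil
    thus ?case using that closed by simp
  next
    case (Cons a w)
    have car: "letter_value G x a \<in> carrier G" "eval_word G x w \<in> carrier G"
        "letter_value H y a \<in> carrier H" "eval_word H y w \<in> carrier H"
      using Cons.prems x H(2)
        G.eval_word_closed[OF x, of w] H.eval_word_closed[OF H(2), of w]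
      by (auto intro!: G.letter_value_closed H.letter_value_closed)
    show ?case
      using Cons letter[of a "eval_word G x w \<otimes>\<^bsub>G\<^esub> g"] car that closed
      by (simp add: G.m_assoc H.m_assoc)
  qed
  have one: "\<phi> \<one>\<^bsub>G\<^esub> = \<one>\<^bsub>H\<^esub>"
    using word_eval[of "[]"] by (simp add: \<phi>_def reduced_words_def)
  show ?thesis
  proof
    show "\<phi> \<in> hom G H"
    proof (rule homI)
      fix g h assume gh: "g \<in> carrier G" "h \<in> carrier G"
      show "\<phi> (g \<otimes>\<^bsub>G\<^esub> h) = \<phi> g \<otimes>\<^bsub>H\<^esub> \<phi> h"
        using eval[OF letters[OF word(1)[OF gh(1)]] gh(2)] word(2)[OF gh(1)]
        by (simp add: \<phi>_def[of g])
    qed (rule closed)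
    fix i assume i: "i \<in> {1..n}"
    have "x i \<in> carrier G" "y i \<in> carrier H" using i x H(2) by auto
    thus "\<phi> (x i) = y i"
      using letter[of "(i, True)" "\<one>\<^bsub>G\<^esub>"] i one by (simp add: letter_value_def)
  qed
qed

section \<open>Basic commutators span the lower central quotients\<close>

datatype (letters: 'a) lie_word = Gen 'a | Br "'a lie_word" "'a lie_word"

primrec weight :: "'a lie_word \<Rightarrow> nat" where
  "weight (Gen i) = 1"
| "weight (Br s t) = weight s + weight t"

primrec group_eval :: "('a, 'b) monoid_scheme \<Rightarrow> ('i \<Rightarrow> 'a) \<Rightarrow> 'i lie_word \<Rightarrow> 'a" where
  "group_eval G x (Gen i) = x i"
| "group_eval G x (Br s t) = gcomm G (group_eval G x s) (group_eval G x t)"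

definition left_normed :: "'a \<Rightarrow> 'a list \<Rightarrow> 'a lie_word" where
  "left_normed i js = foldl Br (Gen i) (map Gen js)"

text \<open>
  Hall's basic commutators up to weight four. The left-normed ones, with nondecreasing tail, are a
  basis of the free metabelian Lie ring; the first commutator of another shape is a bracket of two
  basic commutators of weight two, taken in decreasing lexicographic order.
\<close>

definition metabelian_index :: "nat \<Rightarrow> nat \<Rightarrow> (nat \<times> nat list) set" where
  "metabelian_index n k =
     {(i, js). i \<in> {1..n} \<and> set js \<subseteq> {1..n} \<and> Suc (length js) = k \<and> sorted js \<and>
               (js \<noteq> [] \<longrightarrow> hd js < i)}"

definition metabelian_basis :: "nat \<Rightarrow> nat \<Rightarrow> nat lie_word set" where
  "metabelian_basis n k = (\<lambda>(i, js). left_normed i js) ` metabelian_index n k"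

definition double_index :: "nat \<Rightarrow> (nat \<times> nat \<times> nat \<times> nat) set" where
  "double_index n =
     {(i, j, k, l). {i, j, k, l} \<subseteq> {1..n} \<and> j < i \<and> l < k \<and> (k < i \<or> k = i \<and> l < j)}"

definition double_basis :: "nat \<Rightarrow> nat lie_word set" where
  "double_basis n =
     (\<lambda>(i, j, k, l). Br (Br (Gen i) (Gen j)) (Br (Gen k) (Gen l))) ` double_index n"

definition hall_basis :: "nat \<Rightarrow> nat \<Rightarrow> nat lie_word set" where
  "hall_basis n k = metabelian_basis n k \<union> (if k = 4 then double_basis n else {})"

lemma weight_pos: "weight t \<ge> 1"
  by (induction t) auto

lemma weight_left_normed [simp]: "weight (left_normed i js) = Suc (length js)"
proof -
  have "weight (foldl Br t (map Gen js)) = weight t + length js" for t :: "'a lie_word"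
    by (induction js arbitrary: t) auto
  thus ?thesis by (simp add: left_normed_def)
qed

lemma letters_left_normed [simp]: "letters (left_normed i js) = insert i (set js)"
proof -
  have "letters (foldl Br t (map Gen js)) = letters t \<union> set js" for t :: "'a lie_word"
    by (induction js arbitrary: t) auto
  thus ?thesis by (simp add: left_normed_def)
qed

lemma hall_basis_weight: "t \<in> hall_basis n k \<Longrightarrow> weight t = k"
  by (auto simp: hall_basis_def metabelian_basis_def metabelian_index_def double_basis_def
      split: if_splits)

lemma hall_basis_letters:
  assumes "t \<in> hall_basis n k"
  shows "letters t \<subseteq> {1..n}"
proof (cases "t \<in> metabelian_basis n k")
  case True
  thus ?thesis by (force simp: metabelian_basis_def metabelian_index_def)
next
  case False
  hence "t \<in> double_basis n" using assms by (auto simp: hall_basis_def split: if_splits)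
  thus ?thesis by (auto simp: double_basis_def double_index_def)
qed

lemma hall_basis_1: "hall_basis n 1 = Gen ` {1..n}"
proof -
  have "metabelian_index n 1 = (\<lambda>i. (i, [])) ` {1..n}"
    by (auto simp: metabelian_index_def)
  thus ?thesis by (simp add: hall_basis_def metabelian_basis_def left_normed_def image_image)
qed

lemma hall_basis_2: "hall_basis n 2 = {Br (Gen i) (Gen j) | i j. {i, j} \<subseteq> {1..n} \<and> j < i}"
proof -
  have "metabelian_index n 2 = {(i, [j]) | i j. {i, j} \<subseteq> {1..n} \<and> j < i}"
    by (auto simp: metabelian_index_def length_Suc_conv numeral_2_eq_2)
  moreover have "f ` {(i, [j]) | i j. P i j} = {f (i, [j]) | i j. P i j}"
    for f :: "nat \<times> nat list \<Rightarrow> nat lie_word" and P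
    by blast
  ultimately show ?thesis
    by (simp add: hall_basis_def metabelian_basis_def left_normed_def del: insert_subset)
qed

lemma hall_basis_3:
  "hall_basis n 3 = {Br (Br (Gen i) (Gen j)) (Gen k) | i j k. {i, j, k} \<subseteq> {1..n} \<and> j < i \<and> j \<le> k}"
proof -
  have "metabelian_index n 3 = {(i, [j, k]) | i j k. {i, j, k} \<subseteq> {1..n} \<and> j < i \<and> j \<le> k}"
    by (auto simp: metabelian_index_def length_Suc_conv numeral_3_eq_3)
  moreover have "f ` {(i, [j, k]) | i j k. P i j k} = {f (i, [j, k]) | i j k. P i j k}"
    for f :: "nat \<times> nat list \<Rightarrow> nat lie_word" and P
    by blast
  ultimately show ?thesis
    by (simp add: hall_basis_def metabelian_basis_def left_normed_def del: insert_subset)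
qed

lemma hall_basis_4:
  "hall_basis n 4 =
     {Br (Br (Br (Gen i) (Gen j)) (Gen k)) (Gen l) | i j k l.
        {i, j, k, l} \<subseteq> {1..n} \<and> j < i \<and> j \<le> k \<and> k \<le> l} \<union> double_basis n"
proof -
  have "metabelian_index n 4 =
      {(i, [j, k, l]) | i j k l. {i, j, k, l} \<subseteq> {1..n} \<and> j < i \<and> j \<le> k \<and> k \<le> l}"
    by (auto simp: metabelian_index_def length_Suc_conv eval_nat_numeral)
  moreover have "f ` {(i, [j, k, l]) | i j k l. P i j k l} = {f (i, [j, k, l]) | i j k l. P i j k l}"
    for f :: "nat \<times> nat list \<Rightarrow> nat lie_word" and P
    by blast
  ultimately show ?thesis
    by (simp add: hall_basis_def metabelian_basis_def left_normed_def del: insert_subset)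
qed

lemma finite_hall_basis: "finite (hall_basis n k)"
proof -
  have "metabelian_index n k \<subseteq> {1..n} \<times> {js. set js \<subseteq> {1..n} \<and> length js = k - 1}"
    by (auto simp: metabelian_index_def)
  hence "finite (metabelian_index n k)"
    by (rule finite_subset) (simp add: finite_lists_length_eq)
  moreover have "double_index n \<subseteq> {1..n} \<times> {1..n} \<times> {1..n} \<times> {1..n}"
    by (auto simp: double_index_def)
  hence "finite (double_index n)" by (rule finite_subset) auto
  ultimately show ?thesis by (simp add: hall_basis_def metabelian_basis_def double_basis_def)
qed

locale finitely_generated_group = group G for G :: "('a, 'b) monoid_scheme" (structure) +
  fixes x :: "nat \<Rightarrow> 'a" and n :: nat
  assumes generators: "x ` {1..n} \<subseteq> carrier G" and generate: "carrier G = generate G (x ` {1..n})"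
begin

lemma group_eval_lower_central:
  "letters t \<subseteq> {1..n} \<Longrightarrow> group_eval G x t \<in> lower_central G (weight t)"
proof (induction t)
  case (Gen i)
  thus ?case using generators by auto
next
  case (Br s t)
  thus ?case using gcomm_lower_central[OF weight_pos weight_pos] by simp
qed

text \<open>
  Including the next term of the series makes this subgroup normal, so that one can compute with
  commutators modulo it.
\<close>

definition hall_span :: "nat \<Rightarrow> 'a set" where
  "hall_span k = generate G (group_eval G x ` hall_basis n k \<union> lower_central G (Suc k))"

lemma hall_basis_eval_subset:
  "group_eval G x ` hall_basis n k \<union> lower_central G (Suc k) \<subseteq> lower_central G k"
  using group_eval_lower_central hall_basis_letters hall_basis_weight lower_central_Suc_subset
  by fastforce

lemma hall_span_subset: "hall_span k \<subseteq> lower_central G k"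
  unfolding hall_span_def
  by (rule generate_subgroup_incl[OF hall_basis_eval_subset lower_central_subgroup])

lemma lower_central_Suc_subset_hall_span: "lower_central G (Suc k) \<subseteq> hall_span k"
  unfolding hall_span_def by (auto intro: generate.incl)

lemma group_eval_hall_span: "t \<in> hall_basis n k \<Longrightarrow> group_eval G x t \<in> hall_span k"
  unfolding hall_span_def by (auto intro: generate.incl)

lemma hall_span_normal: "k \<ge> 1 \<Longrightarrow> hall_span k \<lhd> G"
proof (rule normal_between_lower_central)
  show "subgroup (hall_span k) G"
    unfolding hall_span_def
    using hall_basis_eval_subset lower_central_carrier by (intro generate_is_subgroup) blast
  show "hall_span k \<subseteq> lower_central G k" by (rule hall_span_subset)
  show "lower_central G (Suc k) \<subseteq> hall_span k" by (rule lower_central_Suc_subset_hall_span)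
qed

lemma generator_lower_central: "i \<in> {1..n} \<Longrightarrow> x i \<in> lower_central G 1"
  using generators by auto

lemma lower_central_eq_hall_span_1: "lower_central G 1 = hall_span 1"
proof
  have "x ` {1..n} \<subseteq> hall_span 1"
    using group_eval_hall_span[of _ 1] unfolding hall_basis_1 by force
  hence "generate G (x ` {1..n}) \<subseteq> hall_span 1"
    by (rule generate_subgroup_incl) (simp add: hall_span_normal normal_imp_subgroup)
  thus "lower_central G 1 \<subseteq> hall_span 1" using generate by simp
qed (rule hall_span_subset)

lemma lower_central_eq_hall_span_Suc:
  assumes "k \<ge> 1" "lower_central G k = hall_span k"
    and "\<And>t i. t \<in> hall_basis n k \<Longrightarrow> i \<in> {1..n}
           \<Longrightarrow> gcomm G (group_eval G x t) (x i) \<in> hall_span (Suc k)"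
  shows "lower_central G (Suc k) = hall_span (Suc k)"
proof
  show "lower_central G (Suc k) \<subseteq> hall_span (Suc k)"
  proof (rule lower_central_Suc_subset_if_generators
      [where C = "group_eval G x ` hall_basis n k" and Y = "x ` {1..n}"])
    show "group_eval G x ` hall_basis n k \<subseteq> carrier G"
      using hall_basis_eval_subset[of k] lower_central_carrier[of _ k] by auto
    show "lower_central G k = generate G (group_eval G x ` hall_basis n k \<union> lower_central G (Suc k))"
      using assms(2) by (simp add: hall_span_def)
  qed (use assms generators generate in
      \<open>auto intro: hall_span_normal subsetD[OF lower_central_Suc_subset_hall_span]\<close>)
qed (rule hall_span_subset)

lemma gcomm_gcomm_swap:
  assumes "S \<lhd> G" "a \<in> carrier G" "b \<in> carrier G" "c \<in> carrier G" "gcomm G (gcomm G a b) c \<in> S"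
  shows "gcomm G (gcomm G b a) c \<in> S"
proof -
  have "inv (gcomm G a b) \<in> {u \<in> carrier G. gcomm G u c \<in> S}"
    using subgroup.m_inv_closed[OF subgroup_centralizer_mod[OF assms(1,4)], of "gcomm G a b"] assms
    by simp
  thus ?thesis using assms by (simp add: inv_gcomm)
qed

lemma lower_central_eq_hall_span_2: "lower_central G 2 = hall_span 2"
proof -
  interpret S: normal "hall_span 2" G by (rule hall_span_normal) simp
  have commutators: "gcomm G (x i) (x j) \<in> hall_span 2" if ij: "i \<in> {1..n}" "j \<in> {1..n}" for i j
  proof -
    have car: "x i \<in> carrier G" "x j \<in> carrier G" using generators ij by auto
    have basic: "gcomm G (x i) (x j) \<in> hall_span 2" if "j < i" "i \<in> {1..n}" "j \<in> {1..n}" for i j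
      using that group_eval_hall_span[of "Br (Gen i) (Gen j)" 2] unfolding hall_basis_2 by simp
    consider "j < i" | "i = j" | "i < j" by linarith
    thus ?thesis
    proof cases
      case 1
      thus ?thesis using basic ij by blast
    next
      case 2
      thus ?thesis using car S.one_closed by (simp add: gcomm_self)
    next
      case 3
      hence "gcomm G (x j) (x i) \<in> hall_span 2" using basic ij by blast
      thus ?thesis using normal_gcomm_commute[OF S.normal_axioms] car by blast
    qed
  qed
  have "lower_central G (Suc 1) = hall_span (Suc 1)"
  proof (rule lower_central_eq_hall_span_Suc)
    fix t m assume "t \<in> hall_basis n 1" and m: "m \<in> {1..n}"
    then obtain i where "t = Gen i" "i \<in> {1..n}"
      unfolding hall_basis_1 by auto
    thus "gcomm G (group_eval G x t) (x m) \<in> hall_span (Suc 1)"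
      using commutators m by (simp add: numeral_2_eq_2)
  qed (simp_all add: lower_central_eq_hall_span_1[simplified])
  thus ?thesis by (simp add: numeral_2_eq_2)
qed

text \<open>
  A commutator \<open>[[i, j], k]\<close> with \<open>k < j < i\<close> is rewritten by the Jacobi identity in terms of
  \<open>[[j, k], i]\<close> and \<open>[[i, k], j]\<close>, which are basic.
\<close>

lemma lower_central_eq_hall_span_3: "lower_central G 3 = hall_span 3"
proof -
  let ?S = "hall_span 3"
  have S: "?S \<lhd> G" by (rule hall_span_normal) simp
  have basic: "gcomm G (gcomm G (x i) (x j)) (x k) \<in> ?S"
    if "j < i" "j \<le> k" "i \<in> {1..n}" "j \<in> {1..n}" "k \<in> {1..n}" for i j k
    using that group_eval_hall_span[of "Br (Br (Gen i) (Gen j)) (Gen k)" 3]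
    unfolding hall_basis_3 by simp
  have commutators: "gcomm G (gcomm G (x i) (x j)) (x k) \<in> ?S"
    if ij: "j < i" and ijk: "i \<in> {1..n}" "j \<in> {1..n}" "k \<in> {1..n}" for i j k
  proof (cases "j \<le> k")
    case True
    thus ?thesis using basic that by blast
  next
    case False
    have car: "x i \<in> carrier G" "x j \<in> carrier G" "x k \<in> carrier G" using generators ijk by auto
    show ?thesis
    proof (rule jacobi_mem[where a = 1 and b = 1 and c = 1])
      show "lower_central G (Suc (1 + 1 + 1)) \<subseteq> ?S"
        using lower_central_Suc_subset_hall_span[of 3] by (simp add: eval_nat_numeral)
      show "gcomm G (gcomm G (x j) (x k)) (x i) \<in> ?S"
        using False ij ijk by (intro basic) auto
      show "gcomm G (gcomm G (x k) (x i)) (x j) \<in> ?S"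
        using False ij ijk car by (intro gcomm_gcomm_swap[OF S _ _ _ basic]) auto
    qed (use S ijk generator_lower_central in auto)
  qed
  have "lower_central G (Suc 2) = hall_span (Suc 2)"
  proof (rule lower_central_eq_hall_span_Suc)
    fix t m assume "t \<in> hall_basis n 2" and m: "m \<in> {1..n}"
    then obtain i j where "t = Br (Gen i) (Gen j)" "j < i" "i \<in> {1..n}" "j \<in> {1..n}"
      unfolding hall_basis_2 by auto
    thus "gcomm G (group_eval G x t) (x m) \<in> hall_span (Suc 2)"
      using commutators m by simp
  qed (simp_all add: lower_central_eq_hall_span_2[simplified])
  thus ?thesis by simp
qed

text \<open>
  To sort \<open>[[[i, j], k], l]\<close> with \<open>l < k\<close>, the last two entries are exchanged at the cost of
  \<open>[[i, j], [k, l]]\<close>. If \<open>l < j\<close> as well, the inner \<open>[[i, j], l]\<close> is then rewritten as in weight three.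
\<close>

lemma lower_central_eq_hall_span_4: "lower_central G 4 = hall_span 4"
proof -
  let ?S = "hall_span 4"
  have S: "?S \<lhd> G" by (rule hall_span_normal) simp
  interpret S: normal ?S G by (rule S)
  have sub: "lower_central G 5 \<subseteq> ?S"
    using lower_central_Suc_subset_hall_span[of 4] by (simp add: eval_nat_numeral)
  have car: "x i \<in> carrier G" if "i \<in> {1..n}" for i using generators that by auto
  have basic: "gcomm G (gcomm G (gcomm G (x i) (x j)) (x k)) (x l) \<in> ?S"
    if "j < i" "j \<le> k" "k \<le> l" "i \<in> {1..n}" "j \<in> {1..n}" "k \<in> {1..n}" "l \<in> {1..n}" for i j k l
    using that group_eval_hall_span[of "Br (Br (Br (Gen i) (Gen j)) (Gen k)) (Gen l)" 4]
    unfolding hall_basis_4 by simp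
  have double: "gcomm G (gcomm G (x i) (x j)) (gcomm G (x k) (x l)) \<in> ?S"
    if "j < i" "l < k" and mem: "i \<in> {1..n}" "j \<in> {1..n}" "k \<in> {1..n}" "l \<in> {1..n}" for i j k l
  proof -
    have basic': "gcomm G (gcomm G (x i) (x j)) (gcomm G (x k) (x l)) \<in> ?S"
      if "j < i" "l < k" "k < i \<or> k = i \<and> l < j"
        "i \<in> {1..n}" "j \<in> {1..n}" "k \<in> {1..n}" "l \<in> {1..n}" for i j k l
    proof -
      have "(i, j, k, l) \<in> double_index n" using that by (simp add: double_index_def)
      hence "Br (Br (Gen i) (Gen j)) (Br (Gen k) (Gen l)) \<in> hall_basis n 4"
        unfolding hall_basis_4 double_basis_def by force
      thus ?thesis using group_eval_hall_span by force
    qed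
    consider "k < i \<or> k = i \<and> l < j" | "k = i" "l = j" | "i < k \<or> i = k \<and> j < l" by linarith
    thus ?thesis
    proof cases
      case 1
      thus ?thesis using that by (intro basic') auto
    next
      case 2
      thus ?thesis using car mem S.one_closed by (simp add: gcomm_self)
    next
      case 3
      hence "gcomm G (gcomm G (x k) (x l)) (gcomm G (x i) (x j)) \<in> ?S"
        using that by (intro basic') auto
      thus ?thesis using normal_gcomm_commute[OF S] car mem by simp
    qed
  qed
  have gcomm2: "gcomm G (x i) (x j) \<in> lower_central G 2" if "i \<in> {1..n}" "j \<in> {1..n}" for i j
    using gcomm_lower_central[of 1 1 "x i" "x j"] that generator_lower_central
    by (simp add: numeral_2_eq_2)
  \<comment> \<open>The last two entries may be exchanged, because the two sides differ by \<open>[[i, j], [k, l]]\<close>.\<close>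
  have exchange: "gcomm G (gcomm G (gcomm G (x i) (x j)) (x k)) (x l) \<in> ?S"
    if "j < i" "l < k" and mem: "i \<in> {1..n}" "j \<in> {1..n}" "k \<in> {1..n}" "l \<in> {1..n}"
      and other: "gcomm G (gcomm G (gcomm G (x i) (x j)) (x l)) (x k) \<in> ?S" for i j k l
  proof (rule jacobi_mem[where a = 2 and b = 1 and c = 1])
    show "lower_central G (Suc (2 + 1 + 1)) \<subseteq> ?S" using sub by simp
    show "gcomm G (gcomm G (x k) (x l)) (gcomm G (x i) (x j)) \<in> ?S"
      using double[OF that(1,2) mem] normal_gcomm_commute[OF S] car mem by simp
    show "gcomm G (gcomm G (x l) (gcomm G (x i) (x j))) (x k) \<in> ?S"
      using other car mem by (intro gcomm_gcomm_swap[OF S, of "gcomm G (x i) (x j)"]) auto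
  qed (use S mem generator_lower_central gcomm2 in auto)
  have commutators: "gcomm G (gcomm G (gcomm G (x i) (x j)) (x k)) (x l) \<in> ?S"
    if ij: "j < i" "j \<le> k" and mem: "i \<in> {1..n}" "j \<in> {1..n}" "k \<in> {1..n}" "l \<in> {1..n}"
    for i j k l
  proof (cases "k \<le> l")
    case True
    thus ?thesis using that by (intro basic) auto
  next
    case lk: False
    have "gcomm G (gcomm G (gcomm G (x i) (x j)) (x l)) (x k) \<in> ?S"
    proof (cases "j \<le> l")
      case True
      thus ?thesis using that lk by (intro basic) auto
    next
      case lj: False
      \<comment> \<open>The Jacobi identity for \<open>i\<close>, \<open>j\<close>, \<open>l\<close> is used modulo the elements of weight three that
        commute with the generator \<open>k\<close> modulo \<open>?S\<close>; without the weight they need not form a normal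
        subgroup.\<close>
      let ?C = "{u \<in> carrier G. gcomm G u (x k) \<in> ?S} \<inter> lower_central G 3"
      have "gcomm G (gcomm G (x i) (x j)) (x l) \<in> ?C"
      proof (rule jacobi_mem[where a = 1 and b = 1 and c = 1])
        have "gcomm G u (x k) \<in> ?S" if "u \<in> lower_central G 4" for u
          using gcomm_lower_central_carrier[of 4 u "x k"] that car[OF mem(3)] sub
          by (auto simp: eval_nat_numeral)
        hence 4: "lower_central G 4 \<subseteq> ?C"
          using lower_central_carrier[of _ 4] lower_central_antimono[of 3 4] by auto
        thus "lower_central G (Suc (1 + 1 + 1)) \<subseteq> ?C" by (simp add: eval_nat_numeral)
        show C: "?C \<lhd> G"
        proof (rule normal_between_lower_central[of 3])
          show "subgroup ?C G"
            using subgroup_centralizer_mod[OF S car[OF mem(3)]] lower_central_subgroup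
            by (rule subgroups_Inter_pair)
          show "lower_central G (Suc 3) \<subseteq> ?C" using 4 by simp
        qed auto
        have C_I: "gcomm G (gcomm G (x a) (x b)) (x c) \<in> ?C"
          if "gcomm G (gcomm G (gcomm G (x a) (x b)) (x c)) (x k) \<in> ?S"
            "a \<in> {1..n}" "b \<in> {1..n}" "c \<in> {1..n}" for a b c
          using that(1) car[OF that(2)] car[OF that(3)] car[OF that(4)]
            gcomm_lower_central_carrier[OF _ gcomm2[OF that(2,3)] car[OF that(4)]]
          by simp
        have "gcomm G (gcomm G (gcomm G (x j) (x l)) (x i)) (x k) \<in> ?S"
        proof (cases "i \<le> k")
          case True
          thus ?thesis using lj lk that by (intro basic) auto
        next
          case False
          have "gcomm G (gcomm G (gcomm G (x j) (x l)) (x k)) (x i) \<in> ?S"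
            using False lj lk that by (intro basic) auto
          thus ?thesis using False lj mem by (intro exchange[of l j k i]) auto
        qed
        thus "gcomm G (gcomm G (x j) (x l)) (x i) \<in> ?C" by (rule C_I) fact+
        have "gcomm G (gcomm G (gcomm G (x i) (x l)) (x j)) (x k) \<in> ?S"
          using lj lk that by (intro basic) auto
        hence "gcomm G (gcomm G (x i) (x l)) (x j) \<in> ?C"
          by (rule C_I) fact+
        thus "gcomm G (gcomm G (x l) (x i)) (x j) \<in> ?C"
          by (intro gcomm_gcomm_swap[OF C, of "x i" "x l" "x j"] car mem)
      qed (use mem generator_lower_central in auto)
      thus ?thesis by simp
    qed
    thus ?thesis using ij lk mem by (intro exchange[of j i l k]) auto
  qed
  have "lower_central G (Suc 3) = hall_span (Suc 3)"
  proof (rule lower_central_eq_hall_span_Suc)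
    fix t m assume "t \<in> hall_basis n 3" and m: "m \<in> {1..n}"
    then obtain i j k where "t = Br (Br (Gen i) (Gen j)) (Gen k)" "j < i" "j \<le> k"
        "i \<in> {1..n}" "j \<in> {1..n}" "k \<in> {1..n}"
      unfolding hall_basis_3 by auto
    thus "gcomm G (group_eval G x t) (x m) \<in> hall_span (Suc 3)"
      using commutators m by simp
  qed (simp_all add: lower_central_eq_hall_span_3[simplified])
  thus ?thesis by simp
qed

theorem lower_central_eq_hall_span: "k \<in> {1..4} \<Longrightarrow> lower_central G k = hall_span k"
proof -
  assume "k \<in> {1..4}"
  then consider "k = 1" | "k = 2" | "k = 3" | "k = 4" by fastforce
  thus ?thesis
    using lower_central_eq_hall_span_1 lower_central_eq_hall_span_2 lower_central_eq_hall_span_3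
      lower_central_eq_hall_span_4 by cases simp_all
qed

end

section \<open>Basic brackets are independent on \<open>sl\<^sub>2\<close>\<close>

lemma multiset_eqI_filter:
  assumes "count M v = count N v" "filter_mset (\<lambda>u. u \<noteq> v) M = filter_mset (\<lambda>u. u \<noteq> v) N"
  shows "M = N"
proof (rule multiset_eqI)
  fix u
  show "count M u = count N u"
    using assms(1) arg_cong[OF assms(2), of "\<lambda>K. count K u"] by (cases "u = v") auto
qed

text \<open>
  By induction on the variables: one is split off and the others are fixed, and then the coefficients
  of the resulting polynomial in one variable are zero. The index set allows one monomial \<open>M w\<close> to
  come from several terms.
\<close>

lemma polynomial_function_coeffs_zero:
  fixes c :: "'w \<Rightarrow> complex" and M :: "'w \<Rightarrow> 'v multiset"
  assumes "finite V" "finite W" "\<And>w. w \<in> W \<Longrightarrow> set_mset (M w) \<subseteq> V"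
    and "\<And>a. (\<Sum>w\<in>W. c w * prod_mset (image_mset a (M w))) = 0"
  shows "(\<Sum>w\<in>{w\<in>W. M w = M0}. c w) = 0"
  using assms
proof (induction V arbitrary: W M M0 rule: finite_induct)
  case empty
  hence M: "M w = {#}" if "w \<in> W" for w using that by auto
  have "(\<Sum>w\<in>W. c w * prod_mset (image_mset a (M w))) = (\<Sum>w\<in>W. c w)" for a :: "'v \<Rightarrow> complex"
    using M by (intro sum.cong) auto
  hence "(\<Sum>w\<in>W. c w) = 0" using empty(3) by metis
  moreover have "{w \<in> W. M w = M0} = (if M0 = {#} then W else {})"
    using M by auto
  ultimately show ?case by (simp only: split: if_split) simp
next
  case (insert v V)
  let ?rest = "filter_mset (\<lambda>u. u \<noteq> v)"
  let ?W = "{w \<in> W. count (M w) v = count M0 v}"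
  have split: "prod_mset (image_mset a N) = a v ^ count N v * prod_mset (image_mset a (?rest N))"
    for a :: "'v \<Rightarrow> complex" and N
    by (induction N) auto
  have "(\<Sum>w\<in>?W. c w * prod_mset (image_mset a (?rest (M w)))) = 0" for a
  proof -
    \<comment> \<open>The sum as a polynomial in the value at \<open>v\<close>, the other values being fixed.\<close>
    define p where
      "p = (\<Sum>w\<in>W. Polynomial.monom (c w * prod_mset (image_mset a (?rest (M w)))) (count (M w) v))"
    have "poly p z = 0" for z
    proof -
      have "image_mset (a(v := z)) (?rest N) = image_mset a (?rest N)" for N
        by (intro image_mset_cong) auto
      hence "prod_mset (image_mset (a(v := z)) N) = z ^ count N v * prod_mset (image_mset a (?rest N))"
        for N
        by (subst split) simp
      thus ?thesis
        using insert.prems(3)[of "a(v := z)"]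
        by (simp add: p_def poly_sum poly_monom mult_ac del: fun_upd_apply)
    qed
    hence "p = 0" using poly_all_0_iff_0 by blast
    hence "Polynomial.coeff p (count M0 v) = 0" by simp
    thus ?thesis
      using insert.prems(1) by (simp add: p_def coeff_sum sum.inter_filter)
  qed
  hence "(\<Sum>w\<in>{w\<in>?W. ?rest (M w) = ?rest M0}. c w) = 0"
    using insert.prems by (intro insert.IH) auto
  moreover have "{w\<in>?W. ?rest (M w) = ?rest M0} = {w\<in>W. M w = M0}"
    using multiset_eqI_filter[of _ v M0] by auto
  ultimately show ?case by simp
qed

text \<open>
  A triple \<open>(a, b, c)\<close> stands for the traceless matrix with rows \<open>(a, b)\<close> and \<open>(c, -a)\<close>; the bracket
  below is then the commutator of matrices.
\<close>

type_synonym sl2 = "complex \<times> complex \<times> complex"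

fun sl2_bracket :: "sl2 \<Rightarrow> sl2 \<Rightarrow> sl2" where
  "sl2_bracket (a, b, c) (a', b', c') = (b * c' - c * b', 2 * (a * b' - b * a'), 2 * (c * a' - a * c'))"

primrec lie_eval :: "('i \<Rightarrow> sl2) \<Rightarrow> 'i lie_word \<Rightarrow> sl2" where
  "lie_eval Y (Gen i) = Y i"
| "lie_eval Y (Br s t) = sl2_bracket (lie_eval Y s) (lie_eval Y t)"

lemma sl2_bracket_zero [simp]: "sl2_bracket 0 u = 0" "sl2_bracket u 0 = 0"
  by (cases u; simp add: zero_prod_def)+

lemma inj_on_left_normed: "inj_on (\<lambda>(i, js). left_normed i js) A"
proof (rule inj_onI, clarify)
  have "foldl Br (Gen i) (map Gen js) = foldl Br (Gen i') (map Gen js') \<Longrightarrow> i = i' \<and> js = js'"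
    for i i' :: 'a and js js'
  proof (induction js arbitrary: js' rule: rev_induct)
    case Nil
    thus ?case by (cases js' rule: rev_cases) auto
  next
    case (snoc j js)
    thus ?case by (cases js' rule: rev_cases) auto
  qed
  thus "i = i' \<and> js = js'" if "left_normed i js = left_normed i' js'" for i i' :: 'a and js js'
    using that by (simp add: left_normed_def)
qed

lemma inj_on_double:
  "inj_on (\<lambda>(i, j, k, l). Br (Br (Gen i) (Gen j)) (Br (Gen k) (Gen l))) A"
  by (auto simp: inj_on_def)

text \<open>A bracket with \<open>(a, b, 0)\<close> on the right multiplies \<open>(0, \<beta>, 0)\<close> by \<open>- 2 a\<close>.\<close>

lemma lie_eval_left_normed_borel:
  "lie_eval (\<lambda>i. (a i, b i, 0)) (left_normed i (j # ks)) =
     (0, 2 * (a i * b j - b i * a j) * ((- 2) ^ length ks * prod_list (map a ks)), 0)"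
proof -
  have "lie_eval (\<lambda>i. (a i, b i, 0)) (foldl Br t (map Gen ks)) =
      (0, \<beta> * ((- 2) ^ length ks * prod_list (map a ks)), 0)"
    if "lie_eval (\<lambda>i. (a i, b i, 0)) t = (0, \<beta>, 0)" for t \<beta>
    using that
  proof (induction ks arbitrary: t \<beta>)
    case (Cons k ks)
    have "lie_eval (\<lambda>i. (a i, b i, 0)) (Br t (Gen k)) = (0, - 2 * a k * \<beta>, 0)"
      using Cons.prems by simp
    from Cons.IH[OF this] show ?case by (simp add: mult_ac)
  qed simp
  from this[of "Br (Gen i) (Gen j)"] show ?thesis by (simp add: left_normed_def)
qed

lemma lie_eval_double_borel:
  "lie_eval (\<lambda>i. (a i, b i, 0)) (Br (Br (Gen i) (Gen j)) (Br (Gen k) (Gen l))) = 0"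
  by (simp add: zero_prod_def)

abbreviation vanishes :: "nat lie_word set \<Rightarrow> (nat lie_word \<Rightarrow> complex) \<Rightarrow> (sl2 \<Rightarrow> complex) \<Rightarrow> bool" where
  "vanishes B e \<pi> \<equiv> \<forall>Y. (\<Sum>t\<in>B. e t * \<pi> (lie_eval Y t)) = 0"

text \<open>
  On the Borel subalgebra, with \<open>Y\<^sub>i = (a\<^sub>i, b\<^sub>i, 0)\<close>, the bracket \<open>[\<dots>[i, j], \<dots>]\<close> is up to a constant
  \<open>(a\<^sub>i b\<^sub>j - b\<^sub>i a\<^sub>j)\<close> times the product of the \<open>a\<^sub>k\<close> over the other letters \<open>k\<close>. As \<open>j\<close> is the smallest
  letter, the monomial with \<open>b\<^sub>i\<close> has a letter below the index of its \<open>b\<close>, the other one has not. So the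
  coefficient of the former monomial in the sum is that of a single basic bracket.
\<close>

lemma metabelian_independent:
  assumes van: "vanishes (hall_basis n k) e (fst \<circ> snd)" and t: "t \<in> metabelian_basis n k"
  shows "e t = 0"
proof -
  let ?I = "metabelian_index n k"
  define E where "E w = e (left_normed (fst w) (snd w))" for w
  have fin: "finite ?I" "finite (hall_basis n k)"
    using finite_hall_basis finite_subset[of "metabelian_basis n k" "hall_basis n k"]
    by (auto simp: hall_basis_def metabelian_basis_def inj_on_left_normed
        intro: finite_imageD[OF _ inj_on_left_normed])
  have sum_I: "(\<Sum>w\<in>?I. E w * (fst \<circ> snd) (lie_eval (\<lambda>i. (a i, b i, 0)) (left_normed (fst w) (snd w)))) = 0"
    for a b
  proof -
    let ?f = "\<lambda>t. e t * (fst \<circ> snd) (lie_eval (\<lambda>i. (a i, b i, 0)) t)"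
    have "sum ?f (hall_basis n k) = sum ?f (metabelian_basis n k)"
      using fin by (intro sum.mono_neutral_right)
        (auto simp: hall_basis_def double_basis_def lie_eval_double_borel split: if_splits)
    also have "\<dots> = (\<Sum>w\<in>?I. ?f (left_normed (fst w) (snd w)))"
      unfolding metabelian_basis_def
      by (subst sum.reindex[OF inj_on_left_normed]) (simp add: case_prod_unfold)
    finally show ?thesis using van by (simp add: E_def)
  qed
  obtain i0 js0 where w0: "(i0, js0) \<in> ?I" and t_eq: "t = left_normed i0 js0"
    using t by (auto simp: metabelian_basis_def)
  \<comment> \<open>This choice of \<open>b\<close> keeps only the monomials that contain \<open>b\<close> at the index \<open>i0\<close>.\<close>
  let ?b = "\<lambda>i. if i = i0 then 1 else (0 :: complex)"
  have "E (i0, js0) = 0"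
  proof (cases js0)
    case Nil
    hence k: "k = 1" using w0 by (auto simp: metabelian_index_def)
    have "?I = (\<lambda>i. (i, [])) ` {1..n}" by (auto simp: metabelian_index_def k)
    hence "(\<Sum>i\<in>{1..n}. E (i, []) * ?b i) = 0"
      using sum_I[of "\<lambda>_. 0" ?b]
      by (simp add: sum.reindex inj_on_def left_normed_def)
    hence "(\<Sum>i\<in>{1..n}. if i = i0 then E (i, []) else 0) = 0"
      by (simp add: if_distrib[of "\<lambda>z. _ * z"] cong: if_cong)
    thus ?thesis using w0 Nil by (auto simp: metabelian_index_def)
  next
    case (Cons j0 ks0)
    \<comment> \<open>The brackets whose first or second monomial survives, respectively; none is in both sets.\<close>
    define A where "A = {w \<in> ?I. hd (snd w) = i0}"
    define B where "B = {w \<in> ?I. fst w = i0}"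
    define M where "M w = mset (if w \<in> A then fst w # tl (snd w) else snd w)" for w
    define c where "c w = (if w \<in> A then E w else - E w)" for w
    have len: "length (snd w) = length js0" and ne: "snd w \<noteq> []" if "w \<in> ?I" for w
      using that w0 Cons by (auto simp: metabelian_index_def)
    have zero: "(\<Sum>w\<in>A \<union> B. c w * prod_mset (image_mset a (M w))) = 0" for a
    proof -
      let ?K = "2 * (- 2) ^ length ks0 :: complex"
      let ?f = "\<lambda>w. c w * prod_mset (image_mset a (M w))"
      have "?K * (if w \<in> A \<union> B then ?f w else 0)
          = E w * (fst \<circ> snd) (lie_eval (\<lambda>i. (a i, ?b i, 0)) (left_normed (fst w) (snd w)))"
        if w: "w \<in> ?I" for w
      proof -
        obtain i j ks where w_eq: "w = (i, j # ks)" using ne[OF w] by (cases w; cases "snd w") auto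
        have "length ks = length ks0" using len[OF w] w_eq Cons by simp
        moreover have "j < i" using w by (simp add: w_eq metabelian_index_def)
        ultimately show ?thesis
          using w unfolding w_eq
          by (auto simp: lie_eval_left_normed_borel A_def B_def c_def M_def
              prod_mset_prod_list[symmetric] simp flip: mset_map)
      qed
      hence "?K * (\<Sum>w\<in>?I. if w \<in> A \<union> B then ?f w else 0) = 0"
        using sum_I[of a ?b] by (simp add: sum_distrib_left)
      hence "(\<Sum>w\<in>?I. if w \<in> A \<union> B then ?f w else 0) = 0" by simp
      moreover have "?I \<inter> (A \<union> B) = A \<union> B" by (auto simp: A_def B_def)
      ultimately show ?thesis using sum.inter_restrict[OF fin(1), of ?f "A \<union> B"] by simp
    qed
    have "(\<Sum>w\<in>{w\<in>A \<union> B. M w = mset js0}. c w) = 0"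
    proof (rule polynomial_function_coeffs_zero[where V = "{1..n}"])
      show "finite (A \<union> B)" using fin by (auto simp: A_def B_def)
      show "set_mset (M w) \<subseteq> {1..n}" if "w \<in> A \<union> B" for w
        using that list.set_sel(2)[of "snd w"] ne[of w]
        by (fastforce simp: A_def B_def M_def metabelian_index_def)
    qed (use zero in auto)
    moreover have "{w\<in>A \<union> B. M w = mset js0} = {(i0, js0)}"
    proof (intro equalityI subsetI)
      fix w assume w: "w \<in> {w\<in>A \<union> B. M w = mset js0}"
      hence wI: "w \<in> ?I" by (auto simp: A_def B_def)
      obtain i j ks where w_eq: "w = (i, j # ks)" using ne[OF wI] by (cases w; cases "snd w") auto
      show "w \<in> {(i0, js0)}"
      proof (cases "w \<in> A")
        case True
        \<comment> \<open>Then all letters of \<open>M w\<close> are at least \<open>i0\<close>, but \<open>js0\<close> starts with a smaller one.\<close>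
        have "j0 \<in># M w" using w Cons by simp
        hence "j0 \<in> insert i (set ks)" using True by (simp add: M_def w_eq)
        moreover have "j0 < i0" using w0 Cons by (simp add: metabelian_index_def)
        moreover have "j = i0" "j < i" "\<forall>m\<in>set ks. j \<le> m"
          using True wI by (auto simp: A_def metabelian_index_def w_eq)
        ultimately show ?thesis by auto
      next
        case False
        hence "mset (snd w) = mset js0" "fst w = i0" using w by (auto simp: M_def B_def)
        moreover have "sorted (snd w)" "sorted js0" using wI w0 by (auto simp: metabelian_index_def)
        ultimately show ?thesis
          by (metis prod.collapse properties_for_sort singletonI sorted_sort_id)
      qed
    next
      fix w assume "w \<in> {(i0, js0)}"
      thus "w \<in> {w\<in>A \<union> B. M w = mset js0}"
        using w0 Cons by (auto simp: A_def B_def M_def metabelian_index_def)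
    qed
    moreover have "(i0, js0) \<notin> A" using w0 Cons by (auto simp: A_def metabelian_index_def)
    ultimately show ?thesis by (simp add: c_def)
  qed
  thus ?thesis by (simp add: E_def t_eq)
qed

text \<open>
  Setting \<open>Y\<close> to zero outside a set of letters leaves only the brackets with letters in that set. With
  three letters the values at the standard basis of \<open>sl\<^sub>2\<close> are multiples of distinct basis vectors.
  With four letters, making two of the \<open>Y\<^sub>i\<close> equal kills one of the three brackets and makes the other
  two agree up to sign; the three choices below force all coefficients to be zero.
\<close>

lemma double_independent:
  assumes van: "\<And>\<pi>. \<pi> \<in> {fst, fst \<circ> snd, snd \<circ> snd} \<Longrightarrow> vanishes (double_basis n) e \<pi>"
    and t: "t \<in> double_basis n"
  shows "e t = 0"
proof -
  let ?I = "double_index n"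
  define w where "w i j k l = Br (Br (Gen i) (Gen j)) (Br (Gen k) (Gen l))" for i j k l :: nat
  define d where "d = (\<lambda>(i, j, k, l). e (w i j k l))"
  have "?I \<subseteq> {1..n} \<times> {1..n} \<times> {1..n} \<times> {1..n}"
    by (auto simp: double_index_def)
  hence fin: "finite ?I" by (rule finite_subset) auto
  have sum_T: "(\<Sum>(i, j, k, l)\<in>T. d (i, j, k, l) * \<pi> (lie_eval Y (w i j k l))) = 0"
    if \<pi>: "\<pi> \<in> {fst, fst \<circ> snd, snd \<circ> snd}" and T: "T \<subseteq> ?I"
      and other: "\<And>i j k l. (i, j, k, l) \<in> ?I - T \<Longrightarrow> d (i, j, k, l) = 0 \<or> lie_eval Y (w i j k l) = 0"
    for \<pi> T Y
  proof -
    have "(\<Sum>t\<in>double_basis n. e t * \<pi> (lie_eval Y t)) = 0" using van[OF \<pi>] by blast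
    hence "(\<Sum>(i, j, k, l)\<in>?I. d (i, j, k, l) * \<pi> (lie_eval Y (w i j k l))) = 0"
      unfolding double_basis_def
      by (subst (asm) sum.reindex[OF inj_on_double]) (simp add: case_prod_unfold d_def w_def)
    moreover have "\<pi> 0 = 0" using \<pi> by auto
    ultimately show ?thesis
      using sum.mono_neutral_right[OF fin T,
          of "\<lambda>(i, j, k, l). d (i, j, k, l) * \<pi> (lie_eval Y (w i j k l))"] other
      by fastforce
  qed
  have triple: "d (r, p, q, p) = 0 \<and> d (r, q, q, p) = 0 \<and> d (r, q, r, p) = 0"
    if pqr: "p < q" "q < r" "p \<in> {1..n}" "q \<in> {1..n}" "r \<in> {1..n}" for p q r
  proof -
    let ?T = "{(r, p, q, p), (r, q, q, p), (r, q, r, p)}"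
    define Y :: "nat \<Rightarrow> sl2" where
      "Y i = (if i = p then (1, 0, 0) else if i = q then (0, 1, 0) else if i = r then (0, 0, 1) else 0)"
      for i
    have Y: "Y p = (1, 0, 0)" "Y q = (0, 1, 0)" "Y r = (0, 0, 1)"
      using pqr by (auto simp: Y_def)
    have Y0: "Y i = 0" if "i \<notin> {p, q, r}" for i using that by (auto simp: Y_def)
    have "?T \<subseteq> ?I" using pqr by (auto simp: double_index_def)
    moreover have "lie_eval Y (w i j k l) = 0" if "(i, j, k, l) \<in> ?I - ?T" for i j k l
    proof (cases "{i, j, k, l} \<subseteq> {p, q, r}")
      case True
      moreover have "j < i" "l < k" "k < i \<or> k = i \<and> l < j"
        using that by (auto simp: double_index_def)
      moreover have "(a, b) \<in> {(q, p), (r, p), (r, q)}"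
        if "a \<in> {p, q, r}" "b \<in> {p, q, r}" "b < a" for a b
        using that pqr by auto
      ultimately have "(i, j) \<in> {(q, p), (r, p), (r, q)}" "(k, l) \<in> {(q, p), (r, p), (r, q)}"
        by simp_all
      hence "(i, j, k, l) \<in> ?T" using \<open>k < i \<or> k = i \<and> l < j\<close> pqr by auto
      thus ?thesis using that by blast
    next
      case False
      thus ?thesis using Y0 by (auto simp: w_def)
    qed
    ultimately have "(\<Sum>(i, j, k, l)\<in>?T. d (i, j, k, l) * \<pi> (lie_eval Y (w i j k l))) = 0"
      if "\<pi> \<in> {fst, fst \<circ> snd, snd \<circ> snd}" for \<pi>
      using that by (intro sum_T) auto
    note sum_zero = this
    show ?thesis
      using sum_zero[of fst] sum_zero[of "fst \<circ> snd"] sum_zero[of "snd \<circ> snd"] pqr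
      by (simp add: w_def Y)
  qed
  have quad: "d (s, p, r, q) = 0 \<and> d (s, q, r, p) = 0 \<and> d (s, r, q, p) = 0"
    if pqrs: "p < q" "q < r" "r < s" "p \<in> {1..n}" "q \<in> {1..n}" "r \<in> {1..n}" "s \<in> {1..n}" for p q r s
  proof -
    let ?T = "{(s, p, r, q), (s, q, r, p), (s, r, q, p)}"
    have eq: "d (s, p, r, q) * fst (lie_eval Y (w s p r q)) + d (s, q, r, p) * fst (lie_eval Y (w s q r p))
        + d (s, r, q, p) * fst (lie_eval Y (w s r q p)) = 0"
      if Y: "\<And>i. i \<notin> {p, q, r, s} \<Longrightarrow> Y i = 0" for Y
    proof -
      have "?T \<subseteq> ?I" using pqrs by (auto simp: double_index_def)
      moreover have "d (i, j, k, l) = 0 \<or> lie_eval Y (w i j k l) = 0"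
        if ijkl: "(i, j, k, l) \<in> ?I - ?T" for i j k l
      proof (cases "{i, j, k, l} \<subseteq> {p, q, r, s}")
        case True
        have mem: "i \<in> {1..n}" "j \<in> {1..n}" "k \<in> {1..n}" "l \<in> {1..n}"
          and less: "j < i" "l < k" "k < i \<or> k = i \<and> l < j"
          using ijkl by (auto simp: double_index_def)
        let ?P = "{(q, p), (r, p), (r, q), (s, p), (s, q), (s, r)}"
        have notT: "(i, j, k, l) \<notin> ?T" using ijkl by blast
        have order: "p < q" "p < r" "p < s" "q < r" "q < s" "r < s" using pqrs by auto
        have P: "(a, b) \<in> ?P" if "a \<in> {p, q, r, s}" "b \<in> {p, q, r, s}" "b < a" for a b
          using that pqrs by auto
        have m: "i \<in> {p, q, r, s}" "j \<in> {p, q, r, s}" "k \<in> {p, q, r, s}" "l \<in> {p, q, r, s}"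
          using True by simp_all
        have "j = l \<and> k < i \<or> j = k \<and> k < i \<or> k = i \<and> l < j"
          using P[OF m(1,2) less(1)] P[OF m(3,4) less(2)]
          by (elim insertE emptyE Pair_inject; use notT less(3) order in simp)
        thus ?thesis
          using triple[of l k i] triple[of l j i] mem less by auto
      next
        case False
        thus ?thesis using Y by (auto simp: w_def)
      qed
      ultimately have "(\<Sum>(i, j, k, l)\<in>?T. d (i, j, k, l) * fst (lie_eval Y (w i j k l))) = 0"
        by (intro sum_T) auto
      thus ?thesis using pqrs by (simp add: add_ac)
    qed
    define Y :: "nat \<Rightarrow> nat \<Rightarrow> nat \<Rightarrow> nat \<Rightarrow> nat \<Rightarrow> sl2" where
      "Y a b c f i = (if i = a \<or> i = b then (1, 0, 0) else if i = c then (0, 1, 0)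
          else if i = f then (0, 0, 1) else 0)" for a b c f i
    have "d (s, p, r, q) * 4 + d (s, q, r, p) * 4 = 0"
      using eq[of "Y p q r s"] pqrs by (simp add: Y_def w_def)
    hence "d (s, p, r, q) + d (s, q, r, p) = 0"
      by (metis distrib_right mult_eq_0_iff zero_neq_numeral)
    moreover have "d (s, p, r, q) = d (s, r, q, p)"
      using eq[of "Y p r q s"] pqrs by (simp add: Y_def w_def)
    moreover have "d (s, q, r, p) = d (s, r, q, p)"
      using eq[of "Y p s q r"] pqrs by (simp add: Y_def w_def)
    ultimately show ?thesis by simp
  qed
  obtain i j k l where ijkl: "(i, j, k, l) \<in> ?I" and t_eq: "t = w i j k l"
    using t by (auto simp: double_basis_def w_def)
  have mem: "i \<in> {1..n}" "j \<in> {1..n}" "k \<in> {1..n}" "l \<in> {1..n}"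
    and less: "j < i" "l < k" "k < i \<or> k = i \<and> l < j"
    using ijkl by (auto simp: double_index_def)
  consider "k = i" "l < j" | "k < i" "j = l" | "k < i" "j = k" | "k < i" "j < l"
    | "k < i" "l < j" "j < k" | "k < i" "k < j"
    using less by linarith
  hence "d (i, j, k, l) = 0"
  proof cases
    case 1
    thus ?thesis using triple[of l j i] mem less by simp
  next
    case 2
    thus ?thesis using triple[of l k i] mem less by simp
  next
    case 3
    thus ?thesis using triple[of l k i] mem less by simp
  next
    case 4
    thus ?thesis using quad[of j l k i] mem less by simp
  next
    case 5
    thus ?thesis using quad[of l j k i] mem less by simp
  next
    case 6
    thus ?thesis using quad[of l k j i] mem less by simp
  qed
  thus ?thesis by (simp add: d_def t_eq)
qed

theorem hall_basis_independent:
  assumes van: "\<And>\<pi>. \<pi> \<in> {fst, fst \<circ> snd, snd \<circ> snd} \<Longrightarrow> vanishes (hall_basis n k) e \<pi>"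
    and t: "t \<in> hall_basis n k"
  shows "e t = 0"
proof (cases "t \<in> metabelian_basis n k")
  case True
  thus ?thesis using metabelian_independent van by blast
next
  case False
  have metabelian: "e t = 0" if "t \<in> metabelian_basis n k" for t
    using that metabelian_independent van by blast
  have "double_basis n \<subseteq> hall_basis n k" "t \<in> double_basis n" and
    diff: "hall_basis n k - double_basis n \<subseteq> metabelian_basis n k"
    using False t by (auto simp: hall_basis_def split: if_splits)
  moreover have "(\<Sum>t\<in>hall_basis n k. e t * \<pi> (lie_eval Y t)) = (\<Sum>t\<in>double_basis n. e t * \<pi> (lie_eval Y t))"
    for \<pi> :: "sl2 \<Rightarrow> complex" and Y
    using calculation metabelian by (intro sum.mono_neutral_right finite_hall_basis) auto
  ultimately show ?thesis
    using van double_independent[where n = n and e = e and t = t] by simp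
qed

section \<open>Leading terms along curves of representations\<close>

lemma carrier_SL: "A \<in> carrier SL \<longleftrightarrow> det A = 1"
  and mult_SL: "A \<otimes>\<^bsub>SL\<^esub> B = A ** B"
  and one_SL: "\<one>\<^bsub>SL\<^esub> = mat 1"
  by (simp_all add: SL_def)

lemma group_SL: "group (SL :: (complex^'m^'m) monoid)"
proof (rule groupI)
  fix A :: "complex^'m^'m" assume "A \<in> carrier SL"
  hence A: "det A = 1" by (simp add: carrier_SL)
  then obtain B where B: "A ** B = mat 1" "B ** A = mat 1"
    using invertible_det_nz[of A] by (auto simp: invertible_def)
  have "det B = 1" using arg_cong[OF B(1), of det] A by (simp add: det_mul)
  thus "\<exists>B\<in>carrier SL. B \<otimes>\<^bsub>SL\<^esub> A = \<one>\<^bsub>SL\<^esub>"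
    using B by (auto simp: carrier_SL mult_SL one_SL)
qed (auto simp: carrier_SL mult_SL one_SL det_mul matrix_mul_assoc)

context group
begin

lemma rep_variety_mult:
  "r \<in> rep_variety G \<Longrightarrow> g \<in> carrier G \<Longrightarrow> h \<in> carrier G \<Longrightarrow> r (g \<otimes> h) = r g ** r h"
  by (simp add: rep_variety_def hom_def mult_SL)

lemma rep_variety_det: "r \<in> rep_variety G \<Longrightarrow> g \<in> carrier G \<Longrightarrow> det (r g) = 1"
  by (auto simp: rep_variety_def hom_def carrier_SL Pi_iff)

lemma rep_variety_one: "r \<in> rep_variety G \<Longrightarrow> r \<one> = mat 1"
  using hom_one[of r G SL] is_group group_SL by (simp add: rep_variety_def one_SL)

lemma rep_variety_inv: "r \<in> rep_variety G \<Longrightarrow> g \<in> carrier G \<Longrightarrow> r g ** r (inv g) = mat 1"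
  by (simp add: rep_variety_one flip: rep_variety_mult)

end

lemma tendsto_matrix_mult:
  fixes f g :: "'t \<Rightarrow> complex^'m^'m"
  assumes "(f \<longlongrightarrow> A) F" "(g \<longlongrightarrow> B) F"
  shows "((\<lambda>t. f t ** g t) \<longlongrightarrow> A ** B) F"
  unfolding matrix_matrix_mult_def using assms
  by (intro vec_tendstoI) (auto intro!: tendsto_intros)

text \<open>By Cramer's rule the inverse depends continuously on the matrix.\<close>

lemma tendsto_matrix_inverse:
  fixes f g :: "'t \<Rightarrow> complex^'m^'m"
  assumes f: "(f \<longlongrightarrow> mat 1) F" and det: "\<And>t. det (f t) = 1" and inv: "\<And>t. f t ** g t = mat 1"
  shows "(g \<longlongrightarrow> mat 1) F"
proof (intro vec_tendstoI)
  fix i j :: 'm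
  let ?C = "\<lambda>A :: complex^'m^'m. \<chi> k l. if l = i then axis j 1 $ k else A $ k $ l"
  have "A $ i $ j = det (?C B)" if "det B = 1" "B ** A = mat 1" for A B :: "complex^'m^'m"
  proof -
    have "B *v column j A = axis j 1"
      using that(2) by (simp add: vec_eq_iff matrix_matrix_mult_def matrix_vector_mult_def column_def
          mat_def axis_def)
    hence "column j A = (\<chi> k. det (\<chi> i l. if l = k then axis j 1 $ i else B $ i $ l) / det B)"
      using cramer[of B "column j A" "axis j 1"] that(1) by simp
    from arg_cong[OF this, of "\<lambda>v. v $ i"] show ?thesis using that(1) by (simp add: column_def)
  qed
  note entry = this
  have "((\<lambda>t. det (?C (f t))) \<longlongrightarrow> det (?C (mat 1))) F"
    unfolding det_def using f by (auto intro!: tendsto_intros)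
  thus "((\<lambda>t. g t $ i $ j) \<longlongrightarrow> (mat 1 :: complex^'m^'m) $ i $ j) F"
    using entry[OF det inv] entry[of "mat 1" "mat 1"] by simp
qed

text \<open>
  The curve \<open>f\<close> is \<open>1 + t\<^sup>k M\<close> up to higher order. Only the limit is recorded, so \<open>M\<close> may be zero.
\<close>

definition leading_term :: "(real \<Rightarrow> complex^'m^'m) \<Rightarrow> nat \<Rightarrow> complex^'m^'m \<Rightarrow> bool" where
  "leading_term f k M \<longleftrightarrow> ((\<lambda>t. (1 / t ^ k) *\<^sub>R (f t - mat 1)) \<longlongrightarrow> M) (at 0)"

lemma leading_term_unique: "leading_term f k M \<Longrightarrow> leading_term f k N \<Longrightarrow> M = N"
  unfolding leading_term_def by (rule tendsto_unique[rotated]) auto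

lemma leading_term_Suc:
  assumes "leading_term f (Suc k) M"
  shows "leading_term f k 0"
proof -
  have "((\<lambda>t. t *\<^sub>R ((1 / t ^ Suc k) *\<^sub>R (f t - mat 1))) \<longlongrightarrow> 0) (at 0)"
    using tendsto_scaleR[OF tendsto_ident_at assms[unfolded leading_term_def]]
    by (simp only: scaleR_zero_left)
  moreover have "eventually (\<lambda>t. t *\<^sub>R ((1 / t ^ Suc k) *\<^sub>R (f t - mat 1)) =
      (1 / t ^ k) *\<^sub>R (f t - mat 1)) (at 0)"
    by (auto simp: eventually_at_filter)
  ultimately show ?thesis
    unfolding leading_term_def by (rule Lim_transform_eventually)
qed

lemma leading_term_tendsto:
  assumes "k \<ge> 1" "leading_term f k M"
  shows "(f \<longlongrightarrow> mat 1) (at 0)"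
proof -
  have "((\<lambda>t. mat 1 + (t ^ k) *\<^sub>R ((1 / t ^ k) *\<^sub>R (f t - mat 1))) \<longlongrightarrow> mat 1 + (0 ^ k) *\<^sub>R M) (at 0)"
    using assms unfolding leading_term_def by (intro tendsto_intros)
  moreover have "eventually (\<lambda>t. mat 1 + (t ^ k) *\<^sub>R ((1 / t ^ k) *\<^sub>R (f t - mat 1)) = f t) (at 0)"
    by (auto simp: eventually_at_filter)
  ultimately have "(f \<longlongrightarrow> mat 1 + (0 ^ k) *\<^sub>R M) (at 0)"
    by (rule Lim_transform_eventually)
  thus ?thesis using assms(1) by (simp add: power_0_left)
qed

lemma scaleR_matrix_mult:
  fixes A B :: "complex^'m^'m"
  shows "(c *\<^sub>R A) ** B = c *\<^sub>R (A ** B)" "A ** (c *\<^sub>R B) = c *\<^sub>R (A ** B)"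
  by (simp_all add: vec_eq_iff matrix_matrix_mult_def scaleR_sum_right)

lemma matrix_mult_diff_distrib:
  fixes A B C :: "complex^'m^'m"
  shows "(A - B) ** C = A ** C - B ** C" "A ** (B - C) = A ** B - A ** C"
  by (simp_all add: vec_eq_iff matrix_matrix_mult_def left_diff_distrib right_diff_distrib
      sum_subtractf)

lemma leading_term_mult:
  assumes k: "k \<ge> 1" and f: "leading_term f k M" and g: "leading_term g k N"
  shows "leading_term (\<lambda>t. f t ** g t) k (M + N)"
proof -
  have "((\<lambda>t. ((1 / t ^ k) *\<^sub>R (f t - mat 1)) ** g t + (1 / t ^ k) *\<^sub>R (g t - mat 1))
      \<longlongrightarrow> M ** mat 1 + N) (at 0)"
    using f g leading_term_tendsto[OF k g] unfolding leading_term_def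
    by (intro tendsto_intros tendsto_matrix_mult)
  moreover have "((1 / t ^ k) *\<^sub>R (f t - mat 1)) ** g t + (1 / t ^ k) *\<^sub>R (g t - mat 1)
      = (1 / t ^ k) *\<^sub>R (f t ** g t - mat 1)" for t
    by (simp add: scaleR_matrix_mult matrix_mult_diff_distrib flip: scaleR_add_right)
  ultimately show ?thesis by (simp add: leading_term_def)
qed

lemma leading_term_inverse:
  assumes k: "k \<ge> 1" and f: "leading_term f k M" "\<And>t. det (f t) = 1" and g: "\<And>t. f t ** g t = mat 1"
  shows "leading_term g k (- M)"
proof -
  have "((\<lambda>t. - (((1 / t ^ k) *\<^sub>R (f t - mat 1)) ** g t)) \<longlongrightarrow> - (M ** mat 1)) (at 0)"
    using f(1) tendsto_matrix_inverse[OF leading_term_tendsto[OF k f(1)] f(2) g]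
    unfolding leading_term_def by (intro tendsto_intros tendsto_matrix_mult)
  moreover have "- (((1 / t ^ k) *\<^sub>R (f t - mat 1)) ** g t) = (1 / t ^ k) *\<^sub>R (g t - mat 1)" for t
    by (simp add: scaleR_matrix_mult matrix_mult_diff_distrib g flip: scaleR_minus_right)
  ultimately show ?thesis by (simp add: leading_term_def)
qed

text \<open>
  The group commutator is \<open>1 + ((f - 1)(g - 1) - (g - 1)(f - 1)) f\<inverse> g\<inverse>\<close>, so that leading terms
  turn group commutators into matrix commutators.
\<close>

lemma leading_term_commutator:
  assumes kl: "k \<ge> 1" "l \<ge> 1" and f: "leading_term f k M" "\<And>t. det (f t) = 1"
    and g: "leading_term g l N" "\<And>t. det (g t) = 1"
    and inv: "\<And>t. f t ** f' t = mat 1" "\<And>t. g t ** g' t = mat 1"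
  shows "leading_term (\<lambda>t. f t ** g t ** f' t ** g' t) (k + l) (M ** N - N ** M)"
proof -
  let ?f = "\<lambda>t. (1 / t ^ k) *\<^sub>R (f t - mat 1)" and ?g = "\<lambda>t. (1 / t ^ l) *\<^sub>R (g t - mat 1)"
  have "((\<lambda>t. (?f t ** ?g t - ?g t ** ?f t) ** f' t ** g' t)
      \<longlongrightarrow> (M ** N - N ** M) ** mat 1 ** mat 1) (at 0)"
    using f(1) g(1) tendsto_matrix_inverse[OF leading_term_tendsto[OF kl(1) f(1)] f(2) inv(1)]
      tendsto_matrix_inverse[OF leading_term_tendsto[OF kl(2) g(1)] g(2) inv(2)]
    unfolding leading_term_def by (intro tendsto_intros tendsto_matrix_mult)
  moreover have "(?f t ** ?g t - ?g t ** ?f t) ** f' t ** g' t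
      = (1 / t ^ (k + l)) *\<^sub>R (f t ** g t ** f' t ** g' t - mat 1)" for t
  proof -
    have "g t ** f t ** f' t ** g' t = g t ** (f t ** f' t) ** g' t"
      by (simp only: matrix_mul_assoc)
    hence "g t ** f t ** f' t ** g' t = mat 1" by (simp add: inv)
    moreover have "?f t ** ?g t - ?g t ** ?f t = (1 / t ^ (k + l)) *\<^sub>R (f t ** g t - g t ** f t)"
      by (simp add: scaleR_matrix_mult matrix_mult_diff_distrib power_add mult.commute
          flip: scaleR_diff_right)
    ultimately show ?thesis by (simp add: scaleR_matrix_mult matrix_mult_diff_distrib)
  qed
  ultimately show ?thesis by (simp add: leading_term_def)
qed

text \<open>The copy of \<open>sl\<^sub>2\<close> in the \<open>m \<times> m\<close> matrices that is spanned by two coordinates \<open>p\<close> and \<open>q\<close>.\<close>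

definition sl2_matrix :: "'m \<Rightarrow> 'm \<Rightarrow> sl2 \<Rightarrow> complex^'m^'m" where
  "sl2_matrix p q = (\<lambda>(a, b, c). \<chi> i j.
     if i = p \<and> j = p then a else if i = q \<and> j = q then - a
     else if i = p \<and> j = q then b else if i = q \<and> j = p then c else 0)"

lemma sl2_matrix_entries:
  assumes "p \<noteq> q"
  shows "sl2_matrix p q u $ p $ p = fst u" "sl2_matrix p q u $ p $ q = fst (snd u)"
    "sl2_matrix p q u $ q $ p = snd (snd u)"
  using assms by (auto simp: sl2_matrix_def case_prod_unfold)

lemma sl2_matrix_bracket:
  fixes p q :: "'m :: finite"
  assumes "p \<noteq> q"
  shows "sl2_matrix p q u ** sl2_matrix p q v - sl2_matrix p q v ** sl2_matrix p q u
    = sl2_matrix p q (sl2_bracket u v)"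
proof -
  obtain a b c a' b' c' where uv: "u = (a, b, c)" "v = (a', b', c')"
    by (cases u, cases v)
  have mult: "(sl2_matrix p q u ** A) $ i $ j
      = sl2_matrix p q u $ i $ p * A $ p $ j + sl2_matrix p q u $ i $ q * A $ q $ j"
    for i j u and A :: "complex^'m^'m"
  proof -
    have "(sl2_matrix p q u ** A) $ i $ j = (\<Sum>k\<in>{p, q}. sl2_matrix p q u $ i $ k * A $ k $ j)"
      unfolding matrix_matrix_mult_def vec_lambda_beta
      by (intro sum.mono_neutral_right) (auto simp: sl2_matrix_def case_prod_unfold)
    thus ?thesis using assms by simp
  qed
  show ?thesis
    using assms unfolding vec_eq_iff vector_minus_component mult
    by (auto simp: uv sl2_matrix_def algebra_simps)
qed

text \<open>
  Every element of \<open>sl\<^sub>2\<close> is tangent to a curve in \<open>SL\<close>: the product of a diagonal, an upper and a lower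
  unipotent curve has the sum of the three derivatives as its derivative.
\<close>

lemma SL_curve_exists:
  fixes p q :: "'m :: finite"
  assumes pq: "p \<noteq> q"
  obtains f :: "real \<Rightarrow> complex^'m^'m"
  where "\<And>t. det (f t) = 1" "leading_term f 1 (sl2_matrix p q u)"
proof -
  obtain a b c where u: "u = (a, b, c)" by (cases u)
  define D :: "real \<Rightarrow> complex^'m^'m" where
    "D t = (\<chi> i j. if i = j then (if i = p then exp (t *\<^sub>R a) else 1) * (if i = q then exp (- t *\<^sub>R a) else 1)
              else 0)" for t
  define E :: "'m \<Rightarrow> 'm \<Rightarrow> complex \<Rightarrow> real \<Rightarrow> complex^'m^'m" where
    "E i j z t = (\<chi> k. if k = i then row i (mat 1) + (t *\<^sub>R z) *s row j (mat 1) else row k (mat 1))"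
    for i j z t
  have "det (D t) = (\<Prod>i\<in>UNIV. (if i = p then exp (t *\<^sub>R a) else 1) * (if i = q then exp (- t *\<^sub>R a) else 1))"
    for t
    by (subst det_diagonal) (auto simp: D_def)
  hence detD: "det (D t) = 1" for t
    by (simp add: prod.distrib exp_minus)
  have detE: "det (E i j z t) = 1" if "i \<noteq> j" for i j z t
    using det_row_operation[OF that, of "mat 1" "t *\<^sub>R z"] by (simp add: E_def)
  have exp_lim: "((\<lambda>t. (1 / t) *\<^sub>R (exp (t *\<^sub>R z) - 1)) \<longlongrightarrow> z) (at (0 :: real))" for z :: complex
  proof -
    have "((\<lambda>t. exp (t *\<^sub>R z)) has_vector_derivative z) (at 0)"
      using exp_scaleR_has_vector_derivative_right[of z 0 UNIV] by simp
    hence "((\<lambda>t. norm (exp (t *\<^sub>R z) - 1 - t *\<^sub>R z) / norm t) \<longlongrightarrow> 0) (at 0)"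
      by (simp add: has_vector_derivative_def has_derivative_at)
    moreover have "eventually (\<lambda>t. norm (exp (t *\<^sub>R z) - 1 - t *\<^sub>R z) / norm t
        = norm ((1 / t) *\<^sub>R (exp (t *\<^sub>R z) - 1) - z)) (at 0)"
      unfolding eventually_at_filter
    proof (intro always_eventually allI impI)
      fix t :: real assume "t \<noteq> 0"
      hence "(1 / t) *\<^sub>R (exp (t *\<^sub>R z) - 1) - z = (1 / t) *\<^sub>R (exp (t *\<^sub>R z) - 1 - t *\<^sub>R z)"
        by (simp add: scaleR_diff_right)
      thus "norm (exp (t *\<^sub>R z) - 1 - t *\<^sub>R z) / norm t
          = norm ((1 / t) *\<^sub>R (exp (t *\<^sub>R z) - 1) - z)"
        by (simp add: divide_inverse mult.commute)
    qed
    ultimately have "((\<lambda>t. norm ((1 / t) *\<^sub>R (exp (t *\<^sub>R z) - 1) - z)) \<longlongrightarrow> 0) (at 0)"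
      by (rule Lim_transform_eventually)
    thus ?thesis using Lim_null tendsto_norm_zero_iff by blast
  qed
  show ?thesis
  proof
    show "det (D t ** E p q b t ** E q p c t) = 1" for t
      using pq by (simp add: det_mul detD detE)
    have "leading_term D 1 (sl2_matrix p q (a, 0, 0))"
      unfolding leading_term_def
    proof (intro vec_tendstoI)
      fix i j
      show "((\<lambda>t. ((1 / t ^ 1) *\<^sub>R (D t - mat 1)) $ i $ j) \<longlongrightarrow> sl2_matrix p q (a, 0, 0) $ i $ j) (at 0)"
        using pq exp_lim[of a] exp_lim[of "- a"]
        by (auto simp: D_def mat_def sl2_matrix_def)
    qed
    moreover have "leading_term (E p q b) 1 (sl2_matrix p q (0, b, 0))"
      unfolding leading_term_def
    proof (intro vec_tendstoI)
      fix i j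
      show "((\<lambda>t. ((1 / t ^ 1) *\<^sub>R (E p q b t - mat 1)) $ i $ j)
          \<longlongrightarrow> sl2_matrix p q (0, b, 0) $ i $ j) (at 0)"
        using pq by (intro tendsto_eventually)
          (auto simp: E_def mat_def row_def sl2_matrix_def eventually_at_filter)
    qed
    moreover have "leading_term (E q p c) 1 (sl2_matrix p q (0, 0, c))"
      unfolding leading_term_def
    proof (intro vec_tendstoI)
      fix i j
      show "((\<lambda>t. ((1 / t ^ 1) *\<^sub>R (E q p c t - mat 1)) $ i $ j)
          \<longlongrightarrow> sl2_matrix p q (0, 0, c) $ i $ j) (at 0)"
        using pq by (intro tendsto_eventually)
          (auto simp: E_def mat_def row_def sl2_matrix_def eventually_at_filter)
    qed
    ultimately have "leading_term (\<lambda>t. D t ** E p q b t ** E q p c t) 1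
        (sl2_matrix p q (a, 0, 0) + sl2_matrix p q (0, b, 0) + sl2_matrix p q (0, 0, c))"
      by (intro leading_term_mult) simp_all
    also have "sl2_matrix p q (a, 0, 0) + sl2_matrix p q (0, b, 0) + sl2_matrix p q (0, 0, c)
        = sl2_matrix p q u"
      using pq by (auto simp: vec_eq_iff sl2_matrix_def u)
    finally show "leading_term (\<lambda>t. D t ** E p q b t ** E q p c t) 1 (sl2_matrix p q u)" .
  qed
qed

text \<open>
  A curve of representations that starts at the trivial one with prescribed tangent directions at the
  generators. Only its germ at \<open>t = 0\<close> matters.
\<close>

locale SL_deformation = finitely_generated_group +
  fixes r :: "real \<Rightarrow> 'a \<Rightarrow> complex^'m^'m" and p q :: "'m :: finite" and Y :: "nat \<Rightarrow> sl2"
  assumes rep: "\<And>t. r t \<in> rep_variety G"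
    and pq: "p \<noteq> q"
    and leading_generators: "\<And>i. i \<in> {1..n} \<Longrightarrow> leading_term (\<lambda>t. r t (x i)) 1 (sl2_matrix p q (Y i))"
begin

lemmas rep_mult = rep_variety_mult[OF rep]
  and rep_det = rep_variety_det[OF rep]
  and rep_one = rep_variety_one[OF rep]
  and rep_inv = rep_variety_inv[OF rep]

lemma leading_term_gcomm:
  assumes "k \<ge> 1" "l \<ge> 1" "g \<in> carrier G" "h \<in> carrier G"
    "leading_term (\<lambda>t. r t g) k M" "leading_term (\<lambda>t. r t h) l N"
  shows "leading_term (\<lambda>t. r t (gcomm G g h)) (k + l) (M ** N - N ** M)"
  using leading_term_commutator[OF assms(1,2,5) rep_det[OF assms(3)] assms(6) rep_det[OF assms(4)]
      rep_inv[OF assms(3)] rep_inv[OF assms(4)]] assms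
  by (simp add: gcomm_def rep_mult)

lemma subgroup_leading_term:
  assumes "k \<ge> 1"
  shows "subgroup {g \<in> carrier G. \<exists>M. leading_term (\<lambda>t. r t g) k M} G"
proof (rule subgroupI)
  have "leading_term (\<lambda>t. r t \<one>) k 0" by (simp add: leading_term_def rep_one)
  thus "{g \<in> carrier G. \<exists>M. leading_term (\<lambda>t. r t g) k M} \<noteq> {}" by blast
next
  fix g assume "g \<in> {g \<in> carrier G. \<exists>M. leading_term (\<lambda>t. r t g) k M}"
  then obtain M where g: "g \<in> carrier G" and M: "leading_term (\<lambda>t. r t g) k M" by blast
  show "inv g \<in> {g \<in> carrier G. \<exists>M. leading_term (\<lambda>t. r t g) k M}"
    using leading_term_inverse[OF assms M rep_det[OF g] rep_inv[OF g]] g by blast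
next
  fix g h assume "g \<in> {g \<in> carrier G. \<exists>M. leading_term (\<lambda>t. r t g) k M}"
    "h \<in> {g \<in> carrier G. \<exists>M. leading_term (\<lambda>t. r t g) k M}"
  thus "g \<otimes> h \<in> {g \<in> carrier G. \<exists>M. leading_term (\<lambda>t. r t g) k M}"
    using leading_term_mult[OF assms, of "\<lambda>t. r t g" _ "\<lambda>t. r t h"] by (auto simp: rep_mult)
qed auto

lemma lower_central_leading_term:
  assumes "k \<ge> 1" "g \<in> lower_central G k"
  shows "\<exists>M. leading_term (\<lambda>t. r t g) k M"
  using assms
proof (induction k arbitrary: g rule: nat_induct_at_least)
  case base
  have "x ` {1..n} \<subseteq> {g \<in> carrier G. \<exists>M. leading_term (\<lambda>t. r t g) 1 M}"
    using generators leading_generators by blast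
  hence "generate G (x ` {1..n}) \<subseteq> {g \<in> carrier G. \<exists>M. leading_term (\<lambda>t. r t g) 1 M}"
    by (intro generate_subgroup_incl subgroup_leading_term) auto
  thus ?case using base generate by auto
next
  case (Suc k)
  have "lower_central G (Suc k) \<subseteq> {g \<in> carrier G. \<exists>M. leading_term (\<lambda>t. r t g) (Suc k) M}"
    unfolding lower_central_Suc[OF Suc.hyps]
  proof (intro generate_subgroup_incl subgroup_leading_term, clarify)
    fix a b assume a: "a \<in> lower_central G k" and b: "b \<in> carrier G"
    obtain M where M: "leading_term (\<lambda>t. r t a) k M" using Suc.IH a by blast
    have "x ` {1..n} \<subseteq> {g \<in> carrier G. \<exists>M. leading_term (\<lambda>t. r t g) 1 M}"
      using generators leading_generators by blast
    hence "generate G (x ` {1..n}) \<subseteq> {g \<in> carrier G. \<exists>M. leading_term (\<lambda>t. r t g) 1 M}"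
      by (intro generate_subgroup_incl subgroup_leading_term) auto
    then obtain N where N: "leading_term (\<lambda>t. r t b) 1 N" using b generate by auto
    have ac: "a \<in> carrier G" using a lower_central_carrier by blast
    thus "gcomm G a b \<in> carrier G \<and> (\<exists>M. leading_term (\<lambda>t. r t (gcomm G a b)) (Suc k) M)"
      using leading_term_gcomm[OF Suc.hyps _ ac b M N] b by auto
  qed simp
  thus ?case using Suc.prems by blast
qed

lemma leading_term_group_eval:
  "letters s \<subseteq> {1..n} \<Longrightarrow>
     leading_term (\<lambda>t. r t (group_eval G x s)) (weight s) (sl2_matrix p q (lie_eval Y s))"
proof (induction s)
  case (Gen i)
  thus ?case using leading_generators by simp
next
  case (Br s u)
  have "group_eval G x s \<in> carrier G" "group_eval G x u \<in> carrier G"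
    using Br.prems group_eval_lower_central lower_central_carrier by auto
  hence "leading_term (\<lambda>t. r t (gcomm G (group_eval G x s) (group_eval G x u))) (weight s + weight u)
      (sl2_matrix p q (lie_eval Y s) ** sl2_matrix p q (lie_eval Y u)
        - sl2_matrix p q (lie_eval Y u) ** sl2_matrix p q (lie_eval Y s))"
    using leading_term_gcomm[OF weight_pos weight_pos] Br by simp
  thus ?case by (simp add: sl2_matrix_bracket[OF pq])
qed

end

lemma free_group_finitely_generated:
  assumes F: "free_group_with_basis G n x"
  shows "finitely_generated_group G x n"
  using F free_group_generate[OF F]
  by (simp add: finitely_generated_group_def finitely_generated_group_axioms_def
      free_group_with_basis_def)

lemma SL_deformation_exists:
  fixes p q :: "'m :: finite"
  assumes F: "free_group_with_basis G n x" and pq: "p \<noteq> q"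
  obtains r :: "real \<Rightarrow> 'a \<Rightarrow> complex^'m^'m" where "SL_deformation G x n r p q Y"
proof -
  interpret group G using F by (simp add: free_group_with_basis_def)
  have x: "x ` {1..n} \<subseteq> carrier G" using F by (simp add: free_group_with_basis_def)
  have "\<exists>f :: real \<Rightarrow> complex^'m^'m. (\<forall>t. det (f t) = 1) \<and> leading_term f 1 (sl2_matrix p q (Y i))" for i
    using SL_curve_exists[OF pq, of "Y i"] by metis
  then obtain f :: "nat \<Rightarrow> real \<Rightarrow> complex^'m^'m" where
    f: "\<And>i t. det (f i t) = 1" "\<And>i. leading_term (f i) 1 (sl2_matrix p q (Y i))"
    by metis
  have "\<exists>\<phi>. \<phi> \<in> rep_variety G \<and> (\<forall>i\<in>{1..n}. \<phi> (x i) = f i t)" for t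
  proof -
    obtain \<phi> where \<phi>: "\<phi> \<in> hom G SL" "\<And>i. i \<in> {1..n} \<Longrightarrow> \<phi> (x i) = f i t"
    proof (rule free_group_extend_hom[OF F group_SL])
      show "(\<lambda>i. f i t) ` {1..n} \<subseteq> carrier SL" using f(1) by (auto simp: carrier_SL)
    qed blast
    have "restrict \<phi> (carrier G) \<in> rep_variety G"
      using \<phi>(1) by (auto simp: rep_variety_def hom_def)
    moreover have "restrict \<phi> (carrier G) (x i) = f i t" if "i \<in> {1..n}" for i
    proof -
      have "x i \<in> carrier G" using x that by blast
      thus ?thesis using \<phi>(2) that by simp
    qed
    ultimately show ?thesis by blast
  qed
  then obtain r where r: "\<And>t. r t \<in> rep_variety G" "\<And>t i. i \<in> {1..n} \<Longrightarrow> r t (x i) = f i t"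
    by metis
  have "SL_deformation G x n r p q Y"
  proof
    show "leading_term (\<lambda>t. r t (x i)) 1 (sl2_matrix p q (Y i))" if "i \<in> {1..n}" for i
      using f(2) r(2)[OF that] by simp
  qed (use x r pq free_group_generate[OF F] in auto)
  thus ?thesis by (rule that)
qed

text \<open>
  Write \<open>g\<close> modulo the next term as a product of powers of basic commutators. The leading term of \<open>g\<close>
  along a curve with directions \<open>Y\<close> is the corresponding combination of basic brackets at \<open>Y\<close>. If
  it is zero for all \<open>Y\<close>, independence on \<open>sl\<^sub>2\<close> makes all exponents zero.
\<close>

theorem lower_central_detected_by_SL:
  fixes p q :: "'m :: finite"
  assumes F: "free_group_with_basis G n x" and pq: "p \<noteq> q" and k: "k \<in> {1..4}"
    and g: "g \<in> lower_central G k"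
    and zero: "\<And>Y r :: real \<Rightarrow> 'a \<Rightarrow> complex^'m^'m.
      SL_deformation G x n r p q Y \<Longrightarrow> leading_term (\<lambda>t. r t g) k 0"
  shows "g \<in> lower_central G (Suc k)"
proof -
  interpret finitely_generated_group G x n by (rule free_group_finitely_generated[OF F])
  let ?B = "hall_basis n k" and ?K = "lower_central G k" and ?N = "lower_central G (Suc k)"
  have k1: "k \<ge> 1" using k by simp
  have "g \<in> generate G (group_eval G x ` ?B \<union> ?N)"
    using g lower_central_eq_hall_span[OF k] by (simp add: hall_span_def)
  moreover have "gcomm G u v \<in> ?N" if "u \<in> ?K" "v \<in> ?K" for u v
    using gcomm_lower_central_carrier[OF k1 that(1)] that(2) lower_central_carrier by blast
  ultimately obtain e :: "nat lie_word \<Rightarrow> int" where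
    e: "\<And>\<phi> :: 'a \<Rightarrow> complex. (\<forall>u\<in>?K. \<forall>v\<in>?K. \<phi> (u \<otimes>\<^bsub>G\<^esub> v) = \<phi> u + \<phi> v) \<Longrightarrow> (\<forall>u\<in>?N. \<phi> u = 0)
        \<Longrightarrow> \<phi> g = (\<Sum>t\<in>?B. of_int (e t) * \<phi> (group_eval G x t))"
    and e0: "(\<forall>t\<in>?B. e t = 0) \<longrightarrow> g \<in> ?N"
    using generate_coordinates[OF finite_hall_basis lower_central_subgroup lower_central_subgroup
        lower_central_Suc_subset, of "group_eval G x" n k k g, where 'v = complex]
      hall_basis_eval_subset[of k] by auto
  have entries: "(\<Sum>t\<in>?B. of_int (e t) * sl2_matrix p q (lie_eval Y t) $ i $ j) = 0" for Y i j
  proof -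
    obtain r :: "real \<Rightarrow> 'a \<Rightarrow> complex^'m^'m" where "SL_deformation G x n r p q Y"
      using SL_deformation_exists[OF F pq] by blast
    then interpret SL_deformation G x n r p q Y .
    define \<phi> where "\<phi> h = (THE M. leading_term (\<lambda>t. r t h) k M) $ i $ j" for h
    have \<phi>: "\<phi> h = M $ i $ j" if "leading_term (\<lambda>t. r t h) k M" for h M
      unfolding \<phi>_def using that leading_term_unique by (metis (mono_tags, lifting) the_equality)
    have "\<phi> g = (\<Sum>t\<in>?B. of_int (e t) * \<phi> (group_eval G x t))"
    proof (intro e ballI)
      fix u v assume uv: "u \<in> ?K" "v \<in> ?K"
      then obtain M N where MN: "leading_term (\<lambda>t. r t u) k M" "leading_term (\<lambda>t. r t v) k N"
        using lower_central_leading_term[OF k1] by blast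
      have "leading_term (\<lambda>t. r t (u \<otimes>\<^bsub>G\<^esub> v)) k (M + N)"
        using leading_term_mult[OF k1 MN] uv lower_central_carrier[of _ k] by (simp add: rep_mult)
      thus "\<phi> (u \<otimes>\<^bsub>G\<^esub> v) = \<phi> u + \<phi> v" using \<phi> MN by simp
    next
      fix u assume "u \<in> ?N"
      hence "leading_term (\<lambda>t. r t u) k 0"
        using lower_central_leading_term[of "Suc k" u] leading_term_Suc by auto
      thus "\<phi> u = 0" using \<phi> by force
    qed
    moreover have "\<phi> g = 0"
      using \<phi>[OF zero[OF SL_deformation_axioms]] by simp
    moreover have "\<phi> (group_eval G x t) = sl2_matrix p q (lie_eval Y t) $ i $ j" if "t \<in> ?B" for t
      using \<phi> leading_term_group_eval[OF hall_basis_letters[OF that]] hall_basis_weight[OF that]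
      by simp
    ultimately show ?thesis by simp
  qed
  have "vanishes ?B (\<lambda>t. of_int (e t)) \<pi>" if "\<pi> \<in> {fst, fst \<circ> snd, snd \<circ> snd}" for \<pi>
    using that entries[of _ p p] entries[of _ p q] entries[of _ q p]
    by (auto simp: sl2_matrix_entries[OF pq])
  hence "of_int (e t) = (0 :: complex)" if "t \<in> ?B" for t
    using hall_basis_independent[where e = "\<lambda>t. of_int (e t)"] that by blast
  thus ?thesis using e0 by simp
qed

section \<open>The algebra of functions on the representation variety\<close>

lemma fun_ring_simps:
  "carrier (fun_ring S) = extensional S" "f \<otimes>\<^bsub>fun_ring S\<^esub> g = (\<lambda>r\<in>S. f r * g r)"
  "\<one>\<^bsub>fun_ring S\<^esub> = (\<lambda>r\<in>S. 1)" "\<zero>\<^bsub>fun_ring S\<^esub> = (\<lambda>r\<in>S. 0)"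
  "f \<oplus>\<^bsub>fun_ring S\<^esub> g = (\<lambda>r\<in>S. f r + g r)"
  by (simp_all add: fun_ring_def)

lemma cring_fun_ring: "cring (fun_ring S)"
proof (rule cringI)
  show "abelian_group (fun_ring S)"
  proof (rule abelian_groupI)
    fix f assume "f \<in> carrier (fun_ring S)"
    thus "\<exists>g\<in>carrier (fun_ring S). g \<oplus>\<^bsub>fun_ring S\<^esub> f = \<zero>\<^bsub>fun_ring S\<^esub>"
      by (intro bexI[of _ "\<lambda>r\<in>S. - f r"]) (auto simp: fun_ring_simps intro!: restrict_ext)
  qed (auto simp: fun_ring_simps add_ac intro!: restrict_ext extensionalityI[of _ S])
  show "comm_monoid (fun_ring S)"
    by (rule comm_monoidI)
      (auto simp: fun_ring_simps mult_ac intro!: restrict_ext extensionalityI[of _ S])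
qed (auto simp: fun_ring_simps distrib_right intro!: restrict_ext)

lemma a_inv_fun_ring:
  assumes "f \<in> extensional S"
  shows "\<ominus>\<^bsub>fun_ring S\<^esub> f = (\<lambda>r\<in>S. - f r)"
proof -
  interpret cring "fun_ring S" by (rule cring_fun_ring)
  show ?thesis
    using assms by (intro minus_equality) (auto simp: fun_ring_simps intro!: restrict_ext)
qed

text \<open>Negation is multiplication by a rational number.\<close>

lemma rat_subalgebraI:
  assumes "V \<subseteq> extensional S" "(\<lambda>r\<in>S. 1) \<in> V"
    and "\<And>f g. f \<in> V \<Longrightarrow> g \<in> V \<Longrightarrow> (\<lambda>r\<in>S. f r * g r) \<in> V"
    and "\<And>f g. f \<in> V \<Longrightarrow> g \<in> V \<Longrightarrow> (\<lambda>r\<in>S. f r + g r) \<in> V"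
    and scale: "\<And>q f. f \<in> V \<Longrightarrow> (\<lambda>r\<in>S. of_rat q * f r) \<in> V"
  shows "rat_subalgebra S V"
proof -
  interpret cring "fun_ring S" by (rule cring_fun_ring)
  have "subring V (fun_ring S)"
  proof (rule subringI)
    fix f assume f: "f \<in> V"
    thus "\<ominus>\<^bsub>fun_ring S\<^esub> f \<in> V"
      using scale[OF f, of "-1"] assms(1) a_inv_fun_ring[of f S] by auto
  qed (use assms in \<open>auto simp: fun_ring_simps\<close>)
  thus ?thesis using scale by (simp add: rat_subalgebra_def)
qed

lemma rat_subalgebraD:
  assumes "rat_subalgebra S V"
  shows "V \<subseteq> extensional S" "(\<lambda>r\<in>S. 1) \<in> V"
    "f \<in> V \<Longrightarrow> g \<in> V \<Longrightarrow> (\<lambda>r\<in>S. f r * g r) \<in> V"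
    "f \<in> V \<Longrightarrow> g \<in> V \<Longrightarrow> (\<lambda>r\<in>S. f r + g r) \<in> V"
    "f \<in> V \<Longrightarrow> (\<lambda>r\<in>S. of_rat q * f r) \<in> V"
proof -
  have V: "subring V (fun_ring S)" using assms by (simp add: rat_subalgebra_def)
  show "f \<in> V \<Longrightarrow> (\<lambda>r\<in>S. of_rat q * f r) \<in> V" using assms by (simp add: rat_subalgebra_def)
qed (use subringE[of V "fun_ring S"] assms in \<open>auto simp: rat_subalgebra_def fun_ring_simps\<close>)

lemma rat_subalgebra_hull:
  assumes "C \<subseteq> extensional S"
  shows "rat_subalgebra S (rat_subalgebra S hull C)"
proof -
  have "rat_subalgebra S (extensional S)" by (rule rat_subalgebraI) auto
  hence sub: "rat_subalgebra S hull C \<subseteq> extensional S" using assms by (rule hull_minimal[rotated])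
  show ?thesis
    by (rule rat_subalgebraI[OF sub]) (auto simp: hull_def dest: rat_subalgebraD(2-5))
qed

text \<open>The argument \<open>M\<close> only fixes the matrix size.\<close>

locale rep_ring = finitely_generated_group G x n for G :: "('a, 'b) monoid_scheme" (structure) and x n +
  fixes M :: "'m :: finite itself"
begin

abbreviation Reps :: "('a \<Rightarrow> complex^'m^'m) set" where "Reps \<equiv> rep_variety G"
abbreviation A :: "(('a \<Rightarrow> complex^'m^'m) \<Rightarrow> complex) ring" where "A \<equiv> rep_algebra G"
abbreviation J :: "(('a \<Rightarrow> complex^'m^'m) \<Rightarrow> complex) set" where "J \<equiv> rep_ideal G n x"

definition J_power :: "nat \<Rightarrow> (('a \<Rightarrow> complex^'m^'m) \<Rightarrow> complex) set" where
  "J_power k = J [^]\<^bsub>ideals_set A\<^esub> k"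

lemma A_simps:
  "f \<otimes>\<^bsub>A\<^esub> g = (\<lambda>r\<in>Reps. f r * g r)" "\<one>\<^bsub>A\<^esub> = (\<lambda>r\<in>Reps. 1)" "\<zero>\<^bsub>A\<^esub> = (\<lambda>r\<in>Reps. 0)"
  "f \<oplus>\<^bsub>A\<^esub> g = (\<lambda>r\<in>Reps. f r + g r)"
  by (simp_all add: rep_algebra_def fun_ring_def)

lemma carrier_A:
  "carrier A = rat_subalgebra Reps hull {coord G i j g | i j g. g \<in> carrier G}"
  by (simp add: rep_algebra_def)

lemma rat_subalgebra_A: "rat_subalgebra Reps (carrier A)"
  unfolding carrier_A by (rule rat_subalgebra_hull) (auto simp: coord_def)

lemmas A_extensional = rat_subalgebraD(1)[OF rat_subalgebra_A]
  and A_one = rat_subalgebraD(2)[OF rat_subalgebra_A]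
  and A_mult = rat_subalgebraD(3)[OF rat_subalgebra_A]
  and A_add = rat_subalgebraD(4)[OF rat_subalgebra_A]
  and A_scale = rat_subalgebraD(5)[OF rat_subalgebra_A]

lemma A_uminus: "f \<in> carrier A \<Longrightarrow> (\<lambda>r\<in>Reps. - f r) \<in> carrier A"
  using A_scale[of f "-1"] by simp

lemma coord_in_A: "g \<in> carrier G \<Longrightarrow> coord G i j g \<in> carrier A"
  unfolding carrier_A by (intro hull_inc) blast

lemma A_induct:
  assumes "rat_subalgebra Reps V" "\<And>i j g. g \<in> carrier G \<Longrightarrow> coord G i j g \<in> V"
  shows "carrier A \<subseteq> V"
  unfolding carrier_A using assms by (intro hull_minimal) auto

sublocale A: ring A
proof -
  interpret cring "fun_ring Reps" by (rule cring_fun_ring)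
  have "subring (carrier A) (fun_ring Reps)"
    using rat_subalgebra_A by (simp add: rat_subalgebra_def)
  from subring_is_ring[OF this] show "ring A"
    by (simp add: rep_algebra_def)
qed

lemma a_inv_A: "f \<in> carrier A \<Longrightarrow> \<ominus>\<^bsub>A\<^esub> f = (\<lambda>r\<in>Reps. - f r)"
  by (rule A.minus_equality) (auto simp: A_simps A_uminus intro!: restrict_ext)

lemma ideal_AI:
  assumes "V \<subseteq> carrier A" "(\<lambda>r\<in>Reps. 0) \<in> V"
    and "\<And>f g. f \<in> V \<Longrightarrow> g \<in> V \<Longrightarrow> (\<lambda>r\<in>Reps. f r + g r) \<in> V"
    and mult: "\<And>f g. f \<in> V \<Longrightarrow> g \<in> carrier A \<Longrightarrow> (\<lambda>r\<in>Reps. f r * g r) \<in> V"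
  shows "ideal V A"
proof (rule idealI)
  show "subgroup V (add_monoid A)"
  proof (rule A.add.subgroupI)
    fix f assume f: "f \<in> V"
    have "(\<lambda>r\<in>Reps. f r * (\<lambda>r\<in>Reps. - (\<lambda>r\<in>Reps. 1) r) r) \<in> V"
      by (intro mult f A_uminus A_one)
    thus "\<ominus>\<^bsub>A\<^esub> f \<in> V"
      using f assms(1) a_inv_A by (auto simp: cong: restrict_cong)
  qed (use assms in \<open>auto simp: A_simps\<close>)
next
  fix f g assume "f \<in> V" "g \<in> carrier A"
  thus "g \<otimes>\<^bsub>A\<^esub> f \<in> V" "f \<otimes>\<^bsub>A\<^esub> g \<in> V"
    using mult by (auto simp: A_simps mult.commute)
qed (rule A.ring_axioms)

context
  fixes I assumes I: "ideal I A"
begin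

lemma ideal_A_subset: "f \<in> I \<Longrightarrow> f \<in> carrier A"
  using ideal.Icarr[OF I] by blast

lemma ideal_A_extensional: "f \<in> I \<Longrightarrow> f \<in> extensional Reps"
  using ideal_A_subset A_extensional by blast

lemma ideal_A_zero: "(\<lambda>r\<in>Reps. 0) \<in> I"
  using additive_subgroup.zero_closed[OF ideal.axioms(1)[OF I]] by (simp add: A_simps)

lemma ideal_A_add: "f \<in> I \<Longrightarrow> g \<in> I \<Longrightarrow> (\<lambda>r\<in>Reps. f r + g r) \<in> I"
  using additive_subgroup.a_closed[OF ideal.axioms(1)[OF I]] by (simp add: A_simps)

lemma ideal_A_mult: "f \<in> I \<Longrightarrow> g \<in> carrier A \<Longrightarrow> (\<lambda>r\<in>Reps. f r * g r) \<in> I"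
  using ideal.I_r_closed[OF I] by (simp add: A_simps)

lemma ideal_A_scale:
  assumes "f \<in> I"
  shows "(\<lambda>r\<in>Reps. of_rat q * f r) \<in> I"
proof -
  have "(\<lambda>r\<in>Reps. f r * (\<lambda>r\<in>Reps. of_rat q * (\<lambda>r\<in>Reps. 1) r) r) \<in> I"
    by (intro ideal_A_mult assms A_scale A_one)
  thus ?thesis by (simp add: mult.commute cong: restrict_cong)
qed

lemma ideal_A_diff:
  assumes "f \<in> I" "g \<in> I"
  shows "(\<lambda>r\<in>Reps. f r - g r) \<in> I"
proof -
  have "(\<lambda>r\<in>Reps. f r + (\<lambda>r\<in>Reps. of_rat (-1) * g r) r) \<in> I"
    by (intro ideal_A_add ideal_A_scale assms)
  thus ?thesis by (simp cong: restrict_cong)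
qed

lemma ideal_A_sum:
  assumes "finite K" "\<And>k. k \<in> K \<Longrightarrow> (\<lambda>r\<in>Reps. f k r) \<in> I"
  shows "(\<lambda>r\<in>Reps. \<Sum>k\<in>K. f k r) \<in> I"
  using assms
proof (induction K rule: finite_induct)
  case empty
  show ?case using ideal_A_zero by (simp only: sum.empty)
next
  case (insert k K)
  have "(\<lambda>r\<in>Reps. (\<lambda>r\<in>Reps. f k r) r + (\<lambda>r\<in>Reps. \<Sum>k\<in>K. f k r) r) \<in> I"
    using insert by (intro ideal_A_add) auto
  also have "(\<lambda>r\<in>Reps. (\<lambda>r\<in>Reps. f k r) r + (\<lambda>r\<in>Reps. \<Sum>k\<in>K. f k r) r)
      = (\<lambda>r\<in>Reps. \<Sum>k\<in>insert k K. f k r)"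
    using insert.hyps by (intro restrict_ext) simp
  finally show ?case .
qed

end

lemma shifted_coord_apply:
  "r \<in> Reps \<Longrightarrow> shifted_coord G i j g r = (r g - mat 1) $ i $ j"
  by (simp add: shifted_coord_def coord_def mat_def)

lemma shifted_coord_extensional: "shifted_coord G i j g \<in> extensional Reps"
  by (simp add: shifted_coord_def)

lemma shifted_coord_in_A:
  assumes "g \<in> carrier G"
  shows "shifted_coord G i j g \<in> carrier A"
proof -
  have "(\<lambda>r\<in>Reps. coord G i j g r + (\<lambda>r\<in>Reps. of_rat (if i = j then - 1 else 0) * (\<lambda>r\<in>Reps. 1) r) r)
      \<in> carrier A"
    by (intro A_add A_scale A_one coord_in_A assms)
  moreover have "(\<lambda>r\<in>Reps. coord G i j g r
      + (\<lambda>r\<in>Reps. of_rat (if i = j then - 1 else 0) * (\<lambda>r\<in>Reps. 1) r) r) = shifted_coord G i j g"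
    by (auto simp: shifted_coord_def intro!: restrict_ext)
  ultimately show ?thesis by simp
qed

lemma J_generators_in_A:
  "{shifted_coord G i j (x l) | i j l. l \<in> {1..n}} \<subseteq> carrier A"
  using shifted_coord_in_A generators by blast

lemma ideal_J: "ideal J A"
  unfolding rep_ideal_def by (rule A.genideal_ideal[OF J_generators_in_A])

lemma shifted_coord_generator_in_J: "l \<in> {1..n} \<Longrightarrow> shifted_coord G i j (x l) \<in> J"
  unfolding rep_ideal_def using A.genideal_self[OF J_generators_in_A] by blast

lemma J_power_0: "J_power 0 = carrier A"
  and J_power_Suc: "J_power (Suc k) = ideal_prod A (J_power k) J"
  by (simp_all add: J_power_def nat_pow_def ideals_set_def)

lemma ideal_J_power: "ideal (J_power k) A"
proof (induction k)
  case 0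
  show ?case unfolding J_power_0 by (rule A.oneideal)
next
  case (Suc k)
  thus ?case unfolding J_power_Suc using ideal_J by (rule A.ideal_prod_is_ideal)
qed

lemma J_power_Suc_subset: "J_power (Suc k) \<subseteq> J"
  unfolding J_power_Suc using A.ideal_prod_inter[OF ideal_J_power ideal_J] by blast

lemma J_power_SucI: "f \<in> J_power k \<Longrightarrow> g \<in> J \<Longrightarrow> (\<lambda>r\<in>Reps. f r * g r) \<in> J_power (Suc k)"
  unfolding J_power_Suc using ideal_prod.prod[of f "J_power k" g J A] by (simp add: A_simps)

lemma J_subset_J_power_1: "J \<subseteq> J_power 1"
proof
  fix f assume f: "f \<in> J"
  have "(\<lambda>r\<in>Reps. (\<lambda>r\<in>Reps. 1) r * f r) \<in> J_power (Suc 0)"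
    by (intro J_power_SucI f) (simp only: J_power_0 A_one)
  moreover have "(\<lambda>r\<in>Reps. (\<lambda>r\<in>Reps. 1) r * f r) = f"
    using ideal_A_extensional[OF ideal_J f] by (intro extensionalityI[of _ Reps]) auto
  ultimately show "f \<in> J_power 1" by simp
qed

lemma ideal_A_matrix_mult:
  assumes "ideal I A" "g \<in> carrier G" "\<And>i j. (\<lambda>r\<in>Reps. D r $ i $ j) \<in> I"
  shows "(\<lambda>r\<in>Reps. (D r ** r g) $ i $ j) \<in> I"
proof -
  have *: "(\<lambda>r\<in>Reps. D r $ i $ k * r g $ k $ j) \<in> I" for k
  proof -
    have "(\<lambda>r\<in>Reps. (\<lambda>r\<in>Reps. D r $ i $ k) r * coord G k j g r) \<in> I"
      by (intro ideal_A_mult assms coord_in_A)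
    thus ?thesis by (simp add: coord_def cong: restrict_cong)
  qed
  show ?thesis
    unfolding matrix_matrix_mult_def vec_lambda_beta by (rule ideal_A_sum[OF assms(1) finite *])
qed

lemma shifted_coord_eq: "shifted_coord G i j g = (\<lambda>r\<in>Reps. (r g - mat 1) $ i $ j)"
  by (rule extensionalityI[of _ Reps]) (auto simp: shifted_coord_apply shifted_coord_extensional)

lemma subgroup_shifted_coord:
  assumes I: "ideal I A"
  shows "subgroup {g \<in> carrier G. \<forall>i j. shifted_coord G i j g \<in> I} G"
proof (rule subgroupI)
  have "shifted_coord G i j \<one> = (\<lambda>r\<in>Reps. 0)" for i j
    by (auto simp: shifted_coord_eq rep_variety_one intro!: restrict_ext)
  thus "{g \<in> carrier G. \<forall>i j. shifted_coord G i j g \<in> I} \<noteq> {}"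
    using ideal_A_zero[OF I] by (auto intro!: exI[of _ \<one>])
next
  fix g assume "g \<in> {g \<in> carrier G. \<forall>i j. shifted_coord G i j g \<in> I}"
  hence g: "g \<in> carrier G" "\<And>i j. shifted_coord G i j g \<in> I" by auto
  have "shifted_coord G i j (inv g) \<in> I" for i j
  proof -
    have "(\<lambda>r\<in>Reps. ((r g - mat 1) ** r (inv g)) $ i $ j) \<in> I"
      using g by (intro ideal_A_matrix_mult[OF I]) (simp_all add: shifted_coord_eq)
    from ideal_A_scale[OF I this, of "-1"]
    have "(\<lambda>r\<in>Reps. - ((r g - mat 1) ** r (inv g)) $ i $ j) \<in> I"
      by (simp cong: restrict_cong)
    moreover have "(r (inv g) - mat 1) $ i $ j = - ((r g - mat 1) ** r (inv g)) $ i $ j"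
      if "r \<in> Reps" for r
      using that g by (simp add: matrix_mult_diff_distrib rep_variety_inv)
    hence "shifted_coord G i j (inv g) = (\<lambda>r\<in>Reps. - ((r g - mat 1) ** r (inv g)) $ i $ j)"
      unfolding shifted_coord_eq by (rule restrict_ext)
    ultimately show ?thesis by simp
  qed
  thus "inv g \<in> {g \<in> carrier G. \<forall>i j. shifted_coord G i j g \<in> I}" using g by simp
next
  fix g h assume "g \<in> {g \<in> carrier G. \<forall>i j. shifted_coord G i j g \<in> I}"
    "h \<in> {g \<in> carrier G. \<forall>i j. shifted_coord G i j g \<in> I}"
  hence g: "g \<in> carrier G" "\<And>i j. shifted_coord G i j g \<in> I"
    and h: "h \<in> carrier G" "\<And>i j. shifted_coord G i j h \<in> I" by auto
  have "shifted_coord G i j (g \<otimes> h) \<in> I" for i j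
  proof -
    have 1: "(\<lambda>r\<in>Reps. ((r g - mat 1) ** r h) $ i $ j) \<in> I"
      using g h by (intro ideal_A_matrix_mult[OF I]) (simp_all add: shifted_coord_eq)
    have "((r g - mat 1) ** r h) $ i $ j + shifted_coord G i j h r = (r (g \<otimes> h) - mat 1) $ i $ j"
      if "r \<in> Reps" for r
      using that g h by (simp add: matrix_mult_diff_distrib rep_variety_mult shifted_coord_apply)
    thus ?thesis
      using ideal_A_add[OF I 1 h(2)[of i j]]
      by (simp add: shifted_coord_eq[of i j "g \<otimes> h"] cong: restrict_cong)
  qed
  thus "g \<otimes> h \<in> {g \<in> carrier G. \<forall>i j. shifted_coord G i j g \<in> I}" using g h by simp
qed auto

lemma shifted_coord_in_J: "g \<in> carrier G \<Longrightarrow> shifted_coord G i j g \<in> J"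
proof -
  have "x ` {1..n} \<subseteq> {g \<in> carrier G. \<forall>i j. shifted_coord G i j g \<in> J}"
    using generators shifted_coord_generator_in_J by auto
  hence "generate G (x ` {1..n}) \<subseteq> {g \<in> carrier G. \<forall>i j. shifted_coord G i j g \<in> J}"
    by (intro generate_subgroup_incl subgroup_shifted_coord ideal_J)
  thus "g \<in> carrier G \<Longrightarrow> shifted_coord G i j g \<in> J" using generate by auto
qed

text \<open>
  A commutator \<open>[u, v]\<close> acts as the identity plus \<open>(UV - VU) u\<inverse> v\<inverse>\<close> where \<open>U = u - 1\<close> and
  \<open>V = v - 1\<close>, so that the orders of vanishing add up.
\<close>

lemma shifted_coord_lower_central:
  assumes "k \<ge> 1" "g \<in> lower_central G k"
  shows "shifted_coord G i j g \<in> J_power k"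
  using assms
proof (induction k arbitrary: g i j rule: nat_induct_at_least)
  case base
  thus ?case using shifted_coord_in_J J_subset_J_power_1 by auto
next
  case (Suc k)
  let ?I = "J_power (Suc k)"
  note I = ideal_J_power[of "Suc k"]
  have "{gcomm G u v | u v. u \<in> lower_central G k \<and> v \<in> carrier G}
      \<subseteq> {g \<in> carrier G. \<forall>i j. shifted_coord G i j g \<in> ?I}"
  proof clarify
    fix u v assume u: "u \<in> lower_central G k" and v: "v \<in> carrier G"
    have uc: "u \<in> carrier G" using lower_central_carrier[OF u] .
    have uv: "(\<lambda>r\<in>Reps. (r u - mat 1) $ i $ l * (r v - mat 1) $ l' $ j) \<in> ?I" for i j l l'
    proof -
      have "(\<lambda>r\<in>Reps. shifted_coord G i l u r * shifted_coord G l' j v r) \<in> ?I"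
        using Suc.IH[OF u] shifted_coord_in_J[OF v] by (intro J_power_SucI)
      thus ?thesis by (simp add: shifted_coord_apply cong: restrict_cong)
    qed
    let ?D = "\<lambda>r. (r u - mat 1) ** (r v - mat 1) - (r v - mat 1) ** (r u - mat 1)"
    have D: "(\<lambda>r\<in>Reps. ?D r $ i $ j) \<in> ?I" for i j
    proof -
      have 1: "(\<lambda>r\<in>Reps. \<Sum>l\<in>UNIV. (r u - mat 1) $ i $ l * (r v - mat 1) $ l $ j) \<in> ?I"
        by (rule ideal_A_sum[OF I finite uv])
      have 2: "(\<lambda>r\<in>Reps. \<Sum>l\<in>UNIV. (r u - mat 1) $ l $ j * (r v - mat 1) $ i $ l) \<in> ?I"
        by (rule ideal_A_sum[OF I finite uv])
      show ?thesis
        using ideal_A_diff[OF I 1 2]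
        by (simp add: matrix_matrix_mult_def mult.commute cong: restrict_cong)
    qed
    have "shifted_coord G i j (gcomm G u v) \<in> ?I" for i j
    proof -
      have "(\<lambda>r\<in>Reps. (?D r ** r (inv u \<otimes> inv v)) $ i $ j) \<in> ?I"
        using uc v D by (intro ideal_A_matrix_mult[OF I]) auto
      moreover have "?D r ** r (inv u \<otimes> inv v) = r (gcomm G u v) - mat 1" if r: "r \<in> Reps" for r
      proof -
        have "r v ** r u ** r (inv u \<otimes> inv v) = r (v \<otimes> u \<otimes> (inv u \<otimes> inv v))"
          using r uc v by (simp add: rep_variety_mult matrix_mul_assoc)
        also have "v \<otimes> u \<otimes> (inv u \<otimes> inv v) = \<one>"
          using uc v by (simp add: group_word_simps)
        finally have "r v ** r u ** r (inv u \<otimes> inv v) = mat 1" using r by (simp add: rep_variety_one)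
        moreover have "r u ** r v ** r (inv u \<otimes> inv v) = r (gcomm G u v)"
          using r uc v by (simp add: rep_variety_mult gcomm_def matrix_mul_assoc)
        moreover have "?D r = r u ** r v - r v ** r u"
          by (simp add: matrix_mult_diff_distrib)
        ultimately show ?thesis by (simp add: matrix_mult_diff_distrib)
      qed
      ultimately show ?thesis by (simp add: shifted_coord_eq cong: restrict_cong)
    qed
    thus "gcomm G u v \<in> carrier G \<and> (\<forall>i j. shifted_coord G i j (gcomm G u v) \<in> ?I)"
      using uc v by simp
  qed
  hence "lower_central G (Suc k) \<subseteq> {g \<in> carrier G. \<forall>i j. shifted_coord G i j g \<in> ?I}"
    unfolding lower_central_Suc[OF Suc.hyps]
    by (intro generate_subgroup_incl subgroup_shifted_coord I)
  thus ?case using Suc.prems by blast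
qed

end

section \<open>The two filtrations of the automorphism group\<close>

lemma AutoGroup_carrier:
  "\<sigma> \<in> carrier (AutoGroup G) \<longleftrightarrow>
     \<sigma> \<in> hom G G \<and> \<sigma> \<in> extensional (carrier G) \<and> bij_betw \<sigma> (carrier G) (carrier G)"
  by (auto simp: AutoGroup_def auto_def Bij_def)

lemma AutoGroup_inverse:
  assumes "group G" "\<sigma> \<in> carrier (AutoGroup G)"
  obtains \<tau> where "\<tau> \<in> carrier (AutoGroup G)"
    "\<And>g. g \<in> carrier G \<Longrightarrow> \<sigma> (\<tau> g) = g"
proof
  interpret group G by fact
  let ?\<tau> = "restrict (inv_into (carrier G) \<sigma>) (carrier G)"
  have \<sigma>: "\<sigma> \<in> hom G G" "\<sigma> \<in> Bij (carrier G)" and bij: "bij_betw \<sigma> (carrier G) (carrier G)"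
    using assms(2) by (auto simp: AutoGroup_carrier Bij_def)
  show "?\<tau> \<in> carrier (AutoGroup G)"
    using restrict_inv_into_hom[OF \<sigma>] bij by (auto simp: AutoGroup_carrier bij_betw_inv_into)
  show "\<sigma> (?\<tau> g) = g" if "g \<in> carrier G" for g
    using that bij by (simp add: bij_betw_def f_inv_into_f)
qed

lemma kernel_AutoGroup_iff:
  "\<sigma> \<in> kernel (AutoGroup G) (AutoGroup Q) (\<lambda>\<sigma>. \<lambda>C\<in>carrier Q. act \<sigma> ` C) \<longleftrightarrow>
     \<sigma> \<in> carrier (AutoGroup G) \<and> (\<forall>C\<in>carrier Q. act \<sigma> ` C = C)"
proof -
  have "(\<lambda>C\<in>carrier Q. act \<sigma> ` C) = (\<lambda>C\<in>carrier Q. C) \<longleftrightarrow> (\<forall>C\<in>carrier Q. act \<sigma> ` C = C)"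
    by (metis (mono_tags, lifting) restrict_apply' restrict_ext)
  thus ?thesis by (simp add: kernel_def AutoGroup_def BijGroup_def)
qed

context group
begin

text \<open>This allows to test on generators that an automorphism is trivial modulo \<open>N\<close>.\<close>

lemma subgroup_trivial_displacement:
  assumes N: "N \<lhd> G" and \<sigma>: "\<sigma> \<in> hom G G"
  shows "subgroup {g \<in> carrier G. inv g \<otimes> \<sigma> g \<in> N} G"
proof (rule subgroupI)
  interpret N: normal N G by fact
  have \<sigma>c: "\<sigma> g \<in> carrier G" if "g \<in> carrier G" for g using \<sigma> that by (auto simp: hom_def)
  have \<sigma>m: "\<sigma> (g \<otimes> h) = \<sigma> g \<otimes> \<sigma> h" if "g \<in> carrier G" "h \<in> carrier G" for g h
    using \<sigma> that by (auto simp: hom_def)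
  have \<sigma>1: "\<sigma> \<one> = \<one>" using hom_one[OF \<sigma> is_group is_group] .
  have \<sigma>i: "\<sigma> (inv g) = inv (\<sigma> g)" if "g \<in> carrier G" for g
    using that \<sigma>m[of "inv g" g] \<sigma>1 \<sigma>c by (intro inv_equality[symmetric]) auto
  show "{g \<in> carrier G. inv g \<otimes> \<sigma> g \<in> N} \<noteq> {}"
    using N.one_closed \<sigma>1 by (auto intro!: exI[of _ \<one>])
  {
    fix g assume g: "g \<in> {g \<in> carrier G. inv g \<otimes> \<sigma> g \<in> N}"
    have "inv (inv g) \<otimes> \<sigma> (inv g) = g \<otimes> inv (inv g \<otimes> \<sigma> g) \<otimes> inv g"
      using g \<sigma>c by (simp add: \<sigma>i group_word_simps)
    also have "\<dots> \<in> N" using g by (intro normal_conj_mem[OF N]) auto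
    finally show "inv g \<in> {g \<in> carrier G. inv g \<otimes> \<sigma> g \<in> N}" using g by simp
  next
    fix g h assume g: "g \<in> {g \<in> carrier G. inv g \<otimes> \<sigma> g \<in> N}"
      and h: "h \<in> {g \<in> carrier G. inv g \<otimes> \<sigma> g \<in> N}"
    have "inv (g \<otimes> h) \<otimes> \<sigma> (g \<otimes> h) = (inv h \<otimes> (inv g \<otimes> \<sigma> g) \<otimes> inv (inv h)) \<otimes> (inv h \<otimes> \<sigma> h)"
      using g h \<sigma>c by (simp add: \<sigma>m group_word_simps)
    also have "\<dots> \<in> N"
    proof (rule N.m_closed)
      show "inv h \<otimes> (inv g \<otimes> \<sigma> g) \<otimes> inv (inv h) \<in> N"
        by (rule normal_conj_mem[OF N]) (use g h in simp_all)
    qed (use h in simp)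
    finally show "g \<otimes> h \<in> {g \<in> carrier G. inv g \<otimes> \<sigma> g \<in> N}" using g h by simp
  }
qed auto

lemma andreadakis_iff:
  "\<sigma> \<in> andreadakis G k \<longleftrightarrow>
     \<sigma> \<in> carrier (AutoGroup G) \<and> (\<forall>g\<in>carrier G. inv g \<otimes> \<sigma> g \<in> lower_central G (k + 1))"
proof -
  let ?N = "lower_central G (k + 1)"
  interpret N: normal ?N G by (rule lower_central_normal)
  have "(\<forall>C\<in>carrier (G Mod ?N). \<sigma> ` C = C) \<longleftrightarrow> (\<forall>g\<in>carrier G. inv g \<otimes> \<sigma> g \<in> ?N)"
    if \<sigma>: "\<sigma> \<in> carrier (AutoGroup G)"
  proof -
    have bij: "bij_betw \<sigma> (carrier G) (carrier G)" using \<sigma> by (simp add: AutoGroup_carrier)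
    have \<sigma>c: "\<sigma> g \<in> carrier G" if "g \<in> carrier G" for g using bij that by (auto simp: bij_betw_def)
    have coset: "h \<in> ?N #> g \<longleftrightarrow> inv g \<otimes> h \<in> ?N" if "g \<in> carrier G" "h \<in> carrier G" for g h
    proof -
      have "h \<in> g <# ?N \<longleftrightarrow> inv g \<otimes> h \<in> ?N"
      proof
        assume "h \<in> g <# ?N"
        then obtain m where "m \<in> ?N" "h = g \<otimes> m" by (auto simp: l_coset_def)
        thus "inv g \<otimes> h \<in> ?N" using that by (simp add: inv_mult_cancel_left)
      next
        assume "inv g \<otimes> h \<in> ?N"
        moreover have "h = g \<otimes> (inv g \<otimes> h)" using that by (simp add: mult_inv_cancel_left)
        ultimately show "h \<in> g <# ?N" unfolding l_coset_def by blast
      qed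
      thus ?thesis using N.coset_eq that by simp
    qed
    show ?thesis
    proof (intro iffI ballI)
      fix g assume *: "\<forall>C\<in>carrier (G Mod ?N). \<sigma> ` C = C" and g: "g \<in> carrier G"
      have "g \<in> ?N #> g" using coset[OF g g] g N.one_closed by simp
      moreover have "\<sigma> ` (?N #> g) = ?N #> g" using * g by (auto simp: carrier_FactGroup)
      ultimately have "\<sigma> g \<in> ?N #> g" by blast
      thus "inv g \<otimes> \<sigma> g \<in> ?N" using coset[OF g \<sigma>c[OF g]] by simp
    next
      fix C assume *: "\<forall>g\<in>carrier G. inv g \<otimes> \<sigma> g \<in> ?N" and "C \<in> carrier (G Mod ?N)"
      then obtain g where g: "g \<in> carrier G" and C: "C = ?N #> g" by (auto simp: carrier_FactGroup)
      have C_iff: "h \<in> C \<longleftrightarrow> \<sigma> h \<in> C" if h: "h \<in> carrier G" for h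
      proof -
        have "inv g \<otimes> \<sigma> h = (inv g \<otimes> h) \<otimes> (inv h \<otimes> \<sigma> h)"
          "inv g \<otimes> h = (inv g \<otimes> \<sigma> h) \<otimes> inv (inv h \<otimes> \<sigma> h)"
          using g h \<sigma>c by (simp_all add: group_word_simps)
        thus ?thesis
          using * h g \<sigma>c N.m_closed N.m_inv_closed unfolding C by (metis coset)
      qed
      have Cc: "C \<subseteq> carrier G" using g N.subset r_coset_subset_G unfolding C by blast
      show "\<sigma> ` C = C"
      proof (intro equalityI subsetI)
        fix h assume "h \<in> \<sigma> ` C"
        thus "h \<in> C" using C_iff Cc by blast
      next
        fix h assume h: "h \<in> C"
        then obtain h' where "h' \<in> carrier G" "h = \<sigma> h'"
          using Cc bij by (auto simp: bij_betw_def)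
        thus "h \<in> \<sigma> ` C" using C_iff h by blast
      qed
    qed
  qed
  thus ?thesis by (auto simp: andreadakis_def kernel_AutoGroup_iff Let_def)
qed

end

context rep_ring
begin

lemma J_coset:
  assumes I: "ideal I A" "I \<subseteq> J" and f: "f \<in> J"
  shows "r_coset ((add_monoid A)\<lparr>carrier := J\<rparr>) I f = {h \<in> J. (\<lambda>r\<in>Reps. h r - f r) \<in> I}"
proof (intro equalityI subsetI)
  fix h assume "h \<in> r_coset ((add_monoid A)\<lparr>carrier := J\<rparr>) I f"
  then obtain d where d: "d \<in> I" and h: "h = (\<lambda>r\<in>Reps. d r + f r)"
    by (auto simp: r_coset_def A_simps)
  have "(\<lambda>r\<in>Reps. h r - f r) = d"
    using ideal_A_extensional[OF I(1) d] by (intro extensionalityI[of _ Reps]) (auto simp: h)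
  moreover have "h \<in> J"
    unfolding h using d I f by (intro ideal_A_add[OF ideal_J]) auto
  ultimately show "h \<in> {h \<in> J. (\<lambda>r\<in>Reps. h r - f r) \<in> I}" using d by simp
next
  fix h assume h: "h \<in> {h \<in> J. (\<lambda>r\<in>Reps. h r - f r) \<in> I}"
  define d where "d = (\<lambda>r\<in>Reps. h r - f r)"
  have "h = (\<lambda>r\<in>Reps. d r + f r)"
    using h ideal_A_extensional[OF ideal_J] by (intro extensionalityI[of _ Reps]) (auto simp: d_def)
  moreover have "d \<in> I" using h by (simp add: d_def)
  ultimately show "h \<in> r_coset ((add_monoid A)\<lparr>carrier := J\<rparr>) I f"
    unfolding r_coset_def by (auto simp: A_simps)
qed

lemma rep_filtration_iff_cosets:
  "\<sigma> \<in> rep_filtration TYPE('m) G n x k \<longleftrightarrow> \<sigma> \<in> carrier (AutoGroup G) \<and>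
     (\<forall>f\<in>J. let C = {h \<in> J. (\<lambda>r\<in>Reps. h r - f r) \<in> J_power (k + 1)} in aut_act G \<sigma> ` C = C)"
proof -
  have "carrier ((add_monoid A)\<lparr>carrier := J\<rparr> Mod (J [^]\<^bsub>ideals_set A\<^esub> (k + 1)))
      = (\<lambda>f. {h \<in> J. (\<lambda>r\<in>Reps. h r - f r) \<in> J_power (k + 1)}) ` J"
    unfolding carrier_FactGroup J_power_def[symmetric]
    using J_coset[OF ideal_J_power] J_power_Suc_subset[of k] by (auto intro!: image_cong)
  thus ?thesis
    unfolding rep_filtration_def Let_def kernel_AutoGroup_iff by simp
qed

lemma rep_filtrationD:
  assumes "\<sigma> \<in> rep_filtration TYPE('m) G n x k" "f \<in> J"
  shows "(\<lambda>r\<in>Reps. aut_act G \<sigma> f r - f r) \<in> J_power (k + 1)"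
proof -
  let ?C = "{h \<in> J. (\<lambda>r\<in>Reps. h r - f r) \<in> J_power (k + 1)}"
  have "f \<in> ?C" using ideal_A_zero[OF ideal_J_power] assms(2) by simp
  moreover have "aut_act G \<sigma> ` ?C = ?C"
    using assms unfolding rep_filtration_iff_cosets Let_def by blast
  ultimately have "aut_act G \<sigma> f \<in> ?C" by blast
  thus ?thesis by simp
qed

text \<open>
  That \<open>\<sigma>\<close> moves each function by an element of the ideal only gives \<open>\<sigma>(C) \<subseteq> C\<close> for a coset \<open>C\<close>; the
  inverse automorphism gives equality.
\<close>

lemma rep_filtrationI:
  assumes \<sigma>: "\<sigma> \<in> carrier (AutoGroup G)" and \<tau>: "\<tau> \<in> carrier (AutoGroup G)"
    and inverse: "\<And>g. g \<in> carrier G \<Longrightarrow> \<sigma> (\<tau> g) = g"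
    and diff: "\<And>f. f \<in> J \<Longrightarrow> (\<lambda>r\<in>Reps. aut_act G \<sigma> f r - f r) \<in> J_power (k + 1)"
      "\<And>f. f \<in> J \<Longrightarrow> (\<lambda>r\<in>Reps. aut_act G \<tau> f r - f r) \<in> J_power (k + 1)"
  shows "\<sigma> \<in> rep_filtration TYPE('m) G n x k"
  unfolding rep_filtration_iff_cosets Let_def
proof (intro conjI \<sigma> ballI)
  fix f assume f: "f \<in> J"
  let ?I = "J_power (k + 1)"
  let ?C = "{h \<in> J. (\<lambda>r\<in>Reps. h r - f r) \<in> ?I}"
  note I = ideal_J_power[of "k + 1"]
  have closed: "aut_act G \<upsilon> h \<in> ?C"
    if h: "h \<in> ?C" and diff: "(\<lambda>r\<in>Reps. aut_act G \<upsilon> h r - h r) \<in> ?I" for \<upsilon> h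
  proof -
    have diff_J: "(\<lambda>r\<in>Reps. aut_act G \<upsilon> h r - h r) \<in> J"
      using subsetD[OF J_power_Suc_subset[of k]] diff by (simp only: Suc_eq_plus1)
    have hJ: "h \<in> J" and hI: "(\<lambda>r\<in>Reps. h r - f r) \<in> ?I" using h by blast+
    have "(\<lambda>r\<in>Reps. (\<lambda>r\<in>Reps. aut_act G \<upsilon> h r - h r) r + h r) \<in> J"
      by (rule ideal_A_add[OF ideal_J diff_J hJ])
    also have "(\<lambda>r\<in>Reps. (\<lambda>r\<in>Reps. aut_act G \<upsilon> h r - h r) r + h r) = aut_act G \<upsilon> h"
      by (intro extensionalityI[of _ Reps]) (auto simp: aut_act_def)
    finally have "aut_act G \<upsilon> h \<in> J" .
    moreover have "(\<lambda>r\<in>Reps. (\<lambda>r\<in>Reps. aut_act G \<upsilon> h r - h r) r + (\<lambda>r\<in>Reps. h r - f r) r) \<in> ?I"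
      by (rule ideal_A_add[OF I diff hI])
    moreover have "(\<lambda>r\<in>Reps. (\<lambda>r\<in>Reps. aut_act G \<upsilon> h r - h r) r + (\<lambda>r\<in>Reps. h r - f r) r)
        = (\<lambda>r\<in>Reps. aut_act G \<upsilon> h r - f r)"
      by (intro restrict_ext) simp
    ultimately show ?thesis by simp
  qed
  show "aut_act G \<sigma> ` ?C = ?C"
  proof (intro equalityI subsetI)
    fix h assume "h \<in> aut_act G \<sigma> ` ?C"
    thus "h \<in> ?C" using closed diff(1) by blast
  next
    fix h assume h: "h \<in> ?C"
    have "aut_act G \<sigma> (aut_act G \<tau> h) = h"
    proof (rule extensionalityI[of _ Reps])
      show "h \<in> extensional Reps" using h ideal_A_extensional[OF ideal_J] by blast
      fix r assume r: "r \<in> Reps"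
      have \<tau>c: "\<tau> g \<in> carrier G" if "g \<in> carrier G" for g
        using \<tau> that by (auto simp: AutoGroup_carrier bij_betw_def)
      have "compose (carrier G) (compose (carrier G) r \<sigma>) \<tau> = r"
        using r inverse \<tau>c
        by (intro extensionalityI[of _ "carrier G"]) (auto simp: compose_def rep_variety_def)
      thus "aut_act G \<sigma> (aut_act G \<tau> h) r = h r"
        using r compose_rep_variety[OF is_group \<sigma> r] by (simp add: aut_act_def)
    qed (simp add: aut_act_def)
    note inv_act = this
    have "aut_act G \<tau> h \<in> ?C" using closed[OF h] diff(2) h by blast
    thus "h \<in> aut_act G \<sigma> ` ?C" by (rule image_eqI[where f = "aut_act G \<sigma>", OF inv_act[symmetric]])
  qed
qed

text \<open>
  The functions moved by an element of the ideal form a subalgebra, because \<open>\<sigma>\<close> acts by ring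
  homomorphisms. For the coordinates of \<open>g\<close> the difference consists of the entries of
  \<open>(\<rho>(\<sigma>(g) g\<inverse>) - 1) \<rho>(g)\<close>.
\<close>

lemma aut_act_diff_in_J_power:
  assumes \<sigma>: "\<sigma> \<in> andreadakis G k" and f: "f \<in> carrier A"
  shows "(\<lambda>r\<in>Reps. aut_act G \<sigma> f r - f r) \<in> J_power (k + 1)"
proof -
  let ?I = "J_power (k + 1)"
  note I = ideal_J_power[of "k + 1"]
  have Aut: "\<sigma> \<in> carrier (AutoGroup G)"
    and N: "\<And>g. g \<in> carrier G \<Longrightarrow> inv g \<otimes> \<sigma> g \<in> lower_central G (k + 1)"
    using \<sigma> by (auto simp: andreadakis_iff)
  have \<sigma>c: "\<sigma> g \<in> carrier G" if "g \<in> carrier G" for g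
    using Aut that by (auto simp: AutoGroup_carrier bij_betw_def)
  let ?V = "{f \<in> carrier A. aut_act G \<sigma> f \<in> carrier A \<and> (\<lambda>r\<in>Reps. aut_act G \<sigma> f r - f r) \<in> ?I}"
  let ?c = "\<lambda>r. compose (carrier G) r \<sigma>"
  have act: "aut_act G \<sigma> f = (\<lambda>r\<in>Reps. f (?c r))" for f :: "('a \<Rightarrow> complex^'m^'m) \<Rightarrow> complex"
    by (simp add: aut_act_def)
  have c: "?c r \<in> Reps" if "r \<in> Reps" for r
    using compose_rep_variety[OF is_group Aut that] .
  have "carrier A \<subseteq> ?V"
  proof (rule A_induct)
    show "rat_subalgebra Reps ?V"
    proof (rule rat_subalgebraI)
      show "?V \<subseteq> extensional Reps" using A_extensional by blast
      have "aut_act G \<sigma> (\<lambda>r\<in>Reps. 1) = (\<lambda>r\<in>Reps. 1)"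
        by (auto simp: act c intro!: restrict_ext)
      moreover have "(\<lambda>r\<in>Reps. (\<lambda>r\<in>Reps. 1) r - (\<lambda>r\<in>Reps. 1) r) = (\<lambda>r\<in>Reps. 0 :: complex)"
        by (intro restrict_ext) simp
      ultimately show "(\<lambda>r\<in>Reps. 1) \<in> ?V" using A_one ideal_A_zero[OF I] by simp
    next
      fix f g assume "f \<in> ?V" "g \<in> ?V"
      hence f: "f \<in> carrier A" "aut_act G \<sigma> f \<in> carrier A"
          "(\<lambda>r\<in>Reps. aut_act G \<sigma> f r - f r) \<in> ?I"
        and g: "g \<in> carrier A" "aut_act G \<sigma> g \<in> carrier A"
          "(\<lambda>r\<in>Reps. aut_act G \<sigma> g r - g r) \<in> ?I" by blast+
      have eq: "aut_act G \<sigma> (\<lambda>r\<in>Reps. f r * g r) = (\<lambda>r\<in>Reps. aut_act G \<sigma> f r * aut_act G \<sigma> g r)"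
        by (auto simp: act c intro!: restrict_ext)
      have "(\<lambda>r\<in>Reps. (\<lambda>r\<in>Reps. (\<lambda>r\<in>Reps. aut_act G \<sigma> f r - f r) r * aut_act G \<sigma> g r) r
          + (\<lambda>r\<in>Reps. (\<lambda>r\<in>Reps. aut_act G \<sigma> g r - g r) r * f r) r) \<in> ?I"
        by (intro ideal_A_add[OF I] ideal_A_mult[OF I] f g)
      also have "(\<lambda>r\<in>Reps. (\<lambda>r\<in>Reps. (\<lambda>r\<in>Reps. aut_act G \<sigma> f r - f r) r * aut_act G \<sigma> g r) r
          + (\<lambda>r\<in>Reps. (\<lambda>r\<in>Reps. aut_act G \<sigma> g r - g r) r * f r) r)
          = (\<lambda>r\<in>Reps. aut_act G \<sigma> (\<lambda>r\<in>Reps. f r * g r) r - (\<lambda>r\<in>Reps. f r * g r) r)"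
        unfolding eq by (intro restrict_ext) (simp add: algebra_simps)
      finally show "(\<lambda>r\<in>Reps. f r * g r) \<in> ?V"
        using A_mult[OF f(1) g(1)] A_mult[OF f(2) g(2)] by (intro CollectI conjI) (simp_all only: eq)
    next
      fix f g assume "f \<in> ?V" "g \<in> ?V"
      hence f: "f \<in> carrier A" "aut_act G \<sigma> f \<in> carrier A"
          "(\<lambda>r\<in>Reps. aut_act G \<sigma> f r - f r) \<in> ?I"
        and g: "g \<in> carrier A" "aut_act G \<sigma> g \<in> carrier A"
          "(\<lambda>r\<in>Reps. aut_act G \<sigma> g r - g r) \<in> ?I" by blast+
      have eq: "aut_act G \<sigma> (\<lambda>r\<in>Reps. f r + g r) = (\<lambda>r\<in>Reps. aut_act G \<sigma> f r + aut_act G \<sigma> g r)"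
        by (auto simp: act c intro!: restrict_ext)
      have "(\<lambda>r\<in>Reps. (\<lambda>r\<in>Reps. aut_act G \<sigma> f r - f r) r + (\<lambda>r\<in>Reps. aut_act G \<sigma> g r - g r) r) \<in> ?I"
        by (intro ideal_A_add[OF I] f g)
      also have "(\<lambda>r\<in>Reps. (\<lambda>r\<in>Reps. aut_act G \<sigma> f r - f r) r + (\<lambda>r\<in>Reps. aut_act G \<sigma> g r - g r) r)
          = (\<lambda>r\<in>Reps. aut_act G \<sigma> (\<lambda>r\<in>Reps. f r + g r) r - (\<lambda>r\<in>Reps. f r + g r) r)"
        unfolding eq by (intro restrict_ext) (simp add: algebra_simps)
      finally show "(\<lambda>r\<in>Reps. f r + g r) \<in> ?V"
        using A_add[OF f(1) g(1)] A_add[OF f(2) g(2)] by (intro CollectI conjI) (simp_all only: eq)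
    next
      fix q f assume "f \<in> ?V"
      hence f: "f \<in> carrier A" "aut_act G \<sigma> f \<in> carrier A"
          "(\<lambda>r\<in>Reps. aut_act G \<sigma> f r - f r) \<in> ?I" by blast+
      have eq: "aut_act G \<sigma> (\<lambda>r\<in>Reps. of_rat q * f r) = (\<lambda>r\<in>Reps. of_rat q * aut_act G \<sigma> f r)"
        by (auto simp: act c intro!: restrict_ext)
      have "(\<lambda>r\<in>Reps. of_rat q * (\<lambda>r\<in>Reps. aut_act G \<sigma> f r - f r) r) \<in> ?I"
        by (intro ideal_A_scale[OF I] f)
      also have "(\<lambda>r\<in>Reps. of_rat q * (\<lambda>r\<in>Reps. aut_act G \<sigma> f r - f r) r)
          = (\<lambda>r\<in>Reps. aut_act G \<sigma> (\<lambda>r\<in>Reps. of_rat q * f r) r - (\<lambda>r\<in>Reps. of_rat q * f r) r)"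
        unfolding eq by (intro restrict_ext) (simp add: algebra_simps)
      finally show "(\<lambda>r\<in>Reps. of_rat q * f r) \<in> ?V"
        using A_scale[OF f(1)] A_scale[OF f(2)] by (intro CollectI conjI) (simp_all only: eq)
    qed
  next
    fix i j g assume g: "g \<in> carrier G"
    let ?d = "\<sigma> g \<otimes> inv g"
    have "g \<otimes> (inv g \<otimes> \<sigma> g) \<otimes> inv g = ?d" using g \<sigma>c by (simp add: group_word_simps)
    hence "?d \<in> lower_central G (k + 1)"
      using normal_conj_mem[OF lower_central_normal g N[OF g]] by simp
    hence "(\<lambda>r\<in>Reps. (r ?d - mat 1) $ i $ j) \<in> ?I" for i j
      using shifted_coord_lower_central[of "k + 1" ?d i j] by (simp add: shifted_coord_eq)
    hence "(\<lambda>r\<in>Reps. ((r ?d - mat 1) ** r g) $ i $ j) \<in> ?I"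
      using g by (intro ideal_A_matrix_mult[OF I])
    also have "(\<lambda>r\<in>Reps. ((r ?d - mat 1) ** r g) $ i $ j)
        = (\<lambda>r\<in>Reps. aut_act G \<sigma> (coord G i j g) r - coord G i j g r)"
    proof (rule restrict_ext)
      fix r assume r: "r \<in> Reps"
      have "r ?d ** r g = r (?d \<otimes> g)" using r g \<sigma>c by (simp add: rep_variety_mult)
      also have "?d \<otimes> g = \<sigma> g" using g \<sigma>c by (simp add: m_assoc)
      finally show "((r ?d - mat 1) ** r g) $ i $ j = aut_act G \<sigma> (coord G i j g) r - coord G i j g r"
        unfolding aut_act_coord[OF is_group Aut g]
        using r by (simp add: matrix_mult_diff_distrib coord_def)
    qed
    finally show "coord G i j g \<in> ?V"
      using coord_in_A[OF g] coord_in_A[OF \<sigma>c[OF g]]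
      by (intro CollectI conjI) (simp_all only: aut_act_coord[OF is_group Aut g])
  qed
  thus ?thesis using f by blast
qed

lemma andreadakis_subset_rep_filtration: "andreadakis G k \<subseteq> rep_filtration TYPE('m) G n x k"
proof
  fix \<sigma> assume \<sigma>: "\<sigma> \<in> andreadakis G k"
  hence Aut: "\<sigma> \<in> carrier (AutoGroup G)"
    and N: "\<And>g. g \<in> carrier G \<Longrightarrow> inv g \<otimes> \<sigma> g \<in> lower_central G (k + 1)"
    unfolding andreadakis_iff by blast+
  obtain \<tau> where \<tau>: "\<tau> \<in> carrier (AutoGroup G)" "\<And>g. g \<in> carrier G \<Longrightarrow> \<sigma> (\<tau> g) = g"
    by (rule AutoGroup_inverse[OF is_group Aut]) (rule that)
  have "inv g \<otimes> \<tau> g \<in> lower_central G (k + 1)" if g: "g \<in> carrier G" for g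
  proof -
    have \<tau>g: "\<tau> g \<in> carrier G" using \<tau>(1) g by (auto simp: AutoGroup_carrier bij_betw_def)
    have "inv (inv (\<tau> g) \<otimes> \<sigma> (\<tau> g)) \<in> lower_central G (k + 1)"
      by (rule subgroup.m_inv_closed[OF lower_central_subgroup N[OF \<tau>g]])
    thus ?thesis using \<tau>g g \<tau>(2)[OF g] by (simp only: inv_mult_group inv_inv inv_closed)
  qed
  hence "\<tau> \<in> andreadakis G k" using \<tau>(1) by (simp add: andreadakis_iff)
  thus "\<sigma> \<in> rep_filtration TYPE('m) G n x k"
    using aut_act_diff_in_J_power[OF _ ideal_A_subset[OF ideal_J]] \<sigma>
    by (intro rep_filtrationI[OF Aut \<tau>])
qed

text \<open>
  The curve tends to the trivial representation as \<open>t\<close> tends to \<open>0\<close>, and the generators of \<open>J\<close> are of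
  first order along it. Functions in the algebra stay bounded, as coordinates do, so that an element
  of the \<open>k\<close>-th power of \<open>J\<close> is of order \<open>k\<close>.
\<close>

lemma J_power_bigo:
  assumes "SL_deformation G x n r p q Y" and f: "f \<in> J_power k"
  shows "(\<lambda>t. f (r t)) \<in> O[at 0](\<lambda>t. of_real t ^ k)"
proof -
  interpret D: SL_deformation G x n r p q Y by fact
  note rep = D.rep
  define W :: "nat \<Rightarrow> (('a \<Rightarrow> complex^'m^'m) \<Rightarrow> complex) set"
    where "W k = {f. (\<lambda>t. f (r t)) \<in> O[at 0](\<lambda>t. of_real t ^ k)}" for k
  have W_add: "(\<lambda>r\<in>Reps. f r + g r) \<in> W k" if "f \<in> W k" "g \<in> W k" for f g k
    using that rep by (auto simp: W_def intro: sum_in_bigo)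
  have W_mult: "(\<lambda>r\<in>Reps. f r * g r) \<in> W (k + l)" if "f \<in> W k" "g \<in> W l" for f g k l
    using that rep by (auto simp: W_def power_add intro: landau_o.big.mult)
  have W_const: "(\<lambda>r\<in>Reps. c) \<in> W 0" for c
    using rep by (auto simp: W_def)
  have "carrier A \<subseteq> extensional Reps \<inter> W 0"
  proof (rule A_induct)
    show "rat_subalgebra Reps (extensional Reps \<inter> W 0)"
    proof (rule rat_subalgebraI)
      fix f :: "('a \<Rightarrow> complex^'m^'m) \<Rightarrow> complex" and q :: rat
      assume f: "f \<in> extensional Reps \<inter> W 0"
      have "(\<lambda>r\<in>Reps. (\<lambda>r\<in>Reps. of_rat q) r * f r) \<in> W (0 + 0)"
        using f by (intro W_mult W_const) auto
      thus "(\<lambda>r\<in>Reps. of_rat q * f r) \<in> extensional Reps \<inter> W 0"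
        by (simp cong: restrict_cong)
    qed (use W_add W_const W_mult[of _ 0 _ 0] in auto)
    fix i j g assume g: "g \<in> carrier G"
    obtain M where "leading_term (\<lambda>t. r t g) 1 M"
      using D.lower_central_leading_term[of 1 g] g by auto
    hence "((\<lambda>t. r t g) \<longlongrightarrow> mat 1) (at 0)" by (intro leading_term_tendsto[of 1]) auto
    hence "((\<lambda>t. coord G i j g (r t)) \<longlongrightarrow> mat 1 $ i $ j) (at 0)"
      using rep by (auto simp: coord_def intro!: tendsto_intros)
    hence "coord G i j g \<in> W 0"
      unfolding W_def by (auto intro!: bigoI_tendsto)
    thus "coord G i j g \<in> extensional Reps \<inter> W 0" by (simp add: coord_def)
  qed
  hence A: "f \<in> W 0" if "f \<in> carrier A" for f using that by blast
  have "J \<subseteq> carrier A \<inter> W 1"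
    unfolding rep_ideal_def
  proof (rule A.genideal_minimal)
    show "ideal (carrier A \<inter> W 1) A"
    proof (rule ideal_AI)
      show "(\<lambda>r\<in>Reps. 0) \<in> carrier A \<inter> W 1"
        using ideal_A_zero[OF A.oneideal] rep by (auto simp: W_def)
      fix f g assume "f \<in> carrier A \<inter> W 1" "g \<in> carrier A"
      thus "(\<lambda>r\<in>Reps. f r * g r) \<in> carrier A \<inter> W 1"
        using A_mult W_mult[of f 1 g 0] A by auto
    qed (use A_add W_add in auto)
    show "{shifted_coord G i j (x l) | i j l. l \<in> {1..n}} \<subseteq> carrier A \<inter> W 1"
    proof clarify
      fix i j l assume l: "l \<in> {1..n}"
      have "((\<lambda>t. ((1 / t ^ 1) *\<^sub>R (r t (x l) - mat 1)) $ i $ j) \<longlongrightarrow> sl2_matrix p q (Y l) $ i $ j) (at 0)"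
        using D.leading_generators[OF l] unfolding leading_term_def by (intro tendsto_intros)
      moreover have "((1 / t ^ 1) *\<^sub>R (r t (x l) - mat 1)) $ i $ j
          = shifted_coord G i j (x l) (r t) / of_real t ^ 1" for t
        unfolding vector_scaleR_component shifted_coord_apply[OF rep]
        by (simp add: scaleR_conv_of_real)
      ultimately have "((\<lambda>t. shifted_coord G i j (x l) (r t) / of_real t ^ 1)
          \<longlongrightarrow> sl2_matrix p q (Y l) $ i $ j) (at 0)"
        by simp
      hence "shifted_coord G i j (x l) \<in> W 1"
        unfolding W_def by (auto intro!: bigoI_tendsto simp: eventually_at_filter)
      thus "shifted_coord G i j (x l) \<in> carrier A \<inter> W 1"
        using shifted_coord_in_A generators l by blast
    qed
  qed
  hence J: "f \<in> W 1" if "f \<in> J" for f using that by blast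
  have "J_power k \<subseteq> W k" for k
  proof (induction k)
    case 0
    thus ?case using A by (auto simp: J_power_0)
  next
    case (Suc k)
    show ?case unfolding J_power_Suc
    proof
      fix f assume "f \<in> ideal_prod A (J_power k) J"
      thus "f \<in> W (Suc k)"
      proof (induction f rule: ideal_prod.induct)
        case (prod f g)
        have "(\<lambda>r\<in>Reps. f r * g r) \<in> W (k + 1)"
          using prod Suc.IH J by (intro W_mult) blast+
        thus ?case by (simp only: A_simps Suc_eq_plus1)
      next
        case (sum f g)
        thus ?case using W_add[OF sum.IH] by (simp only: A_simps)
      qed
    qed
  qed
  thus ?thesis using f by (auto simp: W_def)
qed

end

lemma bigo_power_Suc_tendsto_zero:
  fixes f :: "real \<Rightarrow> complex"
  assumes "f \<in> O[at 0](\<lambda>t. of_real t ^ Suc k)" "j \<le> k"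
  shows "((\<lambda>t. (1 / t ^ j) *\<^sub>R f t) \<longlongrightarrow> 0) (at 0)"
proof -
  have "((\<lambda>t. of_real t ^ Suc (k - j)) \<longlongrightarrow> (0 :: complex)) (at (0 :: real))"
    by (auto intro!: tendsto_eq_intros)
  moreover have "eventually (\<lambda>t. of_real t ^ Suc (k - j) =
      (of_real t ^ Suc k / of_real t ^ j :: complex)) (at (0 :: real))"
    using assms(2) by (auto simp: eventually_at_filter power_diff Suc_diff_le)
  ultimately have "((\<lambda>t. of_real t ^ Suc k / of_real t ^ j) \<longlongrightarrow> (0 :: complex)) (at (0 :: real))"
    by (rule Lim_transform_eventually)
  moreover have "eventually (\<lambda>t. of_real t ^ j \<noteq> (0 :: complex)) (at (0 :: real))"
    unfolding eventually_at_filter by (intro always_eventually) simp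
  ultimately have "(\<lambda>t. of_real t ^ Suc k) \<in> o[at (0 :: real)](\<lambda>t. of_real t ^ j :: complex)"
    by (rule smalloI_tendsto)
  hence "f \<in> o[at 0](\<lambda>t. of_real t ^ j)"
    using assms(1) landau_o.big_small_trans by blast
  from smalloD_tendsto[OF this] show ?thesis
    by (simp add: scaleR_conv_of_real)
qed

text \<open>
  With \<open>g = x\<^sub>l\<inverse> \<sigma>(x\<^sub>l)\<close> one has \<open>\<rho>(g) - 1 = \<rho>(x\<^sub>l)\<inverse> (\<rho>(\<sigma>(x\<^sub>l)) - \<rho>(x\<^sub>l))\<close>, which is of order
  \<open>k + 1\<close> along every curve of representations. The detection theorem then moves \<open>g\<close> down the lower
  central series, one weight at a time, until weight \<open>k + 1\<close>.
\<close>

lemma rep_filtration_subset_andreadakis: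
  fixes F :: "('a, 'b) monoid_scheme"
  assumes F: "free_group_with_basis F n x" and card: "CARD('m::finite) \<ge> 2" and k: "k \<in> {1..4}"
  shows "rep_filtration TYPE('m) F n x k \<subseteq> andreadakis F k"
proof
  interpret finitely_generated_group F x n by (rule free_group_finitely_generated[OF F])
  interpret rep_ring F x n "TYPE('m)" ..
  obtain p q :: 'm where pq: "p \<noteq> q"
    using card by (metis One_nat_def UNIV_I card_le_Suc0_iff_eq finite not_less_eq_eq numeral_2_eq_2)
  fix \<sigma> assume \<sigma>: "\<sigma> \<in> rep_filtration TYPE('m) F n x k"
  hence Aut: "\<sigma> \<in> carrier (AutoGroup F)" by (simp add: rep_filtration_iff_cosets)
  have \<sigma>c: "\<sigma> g \<in> carrier F" if "g \<in> carrier F" for g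
    using Aut that by (auto simp: AutoGroup_carrier bij_betw_def)
  let ?N = "lower_central F (k + 1)"
  have "inv\<^bsub>F\<^esub> x l \<otimes>\<^bsub>F\<^esub> \<sigma> (x l) \<in> ?N" if l: "l \<in> {1..n}" for l
  proof -
    have xl: "x l \<in> carrier F" using generators l by blast
    let ?g = "inv\<^bsub>F\<^esub> x l \<otimes>\<^bsub>F\<^esub> \<sigma> (x l)"
    have g: "?g \<in> carrier F" using xl \<sigma>c by simp
    have lead: "leading_term (\<lambda>t. r t ?g) j 0"
      if D: "SL_deformation F x n r p q Y" and j: "j \<le> k" for r :: "real \<Rightarrow> 'a \<Rightarrow> complex^'m^'m" and Y j
    proof -
      interpret D: SL_deformation F x n r p q Y by fact
      let ?d = "\<lambda>t. r t (\<sigma> (x l)) - r t (x l)"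
      have "(\<lambda>t. ?d t $ i $ i') \<in> O[at 0](\<lambda>t. of_real t ^ Suc k)" for i i'
      proof -
        let ?f = "\<lambda>r\<in>Reps. aut_act F \<sigma> (shifted_coord F i i' (x l)) r - shifted_coord F i i' (x l) r"
        have "?f \<in> J_power (k + 1)"
          using rep_filtrationD[OF \<sigma>] shifted_coord_in_J[OF xl] by blast
        hence "(\<lambda>t. ?f (r t)) \<in> O[at 0](\<lambda>t. of_real t ^ (k + 1))"
          by (rule J_power_bigo[OF D])
        moreover have "?f (r t) = ?d t $ i $ i'" for t
          using D.rep[of t] compose_rep_variety[OF is_group Aut D.rep[of t]] xl
          by (simp add: aut_act_def shifted_coord_apply compose_def)
        ultimately show ?thesis by simp
      qed
      hence "((\<lambda>t. (1 / t ^ j) *\<^sub>R ?d t) \<longlongrightarrow> 0) (at 0)"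
        using bigo_power_Suc_tendsto_zero[OF _ j] by (intro vec_tendstoI) simp
      moreover have "((\<lambda>t. r t (inv\<^bsub>F\<^esub> x l)) \<longlongrightarrow> mat 1) (at 0)"
      proof -
        obtain M where "leading_term (\<lambda>t. r t (inv\<^bsub>F\<^esub> x l)) 1 M"
          using D.lower_central_leading_term[of 1 "inv\<^bsub>F\<^esub> x l"] xl by auto
        thus ?thesis by (intro leading_term_tendsto[of 1]) auto
      qed
      ultimately have "((\<lambda>t. r t (inv\<^bsub>F\<^esub> x l) ** ((1 / t ^ j) *\<^sub>R ?d t)) \<longlongrightarrow> mat 1 ** 0) (at 0)"
        by (intro tendsto_matrix_mult)
      moreover have "r t (inv\<^bsub>F\<^esub> x l) ** ?d t = r t ?g - mat 1" for t
      proof -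
        have "r t (inv\<^bsub>F\<^esub> x l) ** r t (x l) = mat 1"
          using xl D.rep_one by (simp flip: D.rep_mult)
        thus ?thesis using xl \<sigma>c by (simp add: D.rep_mult matrix_mult_diff_distrib)
      qed
      ultimately show ?thesis by (simp add: leading_term_def scaleR_matrix_mult)
    qed
    have "?g \<in> lower_central F (Suc j)" if "j \<le> k" for j
      using that
    proof (induction j)
      case 0
      thus ?case using g by simp
    next
      case (Suc j)
      thus ?case
        using k lead by (intro lower_central_detected_by_SL[OF F pq, of "Suc j"]) auto
    qed
    thus ?thesis by simp
  qed
  hence "x ` {1..n} \<subseteq> {g \<in> carrier F. inv\<^bsub>F\<^esub> g \<otimes>\<^bsub>F\<^esub> \<sigma> g \<in> ?N}"
    using generators by auto
  hence "generate F (x ` {1..n}) \<subseteq> {g \<in> carrier F. inv\<^bsub>F\<^esub> g \<otimes>\<^bsub>F\<^esub> \<sigma> g \<in> ?N}"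
    using Aut by (intro generate_subgroup_incl subgroup_trivial_displacement lower_central_normal)
      (auto simp: AutoGroup_carrier)
  thus "\<sigma> \<in> andreadakis F k"
    using Aut generate by (auto simp: andreadakis_iff)
qed

section \<open>The comparison theorem\<close>

theorem theorem6p3:
  fixes F :: "('a, 'b) monoid_scheme" and n :: nat and x :: "nat \<Rightarrow> 'a"
  assumes "free_group_with_basis F n x"
    and "CARD('m::finite) \<ge> 2"
  shows "\<forall>k\<in>{1..4}. rep_filtration TYPE('m) F n x k = andreadakis F k"
proof
  fix k :: nat assume k: "k \<in> {1..4}"
  interpret finitely_generated_group F x n by (rule free_group_finitely_generated[OF assms(1)])
  interpret rep_ring F x n "TYPE('m)" ..
  show "rep_filtration TYPE('m) F n x k = andreadakis F k"
    using rep_filtration_subset_andreadakis[OF assms k] andreadakis_subset_rep_filtration by blast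
qed

end
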